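(* Let $P(x,D)=\sum_{|\alpha|\le m}c_\alpha(x)D^\alpha$ be a differential operator with coefficients $c_\alpha\in\mathcal{G}_\infty(\mathbb{R}^n)$. Assume that there exist $a\in\mathbb{R}$, $0\le m'\le m$, $R>0$ and a representative $(P_\varepsilon)_\varepsilon$ of $P$ such that: (i) $|P_\varepsilon|^{(m)}_{\alpha,\beta}=O(\varepsilon^a)$ for all $\alpha,\beta\in\mathbb{N}^n$; (ii) there exists $c>0$ such that $|P_\varepsilon(x,\xi)|\ge c\,\varepsilon^{a}\langle\xi\rangle^{m'}$ for all $x\in\mathbb{R}^n$, $|\xi|\ge R$ and $\varepsilon\in(0,1]$; (iii) for all $\alpha,\beta\in\mathbb{N}^n$ there exists a net $(c_{\alpha,\beta,\varepsilon})_\varepsilon$ with $c_{\alpha,\beta,\varepsilon}=O(1)$ such that $|\partial^\alpha_\xi\partial^\beta_xP_\varepsilon(x,\xi)|\le c_{\alpha,\beta,\varepsilon}|P_\varepsilon(x,\xi)|\langle\xi\rangle^{-|\alpha|}$ for all $x\in\mathbb{R}^n$, $|\xi|\ge R$ and $\varepsilon\in(0,1]$. Then for all $x_0\in\mathbb{R}^n$ there exist a neighborhood $\Omega$ of $x_0$ and a cut-off function $\phi\in\mathcal{C}^\infty_c(\Omega)$, identically $1$ near $x_0$, such that: - for every $f\in\mathcal{G}(\mathbb{R}^n)$ there exists $u\in\mathcal{G}(\Omega)$ with $P(x,D)u=\phi f$ on $\Omega$; and - for every $f\in\mathcal{G}^\infty(\mathbb{R}^n)$ there exists $u\in\mathcal{G}^\infty(\Omega)$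 with $P(x,D)u=\phi f$ on $\Omega$.
   Context: All nets are indexed by $\varepsilon\in(0,1]$ and $O(\cdot)$ refers to $\varepsilon\to0$. For a locally convex space $E$ with seminorms $\{p_i\}$: $\mathcal{M}_E$ is the set of nets $(u_\varepsilon)_\varepsilon\in E^{(0,1]}$ such that for every $i$ there is $N\in\mathbb{N}$ with $p_i(u_\varepsilon)=O(\varepsilon^{-N})$; $\mathcal{N}_E$ is the set of nets with $p_i(u_\varepsilon)=O(\varepsilon^q)$ for all $i$ and all $q\in\mathbb{N}$; $\mathcal{G}_E=\mathcal{M}_E/\mathcal{N}_E$. $\mathcal{G}(\Omega)=\mathcal{G}_{\mathcal{C}^\infty(\Omega)}$ for $\Omega\subseteq\mathbb{R}^n$ open; $\mathcal{G}^\infty(\Omega)$ is the subalgebra of those $u\in\mathcal{G}(\Omega)$ having a representative $(u_\varepsilon)_\varepsilon$ such that for all $K\Subset\Omega$ there is $N\in\mathbb{N}$ such that for all $\alpha\in\mathbb{N}^n$, $\sup_{x\in K}|\partial^\alpha u_\varepsilon(x)|=O(\varepsilon^{-N})$. $\mathcal{G}_\infty(\mathbb{R}^n)=\mathcal{G}_E$ with $E=\bigcap_sW^{s,\infty}(\mathbb{R}^n)$. Operations on generalized functions are defined componentwise on representatives. A representative of $P$ is a net $P_\varepsilon(x,\xi)=\sum_{|\alpha|\le m}c_{\alpha,\varepsilon}(x)\xi^\alpha$ with $(c_{\alpha,\varepsilon})_\varepsilon$ a representative of $c_\alpha$; $D=-i\partial$; $|a|^{(m)}_{\alpha,\beta}=\sup_{(x,\xi)\in\mathbb{R}^{2n}}\langle\xi\rangle^{-m+|\alpha|}|\partial_\xi^\alpha\partial_x^\beta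 a(x,\xi)|$, $\langle\xi\rangle=(1+|\xi|^2)^{1/2}$. *)

theory Defs
  imports "HOL-Analysis.Analysis" "HOL-Library.Landau_Symbols"
    "HOL-Probability.Essential_Supremum"
begin

type_synonym 'n cfun = "(real, 'n) vec \<Rightarrow> complex"
type_synonym 'n multiindex = "'n \<Rightarrow> nat"

text \<open>Nets indexed by (0,1] are total functions on the reals; only their values on (0,1] matter.\<close>

type_synonym 'e net = "real \<Rightarrow> 'e"

definition mi_order :: "'n::finite multiindex \<Rightarrow> nat" where
  "mi_order \<alpha> = (\<Sum>i\<in>UNIV. \<alpha> i)"

definition partial :: "'n::finite \<Rightarrow> 'n cfun \<Rightarrow> 'n cfun" where
  "partial i f = (\<lambda>x. frechet_derivative f (at x) (axis i 1))"

lemma multiindex_list_exists: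
  fixes \<alpha> :: "'n::finite multiindex"
  shows "\<exists>is. \<forall>i. count_list is i = \<alpha> i"
proof -
  have "finite A \<Longrightarrow> \<exists>is. \<forall>i. count_list is i = (if i \<in> A then \<alpha> i else 0)" for A :: "'n set"
  proof (induction A rule: finite_induct)
    case empty
    show ?case by (rule exI[of _ "[]"]) simp
  next
    case (insert a A)
    then obtain js where js: "\<forall>i. count_list js i = (if i \<in> A then \<alpha> i else 0)" by blast
    have rep: "count_list (replicate k a) i = (if i = a then k else 0)" for k i
      by (induction k) auto
    show ?case
      by (rule exI[of _ "replicate (\<alpha> a) a @ js"]) (use js insert rep in auto)
  qed
  from this[of UNIV] show ?thesis by simp
qed

text \<open>The index type carries no order, so the order in which the partial derivatives of a
  multi-index are taken is chosen arbitrarily. It is only applied to smooth functions, for which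
  the order is irrelevant.\<close>

definition mpartial :: "'n::finite multiindex \<Rightarrow> 'n cfun \<Rightarrow> 'n cfun" where
  "mpartial \<alpha> = foldr partial (SOME is. \<forall>i. count_list is i = \<alpha> i)"

text \<open>The space of smooth functions on an open set; functions are total, and the values outside
  of the open set are irrelevant (they are identified in the quotient below). Differentiability
  of all iterated partial derivatives contains their continuity.\<close>

definition smooth_on :: "(real^'n::finite) set \<Rightarrow> 'n cfun set" where
  "smooth_on \<Omega> = {f. \<forall>is. foldr partial is f differentiable_on \<Omega>}"

definition test_functions :: "(real^'n::finite) set \<Rightarrow> 'n cfun set" where
  "test_functions \<Omega> = {\<phi> \<in> smooth_on UNIV.
     compact (closure {x. \<phi> x \<noteq> 0}) \<and> closure {x. \<phi> x \<noteq> 0} \<subseteq> \<Omega>}"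

text \<open>A locally convex space is given by its carrier \<open>E\<close> and its set \<open>S\<close> of seminorms.\<close>

definition moderate_nets :: "'e set \<Rightarrow> ('e \<Rightarrow> real) set \<Rightarrow> 'e net set" where
  "moderate_nets E S = {u. (\<forall>\<epsilon>\<in>{0<..1}. u \<epsilon> \<in> E) \<and>
     (\<forall>p\<in>S. \<exists>N::nat. (\<lambda>\<epsilon>. p (u \<epsilon>)) \<in> O[at_right 0](\<lambda>\<epsilon>. \<epsilon> powr (- real N)))}"

definition negligible_nets :: "'e set \<Rightarrow> ('e \<Rightarrow> real) set \<Rightarrow> 'e net set" where
  "negligible_nets E S = {u. (\<forall>\<epsilon>\<in>{0<..1}. u \<epsilon> \<in> E) \<and>
     (\<forall>p\<in>S. \<forall>q::nat. (\<lambda>\<epsilon>. p (u \<epsilon>)) \<in> O[at_right 0](\<lambda>\<epsilon>. \<epsilon> ^ q))}"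

definition colombeau_rel :: "'e::minus set \<Rightarrow> ('e \<Rightarrow> real) set \<Rightarrow> 'e net rel" where
  "colombeau_rel E S = {(u, v). u \<in> moderate_nets E S \<and> v \<in> moderate_nets E S \<and>
     (\<lambda>\<epsilon>. u \<epsilon> - v \<epsilon>) \<in> negligible_nets E S}"

definition colombeau :: "'e::minus set \<Rightarrow> ('e \<Rightarrow> real) set \<Rightarrow> 'e net set set" where
  "colombeau E S = moderate_nets E S // colombeau_rel E S"

text \<open>Nonempty compact sets suffice, and the supremum over the empty set is unspecified
  for the reals.\<close>

definition compact_seminorm :: "(real^'n::finite) set \<Rightarrow> 'n multiindex \<Rightarrow> 'n cfun \<Rightarrow> real" where
  "compact_seminorm K \<alpha> f = (SUP x\<in>K. cmod (mpartial \<alpha> f x))"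

definition smooth_seminorms :: "(real^'n::finite) set \<Rightarrow> ('n cfun \<Rightarrow> real) set" where
  "smooth_seminorms \<Omega> =
     {compact_seminorm K \<alpha> | K \<alpha>. compact K \<and> K \<noteq> {} \<and> K \<subseteq> \<Omega>}"

definition gf_rel :: "(real^'n::finite) set \<Rightarrow> 'n cfun net rel" where
  "gf_rel \<Omega> = colombeau_rel (smooth_on \<Omega>) (smooth_seminorms \<Omega>)"

definition gf :: "(real^'n::finite) set \<Rightarrow> 'n cfun net set set" where
  "gf \<Omega> = colombeau (smooth_on \<Omega>) (smooth_seminorms \<Omega>)"

definition gf_regular :: "(real^'n::finite) set \<Rightarrow> 'n cfun net set set" where
  "gf_regular \<Omega> = {U \<in> gf \<Omega>. \<exists>u\<in>U. \<forall>K. compact K \<and> K \<noteq> {} \<and> K \<subseteq> \<Omega> \<longrightarrow>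
     (\<exists>N::nat. \<forall>\<alpha>. (\<lambda>\<epsilon>. compact_seminorm K \<alpha> (u \<epsilon>)) \<in> O[at_right 0](\<lambda>\<epsilon>. \<epsilon> powr (- real N)))}"

definition L_infty :: "'n::finite cfun set" where
  "L_infty = {f \<in> borel_measurable lebesgue. esssup lebesgue (\<lambda>x. ereal (cmod (f x))) < \<infinity>}"

definition L_infty_norm :: "'n::finite cfun \<Rightarrow> real" where
  "L_infty_norm f = real_of_ereal (esssup lebesgue (\<lambda>x. ereal (cmod (f x))))"

definition is_weak_deriv :: "'n::finite multiindex \<Rightarrow> 'n cfun \<Rightarrow> 'n cfun \<Rightarrow> bool" where
  "is_weak_deriv \<alpha> f g \<longleftrightarrow> (\<forall>\<psi>\<in>test_functions UNIV.
     (LINT x|lebesgue. f x * mpartial \<alpha> \<psi> x) = (-1) ^ mi_order \<alpha> * (LINT x|lebesgue. g x * \<psi> x))"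

definition sobolev_infty :: "nat \<Rightarrow> 'n::finite cfun set" where
  "sobolev_infty s = {f \<in> L_infty. \<forall>\<alpha>. mi_order \<alpha> \<le> s \<longrightarrow> (\<exists>g\<in>L_infty. is_weak_deriv \<alpha> f g)}"

text \<open>Weak derivatives are unique almost everywhere, so the choice does not affect the norm.\<close>

definition sobolev_infty_norm :: "nat \<Rightarrow> 'n::finite cfun \<Rightarrow> real" where
  "sobolev_infty_norm s f =
     Max ((\<lambda>\<alpha>. L_infty_norm (SOME g. g \<in> L_infty \<and> is_weak_deriv \<alpha> f g)) ` {\<alpha>. mi_order \<alpha> \<le> s})"

text \<open>An element of the intersection of all \<open>sobolev_infty s\<close>, being a function modulo equality
  almost everywhere, has exactly one smooth representative (Sobolev embedding). We take that
  representative as the element, since symbols are evaluated pointwise.\<close>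

definition sobolev_infty_all :: "'n::finite cfun set" where
  "sobolev_infty_all = (\<Inter>s. sobolev_infty s) \<inter> smooth_on UNIV"

definition gf_infty :: "'n::finite cfun net set set" where
  "gf_infty = colombeau sobolev_infty_all (range sobolev_infty_norm)"

definition bracket :: "real^'n::finite \<Rightarrow> real" where
  "bracket \<xi> = sqrt (1 + (norm \<xi>)\<^sup>2)"

definition monomial_at :: "real^'n::finite \<Rightarrow> 'n multiindex \<Rightarrow> complex" where
  "monomial_at \<xi> \<alpha> = (\<Prod>i\<in>UNIV. complex_of_real (\<xi> $ i) ^ \<alpha> i)"

definition Dpartial :: "'n::finite multiindex \<Rightarrow> 'n cfun \<Rightarrow> 'n cfun" where
  "Dpartial \<alpha> f = (\<lambda>x. (- \<i>) ^ mi_order \<alpha> * mpartial \<alpha> f x)"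

text \<open>A differential operator of order at most \<open>m\<close> is given by its family \<open>c\<close> of coefficients, which
  are classes of nets; only the coefficients with index of order at most \<open>m\<close> matter.\<close>

definition coeff_representative ::
  "nat \<Rightarrow> ('n::finite multiindex \<Rightarrow> 'n cfun net set) \<Rightarrow> ('n multiindex \<Rightarrow> 'n cfun net) \<Rightarrow> bool" where
  "coeff_representative m c C \<longleftrightarrow> (\<forall>\<alpha>. mi_order \<alpha> \<le> m \<longrightarrow> C \<alpha> \<in> c \<alpha>)"

definition op_symbol ::
  "nat \<Rightarrow> ('n::finite multiindex \<Rightarrow> 'n cfun net) \<Rightarrow> real \<Rightarrow> real^'n \<Rightarrow> real^'n \<Rightarrow> complex" where
  "op_symbol m C \<epsilon> x \<xi> = (\<Sum>\<alpha> | mi_order \<alpha> \<le> m. C \<alpha> \<epsilon> x * monomial_at \<xi> \<alpha>)"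

definition symbol_deriv :: "'n::finite multiindex \<Rightarrow> 'n multiindex \<Rightarrow>
    (real^'n \<Rightarrow> real^'n \<Rightarrow> complex) \<Rightarrow> real^'n \<Rightarrow> real^'n \<Rightarrow> complex" where
  "symbol_deriv \<alpha> \<beta> a x \<xi> = mpartial \<alpha> (\<lambda>\<eta>. mpartial \<beta> (\<lambda>y. a y \<eta>) x) \<xi>"

definition symbol_seminorm :: "nat \<Rightarrow> 'n::finite multiindex \<Rightarrow> 'n multiindex \<Rightarrow>
    (real^'n \<Rightarrow> real^'n \<Rightarrow> complex) \<Rightarrow> real" where
  "symbol_seminorm m \<alpha> \<beta> a =
     (SUP (x, \<xi>)\<in>UNIV. bracket \<xi> powr (- real m + real (mi_order \<alpha>)) * cmod (symbol_deriv \<alpha> \<beta> a x \<xi>))"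

definition apply_op_rep :: "nat \<Rightarrow> ('n::finite multiindex \<Rightarrow> 'n cfun net) \<Rightarrow> 'n cfun net \<Rightarrow> 'n cfun net" where
  "apply_op_rep m C u = (\<lambda>\<epsilon> x. \<Sum>\<alpha> | mi_order \<alpha> \<le> m. C \<alpha> \<epsilon> x * Dpartial \<alpha> (u \<epsilon>) x)"

text \<open>The operations on classes are the unions of the results over all representatives; they
  are elements of \<open>gf \<Omega>\<close>, since all representatives yield the same class.\<close>

definition apply_op :: "nat \<Rightarrow> ('n::finite multiindex \<Rightarrow> 'n cfun net set) \<Rightarrow> (real^'n) set \<Rightarrow>
    'n cfun net set \<Rightarrow> 'n cfun net set" where
  "apply_op m c \<Omega> U =
     (\<Union>C\<in>{C. coeff_representative m c C}. \<Union>u\<in>U. gf_rel \<Omega> `` {apply_op_rep m C u})"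

text \<open>No explicit restriction of \<open>f\<close> to \<open>\<Omega>\<close> is needed: the relation on \<open>\<Omega>\<close> ignores values off \<open>\<Omega>\<close>.\<close>

definition mult_restrict :: "(real^'n::finite) set \<Rightarrow> 'n cfun \<Rightarrow> 'n cfun net set \<Rightarrow> 'n cfun net set" where
  "mult_restrict \<Omega> \<phi> F = (\<Union>f\<in>F. gf_rel \<Omega> `` {\<lambda>\<epsilon> x. \<phi> x * f \<epsilon> x})"

end

theory Submission
  imports Defs "HOL-Computational_Algebra.Polynomial" "HOL-Probability.Characteristic_Functions"
begin

text \<open>
  Only condition (iii) with \<open>\<alpha> = 0\<close> and the lower bound (ii) are used. Condition (iii) says that
  \<open>log P\<^sub>\<epsilon>(x, \<xi>)\<close> has bounded derivatives in \<open>x\<close>, uniformly in \<open>|\<xi>| \<ge> R\<close>. So \<open>P\<^sub>\<epsilon>\<close> has constant strength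
  near \<open>x\<^sub>0\<close>, and \<open>q(x, \<xi>) = P\<^sub>\<epsilon>(x, \<xi>) / P\<^sub>\<epsilon>(x\<^sub>0, \<xi>) - 1\<close> is a small perturbation near \<open>x\<^sub>0\<close>. In
  place of a pseudodifferential parametrix, put the problem on a small torus of side length \<open>2 \<pi> / M\<close>,
  with the shifted frequencies \<open>\<xi>\<^sub>k = M (k + 1/2)\<close>, which all satisfy \<open>|\<xi>\<^sub>k| \<ge> R\<close> once \<open>M \<ge> 2 R\<close>. With
  \<open>u = \<Sum>\<^sub>k v\<^sub>k / P\<^sub>\<epsilon>(x\<^sub>0, \<xi>\<^sub>k) exp (i \<xi>\<^sub>k x)\<close> the equation \<open>P u = \<phi> f\<close> turns into
  \<open>\<Sum>\<^sub>k v\<^sub>k (1 + q(x, \<xi>\<^sub>k)) exp (i \<xi>\<^sub>k x) = \<phi> f\<close>. After cutting off \<open>q\<close> and expanding it into a Fourier series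
  in \<open>x\<close>, this is a matrix equation for \<open>v\<close> with a perturbation of norm \<open>O(1 / M)\<close> on \<open>\<ell>\<^sup>1\<close>, which a
  Neumann series solves for all small \<open>\<epsilon>\<close>. The derivatives of \<open>u\<^sub>\<epsilon>\<close> are then bounded by
  \<open>\<epsilon> powr (- a)\<close> times derivatives of \<open>f\<^sub>\<epsilon>\<close>, with a power of \<open>\<epsilon>\<close> that does not depend on the order,
  so that both moderateness and regularity are inherited.
\<close>

section \<open>Smooth functions and iterated partial derivatives\<close>

lemma partial_cong:
  assumes "open S" "x \<in> S" "\<And>y. y \<in> S \<Longrightarrow> f y = g y"
  shows "partial i f x = partial i g x"
proof -
  have "(f has_derivative D) (at x) \<longleftrightarrow> (g has_derivative D) (at x)" for D
    using assms has_derivative_transform_within_open[OF _ assms(1,2)] by metis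
  then show ?thesis unfolding partial_def frechet_derivative_def by simp
qed

lemma foldr_partial_cong:
  assumes "open S" "x \<in> S" "\<And>y. y \<in> S \<Longrightarrow> f y = g y"
  shows "foldr partial is f x = foldr partial is g x"
  using assms(2)
proof (induction "is" arbitrary: x)
  case (Cons i "is")
  then show ?case unfolding foldr.simps o_apply by (intro partial_cong[OF assms(1)])
qed (use assms in simp)

lemma partial_eqI:
  assumes "(f has_derivative D) (at x)"
  shows "partial i f x = D (axis i 1)"
  unfolding partial_def using frechet_derivative_at[OF assms] by simp

lemma differentiable_on_cong:
  assumes "f differentiable_on S" "\<And>x. x \<in> S \<Longrightarrow> f x = g x"
  shows "g differentiable_on S"
  using assms unfolding differentiable_on_def
  by (meson differentiable_transform_within zero_less_one)

lemma smooth_on_coinduct: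
  assumes S: "open S" and "X f"
    and step: "\<And>f. X f \<Longrightarrow> f differentiable_on S \<and> (\<forall>i. \<exists>g. X g \<and> (\<forall>x\<in>S. partial i f x = g x))"
  shows "f \<in> smooth_on S"
proof -
  have "\<exists>g. X g \<and> (\<forall>x\<in>S. foldr partial is f x = g x)" for "is"
  proof (induction "is")
    case Nil then show ?case using \<open>X f\<close> by auto
  next
    case (Cons i "is")
    then obtain g where g: "X g" "\<forall>x\<in>S. foldr partial is f x = g x" by blast
    from step[OF g(1)] obtain h where h: "X h" "\<forall>x\<in>S. partial i g x = h x" by blast
    have "partial i (foldr partial is f) x = partial i g x" if "x \<in> S" for x
      using partial_cong[OF S that] g(2) by blast
    then show ?case using h by auto
  qed
  then have "foldr partial is f differentiable_on S" for "is"
    using step differentiable_on_cong by metis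
  then show ?thesis by (simp add: smooth_on_def)
qed

lemma smooth_on_differentiable:
  assumes "f \<in> smooth_on S"
  shows "f differentiable_on S"
  using assms unfolding smooth_on_def by (auto dest: spec[of _ "[]"])

lemma smooth_on_foldr_partial:
  assumes "f \<in> smooth_on S"
  shows "foldr partial is f \<in> smooth_on S"
  using assms unfolding smooth_on_def by (simp flip: foldr_append)

lemma smooth_on_partial:
  assumes "f \<in> smooth_on S"
  shows "partial i f \<in> smooth_on S"
  using smooth_on_foldr_partial[OF assms, of "[i]"] by simp

lemma smooth_on_continuous:
  assumes "f \<in> smooth_on S"
  shows "continuous_on S (foldr partial is f)"
  using smooth_on_differentiable[OF smooth_on_foldr_partial[OF assms]]
  by (rule differentiable_imp_continuous_on)

lemma smooth_on_subset:
  "f \<in> smooth_on S \<Longrightarrow> T \<subseteq> S \<Longrightarrow> f \<in> smooth_on T"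
  unfolding smooth_on_def by (auto intro: differentiable_on_subset)

lemma smooth_on_frechet:
  assumes "f \<in> smooth_on S" "open S" "x \<in> S"
  shows "(f has_derivative (\<lambda>h. \<Sum>i\<in>UNIV. h $ i *\<^sub>R partial i f x)) (at x)"
proof -
  have "f differentiable at x"
    using smooth_on_differentiable[OF assms(1)] assms(2,3) by (simp add: differentiable_on_eq_differentiable_at)
  then obtain D where D: "(f has_derivative D) (at x)" by (auto simp: differentiable_def)
  interpret bounded_linear D using D by (rule has_derivative_bounded_linear)
  have "D h = (\<Sum>i\<in>UNIV. h $ i *\<^sub>R partial i f x)" for h
  proof -
    have "D h = D (\<Sum>i\<in>UNIV. h $ i *\<^sub>R axis i 1)"
      using basis_expansion[of h] by (simp add: scalar_mult_eq_scaleR)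
    also have "\<dots> = (\<Sum>i\<in>UNIV. h $ i *\<^sub>R D (axis i 1))" by (simp add: sum scaleR)
    finally show ?thesis by (simp add: partial_eqI[OF D])
  qed
  then show ?thesis using D by (metis (no_types, lifting) ext)
qed

lemma has_derivative_differentiable_on:
  assumes "open S" "\<And>x. x \<in> S \<Longrightarrow> (f has_derivative D x) (at x)"
  shows "f differentiable_on S"
  using assms by (meson differentiable_at_withinI differentiable_def differentiable_on_def)

lemma smooth_on_differentiable_at:
  assumes "f \<in> smooth_on S" "open S" "x \<in> S"
  shows "f differentiable at x"
  using smooth_on_frechet[OF assms] by (auto simp: differentiable_def)

lemma partial_const [simp]: "partial i (\<lambda>x. c) = (\<lambda>x. 0)"
  by (rule ext) (rule partial_eqI[OF has_derivative_const])

lemma partial_add: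
  assumes "f differentiable at x" "g differentiable at x"
  shows "partial i (\<lambda>x. f x + g x) x = partial i f x + partial i g x"
  unfolding partial_def
  by (subst frechet_derivative_at[OF has_derivative_add[OF assms[unfolded frechet_derivative_works]], symmetric]) simp

lemma partial_mult:
  assumes "f differentiable at x" "g differentiable at x"
  shows "partial i (\<lambda>x. f x * g x) x = f x * partial i g x + partial i f x * g x"
  unfolding partial_def
  by (subst frechet_derivative_at[OF has_derivative_mult[OF assms[unfolded frechet_derivative_works]], symmetric]) simp

lemma partial_cmult:
  assumes "f differentiable at x"
  shows "partial i (\<lambda>x. c * f x) x = c * partial i f x"
  using partial_mult[of "\<lambda>_. c" x f i] assms by simp

lemma smooth_on_add:
  assumes "open S" "f \<in> smooth_on S" "g \<in> smooth_on S"
  shows "(\<lambda>x. f x + g x) \<in> smooth_on S"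
proof (rule smooth_on_coinduct[OF assms(1), where X = "\<lambda>h. \<exists>f g. f \<in> smooth_on S \<and> g \<in> smooth_on S \<and> h = (\<lambda>x. f x + g x)"])
  fix h assume "\<exists>f g. f \<in> smooth_on S \<and> g \<in> smooth_on S \<and> h = (\<lambda>x. f x + g x)"
  then obtain f g where h: "f \<in> smooth_on S" "g \<in> smooth_on S" "h = (\<lambda>x. f x + g x)" by blast
  have "\<exists>k. (\<exists>f g. f \<in> smooth_on S \<and> g \<in> smooth_on S \<and> k = (\<lambda>x. f x + g x)) \<and> (\<forall>x\<in>S. partial i h x = k x)" for i
    by (rule exI[of _ "\<lambda>x. partial i f x + partial i g x"])
       (use h smooth_on_partial smooth_on_differentiable_at[OF _ assms(1)] partial_add in blast)
  then show "h differentiable_on S \<and> (\<forall>i. \<exists>k. (\<exists>f g. f \<in> smooth_on S \<and> g \<in> smooth_on S \<and> k = (\<lambda>x. f x + g x)) \<and> (\<forall>x\<in>S. partial i h x = k x))"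
    using h smooth_on_differentiable by (auto intro!: differentiable_on_add)
qed (use assms in blast)

lemma smooth_on_const [simp]: "(\<lambda>x::real^'a::finite. c) \<in> smooth_on S"
proof -
  have "\<exists>d. foldr partial is (\<lambda>x::real^'a. c) = (\<lambda>x. d)" for "is" by (induction "is") auto
  then have "foldr partial is (\<lambda>x. c) differentiable_on S" for "is"
    by (metis differentiable_on_const)
  then show ?thesis unfolding smooth_on_def by simp
qed

lemma smooth_on_sum:
  assumes "open S" "\<And>a. a \<in> A \<Longrightarrow> f a \<in> smooth_on S"
  shows "(\<lambda>x. \<Sum>a\<in>A. f a x) \<in> smooth_on S"
  using assms(2)
  by (induction A rule: infinite_finite_induct) (auto intro: smooth_on_add assms(1))

inductive sum_of_products :: "'n::finite cfun set \<Rightarrow> 'n cfun set \<Rightarrow> 'n cfun \<Rightarrow> bool" for A B where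
  prod: "f \<in> A \<Longrightarrow> g \<in> B \<Longrightarrow> sum_of_products A B (\<lambda>x. f x * g x)"
| plus: "sum_of_products A B f \<Longrightarrow> sum_of_products A B g \<Longrightarrow> sum_of_products A B (\<lambda>x. f x + g x)"

lemma smooth_on_sum_of_products:
  assumes S: "open S"
    and A: "\<And>f x. f \<in> A \<Longrightarrow> x \<in> S \<Longrightarrow> f differentiable at x"
    and B: "\<And>f x. f \<in> B \<Longrightarrow> x \<in> S \<Longrightarrow> f differentiable at x"
    and step: "\<And>f g i. f \<in> A \<Longrightarrow> g \<in> B \<Longrightarrow>
        \<exists>k. sum_of_products A B k \<and> (\<forall>x\<in>S. f x * partial i g x + partial i f x * g x = k x)"
    and "sum_of_products A B h"
  shows "h \<in> smooth_on S"
proof (rule smooth_on_coinduct[OF S, where X = "sum_of_products A B"])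
  fix f assume "sum_of_products A B f"
  then have "(\<forall>x\<in>S. f differentiable at x) \<and> (\<forall>i. \<exists>g. sum_of_products A B g \<and> (\<forall>x\<in>S. partial i f x = g x))"
  proof induction
    case (prod f g)
    have "\<exists>k. sum_of_products A B k \<and> (\<forall>x\<in>S. partial i (\<lambda>x. f x * g x) x = k x)" for i
      using step[OF prod, of i] partial_mult[OF A[OF prod(1)] B[OF prod(2)]] by simp
    then show ?case using A B prod by (auto intro!: differentiable_mult)
  next
    case (plus f g)
    have "\<exists>k. sum_of_products A B k \<and> (\<forall>x\<in>S. partial i (\<lambda>x. f x + g x) x = k x)" for i
    proof -
      from plus obtain h k where "sum_of_products A B h" "(\<forall>x\<in>S. partial i f x = h x)"
        "sum_of_products A B k" "(\<forall>x\<in>S. partial i g x = k x)" by blast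
      with plus.IH show ?thesis
        by (intro exI[of _ "\<lambda>x. h x + k x"]) (auto simp: partial_add intro: sum_of_products.plus)
    qed
    then show ?case using plus.IH by (auto intro!: differentiable_add)
  qed
  then show "f differentiable_on S \<and> (\<forall>i. \<exists>g. sum_of_products A B g \<and> (\<forall>x\<in>S. partial i f x = g x))"
    by (auto simp: differentiable_on_eq_differentiable_at S)
qed (use assms in blast)

lemma smooth_on_mult:
  assumes S: "open S" and "f \<in> smooth_on S" "g \<in> smooth_on S"
  shows "(\<lambda>x. f x * g x) \<in> smooth_on S"
proof (rule smooth_on_sum_of_products[OF S, of "smooth_on S" "smooth_on S"])
  fix f g :: "'a cfun" and i
  assume fg: "f \<in> smooth_on S" "g \<in> smooth_on S"
  then have "sum_of_products (smooth_on S) (smooth_on S) (\<lambda>x. f x * partial i g x + partial i f x * g x)"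
    by (intro sum_of_products.intros smooth_on_partial)
  then show "\<exists>k. sum_of_products (smooth_on S) (smooth_on S) k \<and> (\<forall>x\<in>S. f x * partial i g x + partial i f x * g x = k x)"
    by blast
qed (use assms in \<open>blast intro: sum_of_products.intros smooth_on_differentiable_at\<close>)+

lemma smooth_on_diff:
  assumes "open S" "f \<in> smooth_on S" "g \<in> smooth_on S"
  shows "(\<lambda>x. f x - g x) \<in> smooth_on S"
  using smooth_on_add[OF assms(1,2) smooth_on_mult[OF assms(1) smooth_on_const[of "-1"] assms(3)]] by simp

lemma smooth_on_component: "(\<lambda>x. complex_of_real (x $ i)) \<in> smooth_on S"
proof -
  have d: "((\<lambda>x. complex_of_real (x $ i)) has_derivative (\<lambda>h. complex_of_real (h $ i))) (at x)" for x :: "real^'a"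
    by (intro has_derivative_of_real bounded_linear_imp_has_derivative bounded_linear_vec_nth)
  have p: "partial j (\<lambda>x. complex_of_real (x $ i)) = (\<lambda>_. complex_of_real ((axis j 1 :: real^'a) $ i))" for j
    by (rule ext) (rule partial_eqI[OF d])
  have "(\<lambda>x::real^'a. complex_of_real (x $ i)) \<in> smooth_on UNIV"
    by (rule smooth_on_coinduct[where X = "\<lambda>f. f = (\<lambda>x. complex_of_real (x $ i)) \<or> (\<exists>c. f = (\<lambda>x. c))"])
      (auto simp: p intro: has_derivative_differentiable_on[OF open_UNIV d] differentiable_on_const)
  then show ?thesis by (rule smooth_on_subset) simp
qed

lemma smooth_on_compose:
  fixes g :: "nat \<Rightarrow> real \<Rightarrow> real"
  assumes S: "open S" and f: "f \<in> smooth_on S"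
    and g: "\<And>j t. (g j has_real_derivative g (Suc j) t) (at t)"
  shows "(\<lambda>x. complex_of_real (g 0 (Re (f x)))) \<in> smooth_on S"
proof -
  define B where "B = range (\<lambda>j x. complex_of_real (g j (Re (f x))))"
  have d: "((\<lambda>x. complex_of_real (g j (Re (f x)))) has_derivative
      (\<lambda>h. complex_of_real (g (Suc j) (Re (f x)) * Re (\<Sum>i\<in>UNIV. h $ i *\<^sub>R partial i f x)))) (at x)" 
    if "x \<in> S" for x j
  proof -
    note d1 = smooth_on_frechet[OF f S that]
    have d2: "((\<lambda>x. Re (f x)) has_derivative (\<lambda>h. Re (\<Sum>i\<in>UNIV. h $ i *\<^sub>R partial i f x))) (at x)"
      by (rule bounded_linear.has_derivative[OF bounded_linear_Re d1])
    have d3: "((\<lambda>x. g j (Re (f x))) has_derivative (\<lambda>h. g (Suc j) (Re (f x)) * Re (\<Sum>i\<in>UNIV. h $ i *\<^sub>R partial i f x))) (at x)"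
      using has_derivative_compose[OF d2 g[unfolded has_field_derivative_def]] .
    show ?thesis by (rule has_derivative_of_real[OF d3])
  qed
  have p: "partial i (\<lambda>x. complex_of_real (g j (Re (f x)))) x = complex_of_real (Re (partial i f x)) * complex_of_real (g (Suc j) (Re (f x)))"
    if "x \<in> S" for x i j
  proof -
    have "(\<Sum>k\<in>UNIV. (axis i 1 :: real^'a) $ k *\<^sub>R partial k f x) = partial i f x"
      by (subst sum.remove[of _ i]) (auto simp: axis_def)
    then show ?thesis using partial_eqI[OF d[OF that, of j], of i] by simp
  qed
  define A where "A = {h. h \<in> smooth_on S}"
  have Re_smooth: "(\<lambda>x. complex_of_real (Re (h x))) \<in> smooth_on S" if "h \<in> smooth_on S" for h
  proof (rule smooth_on_coinduct[OF S, where X = "\<lambda>k. \<exists>h. h \<in> smooth_on S \<and> k = (\<lambda>x. complex_of_real (Re (h x)))"], goal_cases)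
    case (2 k)
    then obtain h where h: "h \<in> smooth_on S" "k = (\<lambda>x. complex_of_real (Re (h x)))" by blast
    have dd: "(k has_derivative (\<lambda>v. complex_of_real (Re (\<Sum>i\<in>UNIV. v $ i *\<^sub>R partial i h x)))) (at x)" if "x \<in> S" for x
      unfolding h(2)
      by (rule has_derivative_of_real[OF bounded_linear.has_derivative[OF bounded_linear_Re smooth_on_frechet[OF h(1) S that]]])
    have "partial i k x = complex_of_real (Re (partial i h x))" if "x \<in> S" for i x
    proof -
      have "(\<Sum>k\<in>UNIV. (axis i 1 :: real^'a) $ k *\<^sub>R partial k h x) = partial i h x"
        by (subst sum.remove[of _ i]) (auto simp: axis_def)
      then show ?thesis using partial_eqI[OF dd[OF that], of i] by simp
    qed
    then show ?case using smooth_on_partial[OF h(1)] has_derivative_differentiable_on[OF S dd] by blast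
  qed (use that in blast)
  have "sum_of_products A B (\<lambda>x. 1 * complex_of_real (g 0 (Re (f x))))"
    by (rule sum_of_products.prod) (auto simp: A_def B_def)
  then have "(\<lambda>x. 1 * complex_of_real (g 0 (Re (f x)))) \<in> smooth_on S"
  proof (rule smooth_on_sum_of_products[OF S, rotated -1], goal_cases)
    case (1 h x) then show ?case by (auto simp: A_def S intro: smooth_on_differentiable_at)
  next
    case (2 h x) then show ?case using d by (fastforce simp: B_def differentiable_def)
  next
    case (3 h k i)
    then obtain j where k: "k = (\<lambda>x. complex_of_real (g j (Re (f x))))" by (auto simp: B_def)
    have "(\<lambda>x. h x * complex_of_real (Re (partial i f x))) \<in> A" "partial i h \<in> A"
      using 3 f by (auto simp: A_def intro!: smooth_on_mult S Re_smooth smooth_on_partial)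
    then have "sum_of_products A B (\<lambda>x. h x * complex_of_real (Re (partial i f x)) * complex_of_real (g (Suc j) (Re (f x)))
       + partial i h x * k x)" 
      by (intro sum_of_products.intros) (auto simp: B_def k)
    moreover have "\<forall>x\<in>S. h x * partial i k x + partial i h x * k x = h x * complex_of_real (Re (partial i f x)) * complex_of_real (g (Suc j) (Re (f x)))
       + partial i h x * k x" using p by (simp add: k)
    ultimately show ?case by blast
  qed
  then show ?thesis by simp
qed

lemma has_real_derivative_line:
  fixes L :: "complex \<Rightarrow> real"
  assumes f: "f \<in> smooth_on S" "open S" and L: "bounded_linear L"
    and x: "a + s *\<^sub>R axis i 1 \<in> S"
  shows "((\<lambda>s. L (f (a + s *\<^sub>R axis i 1))) has_real_derivative L (partial i f (a + s *\<^sub>R axis i 1))) (at s)"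
proof -
  have 1: "((\<lambda>s. a + s *\<^sub>R axis i 1) has_derivative (\<lambda>h. h *\<^sub>R axis i 1)) (at s)"
    by (auto intro!: derivative_eq_intros)
  have 2: "(\<Sum>k\<in>UNIV. (h *\<^sub>R axis i 1 :: real^'a) $ k *\<^sub>R partial k f y) = h *\<^sub>R partial i f y" for h y
    by (subst sum.remove[of _ i]) (auto simp: axis_def)
  have "((\<lambda>s. f (a + s *\<^sub>R axis i 1)) has_derivative (\<lambda>h. h *\<^sub>R partial i f (a + s *\<^sub>R axis i 1))) (at s)"
    using has_derivative_compose[OF 1 smooth_on_frechet[OF f x]] unfolding 2 .
  from bounded_linear.has_derivative[OF L this]
  moreover have "L (h *\<^sub>R c) = L c * h" for h c
    using linear_scale[OF bounded_linear.linear[OF L], of h c] by simp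
  ultimately show ?thesis by (simp add: has_field_derivative_def)
qed

lemma second_difference:
  fixes f :: "'n::finite cfun" and L :: "complex \<Rightarrow> real"
  assumes f: "f \<in> smooth_on S" "open S" and L: "bounded_linear L" and h: "h > 0" "cball x (2 * h) \<subseteq> S"
  shows "\<exists>p\<in>cball x (2 * h). L (f (x + h *\<^sub>R axis i 1 + h *\<^sub>R axis j 1)) - L (f (x + h *\<^sub>R axis i 1))
      - L (f (x + h *\<^sub>R axis j 1)) + L (f x) = h\<^sup>2 * L (partial j (partial i f) p)"
proof -
  have inS: "x + s *\<^sub>R axis i 1 + t *\<^sub>R axis j 1 \<in> cball x (2 * h)" if "0 \<le> s" "s \<le> h" "0 \<le> t" "t \<le> h" for s t
  proof -
    have "norm (s *\<^sub>R axis i 1 + t *\<^sub>R axis j 1 :: real^'n) \<le> s + t"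
      using that by (intro norm_triangle_le) simp
    moreover have "dist x (x + v) = norm v" for v :: "real^'n" by (simp add: dist_norm)
    ultimately show ?thesis using that by (simp add: add.assoc)
  qed
  define \<phi> where "\<phi> s = L (f ((x + h *\<^sub>R axis j 1) + s *\<^sub>R axis i 1)) - L (f (x + s *\<^sub>R axis i 1))" for s
  have d\<phi>: "(\<phi> has_real_derivative
      (L (partial i f ((x + h *\<^sub>R axis j 1) + s *\<^sub>R axis i 1)) - L (partial i f (x + s *\<^sub>R axis i 1)))) (at s)"
    if "0 \<le> s" "s \<le> h" for s
  proof -
    have "x + h *\<^sub>R axis j 1 + s *\<^sub>R axis i 1 \<in> S" "x + s *\<^sub>R axis i 1 \<in> S"
      using subsetD[OF h(2) inS[OF that, of h]] subsetD[OF h(2) inS[OF that, of 0]] h(1) by (simp_all add: add.commute add.left_commute)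
    from DERIV_diff[OF has_real_derivative_line[OF f L this(1)] has_real_derivative_line[OF f L this(2)]]
    show ?thesis unfolding \<phi>_def .
  qed
  obtain s where s: "0 < s" "s < h" "\<phi> h - \<phi> 0 = (h - 0) *
      (L (partial i f ((x + h *\<^sub>R axis j 1) + s *\<^sub>R axis i 1)) - L (partial i f (x + s *\<^sub>R axis i 1)))"
    using MVT2[of 0 h, OF h(1) d\<phi>] by blast
  have d2: "((\<lambda>t. L (partial i f ((x + s *\<^sub>R axis i 1) + t *\<^sub>R axis j 1))) has_real_derivative
      L (partial j (partial i f) ((x + s *\<^sub>R axis i 1) + t *\<^sub>R axis j 1))) (at t)" if "0 \<le> t" "t \<le> h" for t
    by (rule has_real_derivative_line[OF smooth_on_partial[OF f(1)] f(2) L subsetD[OF h(2) inS]]) (use s that in simp_all)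
  obtain t where t: "0 < t" "t < h"
    "L (partial i f ((x + s *\<^sub>R axis i 1) + h *\<^sub>R axis j 1)) - L (partial i f ((x + s *\<^sub>R axis i 1) + 0 *\<^sub>R axis j 1))
      = (h - 0) * L (partial j (partial i f) ((x + s *\<^sub>R axis i 1) + t *\<^sub>R axis j 1))"
    using MVT2[of 0 h, OF h(1) d2] by blast
  show ?thesis
  proof (rule bexI[OF _ inS[of s t]])
    have e: "x + h *\<^sub>R axis j 1 + h *\<^sub>R axis i 1 = x + h *\<^sub>R axis i 1 + h *\<^sub>R axis j 1"
      "x + h *\<^sub>R axis j 1 + s *\<^sub>R axis i 1 = x + s *\<^sub>R axis i 1 + h *\<^sub>R axis j 1" by simp_all
    have "\<phi> h - \<phi> 0 = h * (h * L (partial j (partial i f) (x + s *\<^sub>R axis i 1 + t *\<^sub>R axis j 1)))"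
      using s(3) t(3) unfolding e by simp
    then show "L (f (x + h *\<^sub>R axis i 1 + h *\<^sub>R axis j 1)) - L (f (x + h *\<^sub>R axis i 1))
      - L (f (x + h *\<^sub>R axis j 1)) + L (f x) = h\<^sup>2 * L (partial j (partial i f) (x + s *\<^sub>R axis i 1 + t *\<^sub>R axis j 1))"
      unfolding \<phi>_def e by (simp add: power2_eq_square)
  qed (use s t in simp_all)
qed

lemma partial_commute:
  fixes f :: "'n::finite cfun"
  assumes f: "f \<in> smooth_on S" "open S" and x: "x \<in> S"
  shows "partial i (partial j f) x = partial j (partial i f) x"
proof -
  have *: "L (partial i (partial j f) x) = L (partial j (partial i f) x)" if L: "bounded_linear L" for L :: "complex \<Rightarrow> real"
  proof (rule ccontr)
    define A B where "A y = L (partial i (partial j f) y)" and "B y = L (partial j (partial i f) y)" for y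
    assume "\<not> ?thesis"
    then have e: "dist (A x) (B x) / 2 > 0" by (simp add: A_def B_def)
    have "continuous_on S A" "continuous_on S B" unfolding A_def B_def
      by (intro bounded_linear.continuous_on[OF L] differentiable_imp_continuous_on
          smooth_on_differentiable smooth_on_partial f)+
    then have "isCont A x" "isCont B x" using f(2) x by (simp_all add: continuous_on_eq_continuous_at)
    with e obtain d1 d2 where d: "d1 > 0" "\<And>y. dist y x < d1 \<Longrightarrow> dist (A y) (A x) < dist (A x) (B x) / 2"
       "d2 > 0" "\<And>y. dist y x < d2 \<Longrightarrow> dist (B y) (B x) < dist (A x) (B x) / 2"
      unfolding continuous_at_eps_delta by metis
    obtain r where r: "r > 0" "ball x r \<subseteq> S" using f(2) x by (meson openE)
    define h where "h = min r (min d1 d2) / 4"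
    have h: "h > 0" "2 * h < r" "2 * h < d1" "2 * h < d2" using r d by (auto simp: h_def min_def)
    have c: "cball x (2*h) \<subseteq> S" using h(2) by (intro order_trans[OF _ r(2)]) auto
    obtain p where p: "p \<in> cball x (2*h)" "L (f (x + h *\<^sub>R axis i 1 + h *\<^sub>R axis j 1)) - L (f (x + h *\<^sub>R axis i 1))
      - L (f (x + h *\<^sub>R axis j 1)) + L (f x) = h\<^sup>2 * B p"
      using second_difference[OF f L h(1) c, of i j] by (auto simp: B_def)
    obtain q where q: "q \<in> cball x (2*h)" "L (f (x + h *\<^sub>R axis j 1 + h *\<^sub>R axis i 1)) - L (f (x + h *\<^sub>R axis j 1))
      - L (f (x + h *\<^sub>R axis i 1)) + L (f x) = h\<^sup>2 * A q"
      using second_difference[OF f L h(1) c, of j i] by (auto simp: A_def)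
    have "x + h *\<^sub>R axis j 1 + h *\<^sub>R axis i 1 = x + h *\<^sub>R axis i 1 + h *\<^sub>R axis j 1" by simp
    from q(2)[unfolded this] p(2) have "h\<^sup>2 * A q = h\<^sup>2 * B p" by linarith
    then have "A q = B p" using h by simp
    moreover have "dist (A q) (A x) < dist (A x) (B x) / 2" "dist (B p) (B x) < dist (A x) (B x) / 2"
      using p(1) q(1) h d by (auto simp: dist_commute)
    ultimately show False by (metis dist_commute dist_triangle_half_r less_irrefl)
  qed
  show ?thesis using *[OF bounded_linear_Re] *[OF bounded_linear_Im] by (simp add: complex_eq_iff)
qed

lemma foldr_partial_move:
  assumes f: "f \<in> smooth_on S" "open S" and "x \<in> S"
  shows "foldr partial (xs @ i # ys) f x = partial i (foldr partial (xs @ ys) f) x"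
  using assms(3)
proof (induction xs arbitrary: x)
  case (Cons a xs)
  have "foldr partial ((a # xs) @ i # ys) f x = partial a (foldr partial (xs @ i # ys) f) x" by simp
  also have "\<dots> = partial a (partial i (foldr partial (xs @ ys) f)) x"
    by (rule partial_cong[OF f(2) Cons.prems]) (rule Cons.IH)
  also have "\<dots> = partial i (partial a (foldr partial (xs @ ys) f)) x"
    by (rule partial_commute[OF smooth_on_foldr_partial[OF f(1)] f(2) Cons.prems])
  finally show ?case by simp
qed simp

lemma foldr_partial_perm:
  assumes f: "f \<in> smooth_on S" "open S" and "x \<in> S" "mset xs = mset ys"
  shows "foldr partial xs f x = foldr partial ys f x"
  using assms(3,4)
proof (induction xs arbitrary: x ys)
  case (Cons i xs)
  then have "i \<in> set ys" by (metis list.set_intros(1) mset_eq_setD)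
  then obtain as bs where ys: "ys = as @ i # bs" by (meson split_list)
  then have m: "mset xs = mset (as @ bs)" using Cons.prems by simp
  have "foldr partial (i # xs) f x = partial i (foldr partial (as @ bs) f) x"
    unfolding foldr.simps o_apply
    by (rule partial_cong[OF f(2) Cons.prems(1)]) (rule Cons.IH[OF _ m])
  then show ?case unfolding ys foldr_partial_move[OF f Cons.prems(1)] .
qed simp

lemma mpartial_list:
  fixes \<alpha> :: "'n::finite multiindex"
  obtains "is" where "mpartial \<alpha> = foldr partial is" "\<And>i. count_list is i = \<alpha> i" "length is = mi_order \<alpha>"
proof -
  let ?is = "SOME is. \<forall>i. count_list is i = \<alpha> i"
  have c: "count_list ?is i = \<alpha> i" for i
    using someI_ex[OF multiindex_list_exists[of \<alpha>]] by blast
  have "length ?is = mi_order \<alpha>"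
    using sum_count_set[of ?is UNIV] by (simp add: mi_order_def c)
  with c show ?thesis by (intro that[of ?is]) (simp_all add: mpartial_def)
qed

lemma mpartial_count_list:
  assumes "f \<in> smooth_on S" "open S" "x \<in> S"
  shows "mpartial (count_list is) f x = foldr partial is f x"
proof -
  obtain js where js: "mpartial (count_list is) = foldr partial js" "\<And>i. count_list js i = count_list is i"
    using mpartial_list[of "count_list is"] by metis
  from js(2) have "mset js = mset is" by (intro multiset_eqI) (simp add: count_mset)
  then show ?thesis unfolding js by (intro foldr_partial_perm[OF assms])
qed

lemma mi_order_count_list: "mi_order (count_list is) = length (is :: 'n::finite list)"
  unfolding mi_order_def by (rule sum_count_set) auto

lemma mpartial_zero [simp]: "mpartial (\<lambda>_. 0) = (\<lambda>f. f)"
proof -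
  obtain js where js: "mpartial (\<lambda>_. 0) = foldr partial js" "length (js::'a list) = mi_order (\<lambda>_::'a. 0)"
    by (rule mpartial_list)
  then have "js = []" by (simp add: mi_order_def)
  then show ?thesis by (auto simp: js)
qed

lemma smooth_on_mpartial: "f \<in> smooth_on S \<Longrightarrow> mpartial \<alpha> f \<in> smooth_on S"
  by (simp add: mpartial_def smooth_on_foldr_partial)

lemma foldr_partial_const_0 [simp]: "foldr partial is (\<lambda>x. 0) = (\<lambda>x. 0)"
  by (induction "is") auto

lemma foldr_partial_outside:
  assumes "closed T" "\<And>x. x \<notin> T \<Longrightarrow> f x = 0" "x \<notin> T"
  shows "foldr partial is f x = 0"
proof -
  have "foldr partial is f x = foldr partial is (\<lambda>x. 0) x"
    by (rule foldr_partial_cong[of "- T"]) (use assms in auto)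
  then show ?thesis by simp
qed

lemma foldr_partial_add:
  assumes "f \<in> smooth_on S" "g \<in> smooth_on S" "open S" "x \<in> S"
  shows "foldr partial is (\<lambda>x. f x + g x) x = foldr partial is f x + foldr partial is g x"
  using assms(4)
proof (induction "is" arbitrary: x)
  case (Cons i "is")
  have "foldr partial (i # is) (\<lambda>x. f x + g x) x = partial i (\<lambda>x. foldr partial is f x + foldr partial is g x) x"
    unfolding foldr.simps o_apply by (rule partial_cong[OF assms(3) Cons.prems]) (rule Cons.IH)
  also have "\<dots> = foldr partial (i # is) f x + foldr partial (i # is) g x"
    unfolding foldr.simps o_apply
    by (rule partial_add; rule smooth_on_differentiable_at[OF smooth_on_foldr_partial _ Cons.prems]) (fact assms)+
  finally show ?case .
qed simp

lemma foldr_partial_cmult: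
  assumes "f \<in> smooth_on S" "open S" "x \<in> S"
  shows "foldr partial is (\<lambda>x. c * f x) x = c * foldr partial is f x"
  using assms(3)
proof (induction "is" arbitrary: x)
  case (Cons i "is")
  have "foldr partial (i # is) (\<lambda>x. c * f x) x = partial i (\<lambda>x. c * foldr partial is f x) x"
    unfolding foldr.simps o_apply by (rule partial_cong[OF assms(2) Cons.prems]) (rule Cons.IH)
  also have "\<dots> = c * foldr partial (i # is) f x"
    unfolding foldr.simps o_apply
    by (rule partial_cmult; rule smooth_on_differentiable_at[OF smooth_on_foldr_partial _ Cons.prems]) (fact assms)+
  finally show ?case .
qed simp

lemma foldr_partial_diff:
  assumes "f \<in> smooth_on S" "g \<in> smooth_on S" "open S" "x \<in> S"
  shows "foldr partial is (\<lambda>x. f x - g x) x = foldr partial is f x - foldr partial is g x"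
  using foldr_partial_add[OF assms(1) smooth_on_mult[OF assms(3) smooth_on_const[of "-1"] assms(2)] assms(3,4), of "is"]
    foldr_partial_cmult[OF assms(2-4), of "is" "-1"] by simp

definition derivs_bounded :: "(real^'n::finite) set \<Rightarrow> nat \<Rightarrow> real \<Rightarrow> 'n cfun \<Rightarrow> bool" where
  "derivs_bounded S J B f \<longleftrightarrow> (\<forall>is. length is \<le> J \<longrightarrow> (\<forall>x\<in>S. cmod (foldr partial is f x) \<le> B))"

lemma derivs_bounded_mono:
  "derivs_bounded S J B f \<Longrightarrow> J' \<le> J \<Longrightarrow> B \<le> B' \<Longrightarrow> T \<subseteq> S \<Longrightarrow> derivs_bounded T J' B' f"
  unfolding derivs_bounded_def by (meson order_trans subsetD)

lemma derivs_bounded_partial: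
  "derivs_bounded S (Suc J) B f \<Longrightarrow> derivs_bounded S J B (partial i f)"
  unfolding derivs_bounded_def
proof (intro allI impI)
  fix "is" :: "'a list" assume "\<forall>is. length is \<le> Suc J \<longrightarrow> (\<forall>x\<in>S. cmod (foldr partial is f x) \<le> B)" "length is \<le> J"
  then show "\<forall>x\<in>S. cmod (foldr partial is (partial i f) x) \<le> B"
    using spec[of "\<lambda>is. length is \<le> Suc J \<longrightarrow> (\<forall>x\<in>S. cmod (foldr partial is f x) \<le> B)" "is @ [i]"] by simp
qed

lemma derivs_bounded_mult_on:
  assumes S: "open S" "K \<subseteq> S" and "f \<in> smooth_on S" "g \<in> smooth_on S" "derivs_bounded K J A f" "derivs_bounded K J B g"
  shows "derivs_bounded K J (2 ^ J * (A * B)) (\<lambda>x. f x * g x)"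
proof -
  have "cmod (foldr partial is (\<lambda>x. f x * g x) x) \<le> 2 ^ length is * (A * B)"
    if "length is \<le> J" "x \<in> K" "f \<in> smooth_on S" "g \<in> smooth_on S"
       "derivs_bounded K (length is) A f" "derivs_bounded K (length is) B g" for "is" x f g
    using that
  proof (induction "is" arbitrary: f g rule: rev_induct)
    case Nil
    then have "cmod (f x) \<le> A" "cmod (g x) \<le> B" by (auto simp: derivs_bounded_def)
    then show ?case by (auto simp: norm_mult intro!: mult_mono order_trans[OF norm_ge_zero])
  next
    case (snoc i "is")
    then have "x \<in> S" using S(2) by blast
    have b: "derivs_bounded K (length is) A (partial i f)" "derivs_bounded K (length is) B (partial i g)"
      using snoc.prems by (auto intro: derivs_bounded_partial)
    have b': "derivs_bounded K (length is) A f" "derivs_bounded K (length is) B g"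
      using snoc.prems by (auto elim: derivs_bounded_mono)
    have "foldr partial (is @ [i]) (\<lambda>x. f x * g x) x = foldr partial is (\<lambda>x. f x * partial i g x + partial i f x * g x) x"
      unfolding foldr_append foldr.simps o_apply id_apply
      by (rule foldr_partial_cong[OF S(1) \<open>x \<in> S\<close>])
         (intro partial_mult smooth_on_differentiable_at[OF _ S(1)] snoc.prems)
    also have "\<dots> = foldr partial is (\<lambda>x. f x * partial i g x) x + foldr partial is (\<lambda>x. partial i f x * g x) x"
      by (rule foldr_partial_add[OF _ _ S(1) \<open>x \<in> S\<close>]; rule smooth_on_mult[OF S(1)]) (simp_all add: snoc.prems smooth_on_partial)
    also have "cmod \<dots> \<le> 2 ^ length is * (A * B) + 2 ^ length is * (A * B)"
      by (intro norm_triangle_le add_mono snoc.IH smooth_on_partial snoc.prems b b') (use snoc.prems in simp)+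
    finally show ?case by (simp add: algebra_simps)
  qed
  note * = this
  show ?thesis unfolding derivs_bounded_def
  proof (intro allI impI ballI)
    fix "is" :: "'a list" and x assume **: "length is \<le> J" "x \<in> K"
    have "cmod (f x) \<le> A" "cmod (g x) \<le> B"
      using assms(5,6) **(2) unfolding derivs_bounded_def by (metis foldr.simps(1) id_apply le0 list.size(3))+
    then have "0 \<le> A * B" by (meson mult_nonneg_nonneg norm_ge_zero order_trans)
    have "cmod (foldr partial is (\<lambda>x. f x * g x) x) \<le> 2 ^ length is * (A * B)"
      by (intro * ** assms derivs_bounded_mono[OF assms(5) **(1)] derivs_bounded_mono[OF assms(6) **(1)]) auto
    also have "\<dots> \<le> 2 ^ J * (A * B)"
      using ** \<open>0 \<le> A * B\<close> by (intro mult_right_mono power_increasing) auto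
    finally show "cmod (foldr partial is (\<lambda>x. f x * g x) x) \<le> 2 ^ J * (A * B)" .
  qed
qed

lemma derivs_bounded_mult:
  assumes "open S" "f \<in> smooth_on S" "g \<in> smooth_on S" "derivs_bounded S J A f" "derivs_bounded S J B g"
  shows "derivs_bounded S J (2 ^ J * (A * B)) (\<lambda>x. f x * g x)"
  by (rule derivs_bounded_mult_on[OF assms(1) order_refl assms(2-)])

lemma derivs_bounded_compact:
  fixes f :: "'n::finite cfun"
  assumes "f \<in> smooth_on S" "compact K" "K \<subseteq> S"
  obtains B where "B \<ge> 0" "derivs_bounded K J B f"
proof -
  have "\<exists>B. \<forall>x\<in>K. cmod (foldr partial is f x) \<le> B" for "is"
  proof -
    have "compact (foldr partial is f ` K)"
      using compact_continuous_image[OF continuous_on_subset[OF smooth_on_continuous[OF assms(1)] assms(3)] assms(2)] .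
    then show ?thesis using compact_imp_bounded bounded_iff by (metis imageI)
  qed
  then obtain B where B: "\<And>is x. x \<in> K \<Longrightarrow> cmod (foldr partial is f x) \<le> B is" by metis
  define L where "L = {is :: 'n list. length is \<le> J}"
  have "finite L" unfolding L_def using finite_lists_length_le[of "UNIV :: 'n set"] by simp
  have "derivs_bounded K J (\<Sum>is\<in>L. \<bar>B is\<bar>) f" unfolding derivs_bounded_def
  proof (intro allI impI ballI)
    fix "is" :: "'n list" and x assume "length is \<le> J" "x \<in> K"
    then have "cmod (foldr partial is f x) \<le> \<bar>B is\<bar>" using B by (meson abs_ge_self order_trans)
    also have "\<dots> \<le> (\<Sum>is\<in>L. \<bar>B is\<bar>)" using \<open>length is \<le> J\<close> \<open>finite L\<close> by (intro member_le_sum) (auto simp: L_def)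
    finally show "cmod (foldr partial is f x) \<le> (\<Sum>is\<in>L. \<bar>B is\<bar>)" .
  qed
  then show ?thesis by (intro that[of "\<Sum>is\<in>L. \<bar>B is\<bar>"]) (auto simp: sum_nonneg)
qed

lemma open_affine_vimage: "open S \<Longrightarrow> open {y. a + c *\<^sub>R y \<in> S}"
  for a :: "'a::real_normed_vector"
  using open_vimage[of S "\<lambda>y. a + c *\<^sub>R y"] by (simp add: vimage_def continuous_on_add continuous_on_const continuous_on_id continuous_on_scaleR)

lemma has_derivative_affine:
  assumes "f \<in> smooth_on S" "open S" "a + c *\<^sub>R y \<in> S"
  shows "((\<lambda>y. f (a + c *\<^sub>R y)) has_derivative (\<lambda>h. \<Sum>i\<in>UNIV. (c *\<^sub>R h) $ i *\<^sub>R partial i f (a + c *\<^sub>R y))) (at y)"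
proof -
  have "((\<lambda>y. a + c *\<^sub>R y) has_derivative (\<lambda>h. c *\<^sub>R h)) (at y)"
    by (auto intro!: derivative_eq_intros)
  from has_derivative_compose[OF this smooth_on_frechet[OF assms]] show ?thesis .
qed

lemma partial_affine:
  assumes "f \<in> smooth_on S" "open S" "a + c *\<^sub>R y \<in> S"
  shows "partial i (\<lambda>y. f (a + c *\<^sub>R y)) y = of_real c * partial i f (a + c *\<^sub>R y)"
proof -
  have "(\<Sum>k\<in>UNIV. (c *\<^sub>R axis i 1 :: real^'a) $ k *\<^sub>R partial k f z) = complex_of_real c * partial i f z" for z
    by (subst sum.remove[of _ i]) (auto simp: axis_def scaleR_conv_of_real[where 'a = complex])
  then show ?thesis using partial_eqI[OF has_derivative_affine[OF assms]] by simp
qed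

lemma smooth_on_affine:
  assumes f: "f \<in> smooth_on S" and S: "open S"
  shows "(\<lambda>y. f (a + c *\<^sub>R y)) \<in> smooth_on {y. a + c *\<^sub>R y \<in> S}"
proof (rule smooth_on_coinduct[where X = "\<lambda>h. \<exists>f\<in>smooth_on S. h = (\<lambda>y. f (a + c *\<^sub>R y))"])
  fix h assume "\<exists>f\<in>smooth_on S. h = (\<lambda>y. f (a + c *\<^sub>R y))"
  then obtain f where f: "f \<in> smooth_on S" "h = (\<lambda>y. f (a + c *\<^sub>R y))" by blast
  have "h differentiable_on {y. a + c *\<^sub>R y \<in> S}"
    unfolding f by (rule has_derivative_differentiable_on[OF open_affine_vimage[OF S] has_derivative_affine[OF f(1) S]]) simp
  moreover have "\<exists>g. (\<exists>f\<in>smooth_on S. g = (\<lambda>y. f (a + c *\<^sub>R y))) \<and> (\<forall>x\<in>{y. a + c *\<^sub>R y \<in> S}. partial i h x = g x)" for i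
    by (rule exI[of _ "\<lambda>y. of_real c * partial i f (a + c *\<^sub>R y)"])
       (use partial_affine[OF f(1) S] smooth_on_mult[OF S smooth_on_const[of "of_real c"] smooth_on_partial[OF f(1)]] f(2) in auto)
  ultimately show "h differentiable_on {y. a + c *\<^sub>R y \<in> S} \<and> (\<forall>i. \<exists>g. (\<exists>f\<in>smooth_on S. g = (\<lambda>y. f (a + c *\<^sub>R y))) \<and>
      (\<forall>x\<in>{y. a + c *\<^sub>R y \<in> S}. partial i h x = g x))" by blast
qed (use f open_affine_vimage[OF S] in auto)

lemma foldr_partial_affine:
  assumes f: "f \<in> smooth_on S" and S: "open S" and "a + c *\<^sub>R y \<in> S"
  shows "foldr partial is (\<lambda>y. f (a + c *\<^sub>R y)) y = of_real c ^ length is * foldr partial is f (a + c *\<^sub>R y)"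
  using assms(3)
proof (induction "is" arbitrary: y)
  case (Cons i "is")
  have "foldr partial (i # is) (\<lambda>y. f (a + c *\<^sub>R y)) y
      = partial i (\<lambda>y. of_real c ^ length is * foldr partial is f (a + c *\<^sub>R y)) y"
    unfolding foldr.simps o_apply
    by (rule partial_cong[OF open_affine_vimage[OF S]]) (use Cons in auto)
  also have "\<dots> = of_real c ^ length is * (of_real c * partial i (foldr partial is f) (a + c *\<^sub>R y))"
    by (subst partial_cmult)
      (use smooth_on_differentiable_at[OF smooth_on_affine[OF smooth_on_foldr_partial[OF f] S] open_affine_vimage[OF S]] Cons.prems
        partial_affine[OF smooth_on_foldr_partial[OF f] S Cons.prems] in auto)
  finally show ?case by simp
qed simp

fun exp_inv_poly :: "nat \<Rightarrow> real poly" where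
  "exp_inv_poly 0 = 1"
| "exp_inv_poly (Suc j) = monom 1 2 * (exp_inv_poly j - pderiv (exp_inv_poly j))"

text \<open>The \<open>j\<close>-th derivative of the flat function \<open>exp (- 1 / t)\<close>.\<close>

definition flat_deriv :: "nat \<Rightarrow> real \<Rightarrow> real" where
  "flat_deriv j t = (if t > 0 then poly (exp_inv_poly j) (inverse t) * exp (- inverse t) else 0)"

lemma tendsto_poly_exp_neg: "((\<lambda>s. poly p s * exp (- s)) \<longlongrightarrow> 0) (at_top :: real filter)"
proof -
  have "((\<lambda>s. \<Sum>i\<le>degree p. coeff p i * (s ^ i / exp s)) \<longlongrightarrow> (\<Sum>i\<le>degree p. coeff p i * 0)) at_top"
    by (intro tendsto_intros tendsto_power_div_exp_0)
  then show ?thesis by (simp add: poly_altdef sum_distrib_right exp_minus divide_inverse mult.assoc)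
qed

lemma flat_deriv_DERIV: "(flat_deriv j has_real_derivative flat_deriv (Suc j) t) (at t)"
proof -
  consider "t > 0" | "t < 0" | "t = 0" by linarith
  then show ?thesis
  proof cases
    case 1
    have "((\<lambda>t. poly (exp_inv_poly j) (inverse t) * exp (- inverse t)) has_real_derivative flat_deriv (Suc j) t) (at t)"
      using 1 by (auto intro!: derivative_eq_intros
        simp: flat_deriv_def poly_monom power2_eq_square field_simps)
    then show ?thesis
      by (rule has_field_derivative_transform_within_open[of _ _ _ "{0<..}"]) (use 1 in \<open>auto simp: flat_deriv_def\<close>)
  next
    case 2
    have "((\<lambda>t. 0) has_real_derivative flat_deriv (Suc j) t) (at t)"
      using 2 by (auto simp: flat_deriv_def)
    then show ?thesis
      by (rule has_field_derivative_transform_within_open[of _ _ _ "{..<0}"]) (use 2 in \<open>auto simp: flat_deriv_def\<close>)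
  next
    case 3
    have r: "((\<lambda>t. (flat_deriv j t - flat_deriv j 0) / (t - 0)) \<longlongrightarrow> 0) (at_right 0)"
    proof (rule Lim_transform_eventually)
      show "((\<lambda>t. poly (pCons 0 (exp_inv_poly j)) (inverse t) * exp (- inverse t)) \<longlongrightarrow> 0) (at_right (0::real))"
        using filterlim_compose[OF tendsto_poly_exp_neg filterlim_inverse_at_top_right] .
      show "\<forall>\<^sub>F t in at_right 0. poly (pCons 0 (exp_inv_poly j)) (inverse t) * exp (- inverse t) = (flat_deriv j t - flat_deriv j 0) / (t - 0)"
        by (rule eventually_at_rightI[of 0 1]) (auto simp: flat_deriv_def field_simps)
    qed
    have l: "((\<lambda>t. (flat_deriv j t - flat_deriv j 0) / (t - 0)) \<longlongrightarrow> 0) (at_left 0)"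
      by (rule Lim_transform_eventually[OF tendsto_const])
         (rule eventually_at_leftI[of "-1"], auto simp: flat_deriv_def)
    have "((\<lambda>t. (flat_deriv j t - flat_deriv j 0) / (t - 0)) \<longlongrightarrow> 0) (at 0)"
      using l r by (simp add: filterlim_at_split)
    then show ?thesis using 3 by (simp add: has_field_derivative_iff flat_deriv_def)
  qed
qed

lemma flat_0: "flat_deriv 0 t = (if t > 0 then exp (- inverse t) else 0)"
  by (simp add: flat_deriv_def)

lemma flat_0_mono: "s \<le> t \<Longrightarrow> flat_deriv 0 s \<le> flat_deriv 0 t"
  by (auto simp: flat_0 intro: le_imp_inverse_le)

definition bump :: "'n::finite cfun" where
  "bump x = of_real (flat_deriv 0 (exp (- 1) - flat_deriv 0 ((norm x)\<^sup>2 - 1)) / flat_deriv 0 (exp (- 1)))"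

lemma bump_smooth: "bump \<in> smooth_on S"
proof -
  have n: "(\<Sum>i\<in>UNIV. x $ i * x $ i) = (norm x)\<^sup>2" for x :: "real^'a"
    by (simp add: power2_norm_eq_inner inner_vec_def)
  have "(\<lambda>x::real^'a. (\<Sum>i\<in>UNIV. of_real (x $ i) * of_real (x $ i)) - 1 :: complex) \<in> smooth_on UNIV"
    by (intro smooth_on_diff smooth_on_sum smooth_on_mult smooth_on_component smooth_on_const open_UNIV)
  from smooth_on_compose[where g = flat_deriv, OF open_UNIV this flat_deriv_DERIV]
  have "(\<lambda>x::real^'a. complex_of_real (flat_deriv 0 ((norm x)\<^sup>2 - 1))) \<in> smooth_on UNIV"
    by (simp add: n flip: of_real_mult)
  then have "(\<lambda>x::real^'a. of_real (exp (- 1)) - complex_of_real (flat_deriv 0 ((norm x)\<^sup>2 - 1))) \<in> smooth_on UNIV"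
    by (intro smooth_on_diff smooth_on_const open_UNIV)
  from smooth_on_compose[where g = flat_deriv, OF open_UNIV this flat_deriv_DERIV]
  have "(\<lambda>x::real^'a. complex_of_real (flat_deriv 0 (exp (- 1) - flat_deriv 0 ((norm x)\<^sup>2 - 1)))) \<in> smooth_on UNIV"
    by simp
  from smooth_on_mult[OF open_UNIV smooth_on_const[of "inverse (of_real (flat_deriv 0 (exp (- 1))))"] this]
  have "bump \<in> smooth_on (UNIV :: (real^'a) set)"
    by (simp add: bump_def[abs_def] divide_inverse mult.commute)
  then show ?thesis by (rule smooth_on_subset) simp
qed

lemma bump_eq_1: "norm x \<le> 1 \<Longrightarrow> bump x = 1"
proof -
  assume "norm x \<le> 1"
  then have "flat_deriv 0 ((norm x)\<^sup>2 - 1) = 0" using power_le_one[of "norm x" 2] by (simp add: flat_0)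
  moreover have "flat_deriv 0 (exp (- 1)) > 0" by (simp add: flat_0)
  ultimately show ?thesis by (simp add: bump_def)
qed

lemma bump_eq_0: "norm x \<ge> 3 / 2 \<Longrightarrow> bump x = 0"
proof -
  assume "norm x \<ge> 3 / 2"
  then have "(norm x)\<^sup>2 \<ge> (3 / 2)\<^sup>2" by (intro power_mono) auto
  then have "flat_deriv 0 ((norm x)\<^sup>2 - 1) \<ge> flat_deriv 0 1"
    by (intro flat_0_mono) (simp add: power2_eq_square)
  then show ?thesis by (simp add: bump_def flat_0)
qed

lemma bump_nonneg: "\<exists>r\<ge>0. bump x = of_real r"
  unfolding bump_def by (rule exI, rule conjI[OF _ refl]) (simp add: flat_0)

section \<open>Fourier coefficients\<close>

lemma smooth_on_lipschitz:
  fixes f :: "'n::finite cfun"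
  assumes f: "f \<in> smooth_on S" "open S" "convex S"
    and B: "\<And>i z. z \<in> S \<Longrightarrow> cmod (partial i f z) \<le> B" and xy: "x \<in> S" "y \<in> S"
  shows "cmod (f x - f y) \<le> real CARD('n) * B * norm (x - y)"
proof (rule differentiable_bound[OF f(3) _ _ xy])
  fix z assume z: "z \<in> S"
  show "(f has_derivative (\<lambda>h. \<Sum>i\<in>UNIV. h $ i *\<^sub>R partial i f z)) (at z within S)"
    using smooth_on_frechet[OF f(1,2) z] by (rule has_derivative_at_withinI)
  show "onorm (\<lambda>h. \<Sum>i\<in>UNIV. h $ i *\<^sub>R partial i f z) \<le> real CARD('n) * B"
  proof (rule onorm_le)
    fix h :: "real^'n"
    have "norm (\<Sum>i\<in>UNIV. h $ i *\<^sub>R partial i f z) \<le> (\<Sum>i\<in>(UNIV::'n set). norm h * B)"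
      by (rule sum_norm_le) (auto intro!: mult_mono B[OF z] component_le_norm_cart)
    then show "norm (\<Sum>i\<in>UNIV. h $ i *\<^sub>R partial i f z) \<le> real CARD('n) * B * norm h"
      by (simp add: mult.commute mult.left_commute)
  qed
qed

lemma integrable_compact_support:
  fixes f :: "'a::euclidean_space \<Rightarrow> 'b::{banach, second_countable_topology}"
  assumes "compact T" "continuous_on T f" "\<And>x. x \<notin> T \<Longrightarrow> f x = 0"
  shows "integrable lborel f"
proof -
  have "f = (\<lambda>x. indicator T x *\<^sub>R f x)" using assms(3) by (auto simp: indicator_def)
  then show ?thesis using borel_integrable_compact[OF assms(1,2)] by simp
qed

lemma integral_partial_eq_0:
  fixes f :: "'n::finite cfun"
  assumes f: "f \<in> smooth_on UNIV" and T: "compact T" "\<And>x. x \<notin> T \<Longrightarrow> f x = 0"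
  shows "(LINT x|lborel. partial i f x) = 0"
proof -
  obtain r where r: "\<And>x. x \<in> T \<Longrightarrow> norm x \<le> r" using T(1) compact_imp_bounded bounded_iff by metis
  have cont: "continuous_on X f" for X
    using smooth_on_continuous[OF f, of "[]"] continuous_on_subset by auto
  have contp: "continuous_on X (partial i f)" for X
    using smooth_on_continuous[OF f, of "[i]"] continuous_on_subset by auto
  obtain C where C: "C \<ge> 0" "derivs_bounded T 1 C f"
    using derivs_bounded_compact[OF f T(1) subset_UNIV] by blast
  have C': "cmod (partial j f x) \<le> C" for j x
  proof (cases "x \<in> T")
    case True
    then show ?thesis using C(2) unfolding derivs_bounded_def
      by (auto dest!: spec[of _ "[j]"])
  next
    case False
    have "foldr partial [j] f x = 0"
      by (rule foldr_partial_outside[OF compact_imp_closed[OF T(1)]]) (use T(2) False in auto)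
    then show ?thesis using C by simp
  qed
  define e where "e n = inverse (real (Suc n)) *\<^sub>R (axis i 1 :: real^'n)" for n
  define D where "D n x = (f (x + e n) - f x) /\<^sub>R inverse (real (Suc n))" for n x
  have int: "integrable lborel f" by (rule integrable_compact_support[OF T(1) cont T(2)])
  have ne: "norm (e n) = inverse (real (Suc n))" for n by (simp add: e_def)
  have shift: "integrable lborel (\<lambda>x. f (x + e n))" "(LINT x|lborel. f (x + e n)) = (LINT x|lborel. f x)" for n
  proof -
    have m: "(+) (e n) \<in> lborel \<rightarrow>\<^sub>M borel" by simp
    have fm: "f \<in> borel_measurable borel" using int by simp
    have "integrable (distr lborel borel ((+) (e n))) f" using int by (simp only: lborel_distr_plus)
    then show "integrable lborel (\<lambda>x. f (x + e n))"
      unfolding integrable_distr_eq[OF m fm] by (simp only: add.commute)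
    have "(LINT x|lborel. f x) = (LINT x|distr lborel borel ((+) (e n)). f x)" by (simp only: lborel_distr_plus)
    then show "(LINT x|lborel. f (x + e n)) = (LINT x|lborel. f x)"
      unfolding integral_distr[OF m fm] by (simp only: add.commute)
  qed
  have "(\<lambda>n. LINT x|lborel. D n x) \<longlonglongrightarrow> (LINT x|lborel. partial i f x)"
  proof (rule integral_dominated_convergence[where w = "\<lambda>x. indicator (cball 0 (r + 1)) x * (real CARD('n) * C)"])
    show "partial i f \<in> borel_measurable lborel"
      using borel_measurable_continuous_onI[OF contp] by simp
    show "D n \<in> borel_measurable lborel" for n
      unfolding D_def using borel_measurable_integrable[OF int] borel_measurable_integrable[OF shift(1)] by measurable
    show "integrable lborel (\<lambda>x::real^'n. indicator (cball 0 (r + 1)) x * (real CARD('n) * C))"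
      by (intro integrable_mult_left integrable_real_indicator emeasure_compact_finite borel_compact) auto
    show "AE x in lborel. (\<lambda>n. D n x) \<longlonglongrightarrow> partial i f x"
    proof (intro AE_I2)
      fix x
      have *: "((\<lambda>t. L (f (x + t *\<^sub>R axis i 1))) has_real_derivative L (partial i f x)) (at 0)"
        if "bounded_linear L" for L
        using has_real_derivative_line[OF f open_UNIV that, of x 0 i] by simp
      have "(\<lambda>n. L (D n x)) \<longlonglongrightarrow> L (partial i f x)" if L: "bounded_linear L" for L :: "complex \<Rightarrow> real"
      proof -
        have "((\<lambda>t. (L (f (x + t *\<^sub>R axis i 1)) - L (f x)) / t) \<longlongrightarrow> L (partial i f x)) (at 0)"
          using *[OF L] by (simp add: has_field_derivative_iff)
        then have "(\<lambda>n. (L (f (x + inverse (real (Suc n)) *\<^sub>R axis i 1)) - L (f x)) / inverse (real (Suc n))) \<longlonglongrightarrow> L (partial i f x)"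
          by (rule tendsto_at_iff_sequentially[THEN iffD1, rule_format, unfolded o_def])
             (use LIMSEQ_inverse_real_of_nat in auto)
        moreover have "L (D n x) = (L (f (x + inverse (real (Suc n)) *\<^sub>R axis i 1)) - L (f x)) / inverse (real (Suc n))" for n
          unfolding D_def e_def linear_scale[OF bounded_linear.linear[OF L]] linear_diff[OF bounded_linear.linear[OF L]]
          by (simp add: divide_inverse mult.commute)
        ultimately show ?thesis by simp
      qed
      from this[OF bounded_linear_Re] this[OF bounded_linear_Im]
      show "(\<lambda>n. D n x) \<longlonglongrightarrow> partial i f x" by (simp add: tendsto_complex_iff)
    qed
    show "AE x in lborel. norm (D n x) \<le> indicator (cball 0 (r + 1)) x * (real CARD('n) * C)" for n
    proof (intro AE_I2)
      fix x
      show "norm (D n x) \<le> indicator (cball 0 (r + 1)) x * (real CARD('n) * C)"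
      proof (cases "norm x \<le> r + 1")
        case True
        have "cmod (f (x + e n) - f x) \<le> real CARD('n) * C * norm (x + e n - x)"
          by (rule smooth_on_lipschitz[OF f open_UNIV convex_UNIV C']) auto
        then have "cmod (f (x + e n) - f x) \<le> real CARD('n) * C * inverse (real (Suc n))" by (simp add: ne)
        moreover have "cmod (D n x) = real (Suc n) * cmod (f (x + e n) - f x)"
          unfolding D_def norm_scaleR by simp
        ultimately have "cmod (D n x) \<le> real CARD('n) * C" by (simp add: field_simps)
        then show ?thesis using True by simp
      next
        case False
        have "norm x \<le> norm (x + e n) + norm (e n)" using norm_triangle_ineq4[of "x + e n" "e n"] by simp
        moreover have "norm (e n) \<le> 1" unfolding ne by (simp add: field_simps)
        ultimately have "norm (x + e n) > r" "norm x > r" using False by linarith+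
        then have "f (x + e n) = 0" "f x = 0" using r T(2) by (meson not_less)+
        then show ?thesis using C by (simp add: D_def)
      qed
    qed
  qed
  moreover have "(LINT x|lborel. D n x) = 0" for n
    unfolding D_def using int shift[of n] by simp
  ultimately show ?thesis by (simp add: LIMSEQ_const_iff)
qed

definition wave :: "real^'n::finite \<Rightarrow> 'n cfun" where
  "wave \<xi> x = exp (\<i> * complex_of_real (\<xi> \<bullet> x))"

lemma wave_add: "wave (\<xi> + \<eta>) x = wave \<xi> x * wave \<eta> x"
  by (simp add: wave_def inner_add_left ring_distribs exp_add)

lemma norm_wave [simp]: "cmod (wave \<xi> x) = 1"
  by (simp add: wave_def)

lemma wave_0 [simp]: "wave 0 x = 1" "wave \<xi> 0 = 1"
  by (simp_all add: wave_def)

lemma continuous_wave: "continuous_on S (wave \<xi>)"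
  unfolding wave_def by (intro continuous_intros)

lemma wave_has_derivative: "(wave \<xi> has_derivative (\<lambda>h. \<i> * complex_of_real (\<xi> \<bullet> h) * wave \<xi> x)) (at x)"
proof -
  have "((\<lambda>x. \<i> * complex_of_real (\<xi> \<bullet> x)) has_derivative (\<lambda>h. \<i> * complex_of_real (\<xi> \<bullet> h))) (at x)"
    by (intro has_derivative_mult_right has_derivative_of_real has_derivative_inner_right has_derivative_ident)
  from has_derivative_compose[OF this DERIV_exp[unfolded has_field_derivative_def]] show ?thesis
    unfolding wave_def by (simp add: mult.commute)
qed

lemma partial_wave: "partial i (\<lambda>x. c * wave \<xi> x) = (\<lambda>x. (c * (\<i> * complex_of_real (\<xi> $ i))) * wave \<xi> x)"
proof
  fix x :: "real^'a"
  have "((\<lambda>x. c * wave \<xi> x) has_derivative (\<lambda>h. c * (\<i> * complex_of_real (\<xi> \<bullet> h) * wave \<xi> x))) (at x)"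
    by (intro has_derivative_mult_right wave_has_derivative)
  from partial_eqI[OF this] show "partial i (\<lambda>x. c * wave \<xi> x) x = (c * (\<i> * complex_of_real (\<xi> $ i))) * wave \<xi> x"
    by (simp add: inner_axis)
qed

lemma smooth_on_wave: "wave \<xi> \<in> smooth_on S"
proof -
  have "wave \<xi> \<in> smooth_on UNIV"
  proof (rule smooth_on_coinduct[where X = "\<lambda>f. \<exists>c. f = (\<lambda>x. c * wave \<xi> x)"])
    fix f assume "\<exists>c. f = (\<lambda>x. c * wave \<xi> x)"
    then obtain c where f: "f = (\<lambda>x. c * wave \<xi> x)" by blast
    have "f differentiable_on UNIV" unfolding f
      by (rule has_derivative_differentiable_on[OF open_UNIV has_derivative_mult_right[OF wave_has_derivative]])
    then show "f differentiable_on UNIV \<and> (\<forall>i. \<exists>g. (\<exists>c. g = (\<lambda>x. c * wave \<xi> x)) \<and> (\<forall>x\<in>UNIV. partial i f x = g x))"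
      by (auto simp: f partial_wave)
  qed (auto intro!: exI[of _ 1])
  then show ?thesis by (rule smooth_on_subset) simp
qed

lemma foldr_partial_wave:
  "foldr partial is (wave \<xi>) = (\<lambda>x. (\<Prod>i\<leftarrow>is. \<i> * complex_of_real (\<xi> $ i)) * wave \<xi> x)"
proof (induction "is")
  case (Cons i "is")
  show ?case unfolding foldr.simps o_apply Cons partial_wave by (simp add: mult.commute)
qed simp

definition freq :: "('n::finite \<Rightarrow> int) \<Rightarrow> real^'n" where
  "freq k = (\<chi> i. of_int (k i))"

lemma freq_nth [simp]: "freq k $ i = of_int (k i)"
  by (simp add: freq_def)

lemma freq_add: "freq (\<lambda>i. k i + l i) = freq k + freq l"
  by (simp add: vec_eq_iff)

lemma freq_diff: "freq (\<lambda>i. k i - l i) = freq k - freq l"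
  by (simp add: vec_eq_iff)

definition fourier_coeff :: "'n::finite cfun \<Rightarrow> ('n \<Rightarrow> int) \<Rightarrow> complex" where
  "fourier_coeff f k = (LINT y|lborel. f y * wave (- freq k) y) / of_real ((2 * pi) ^ CARD('n))"

lemma fourier_coeff_partial:
  assumes f: "f \<in> smooth_on UNIV" and T: "compact T" "\<And>x. x \<notin> T \<Longrightarrow> f x = 0"
  shows "fourier_coeff (partial i f) k = \<i> * of_int (k i) * fourier_coeff f k"
proof -
  have cont: "continuous_on T (partial i f)" "continuous_on T f"
    using smooth_on_continuous[OF f, of "[i]"] smooth_on_continuous[OF f, of "[]"] continuous_on_subset by auto
  have "foldr partial [i] f x = 0" if "x \<notin> T" for x
    by (rule foldr_partial_outside[OF compact_imp_closed[OF T(1)]]) (use T(2) that in auto)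
  then have p0: "partial i f x = 0" if "x \<notin> T" for x using that by simp
  have i1: "integrable lborel (\<lambda>y. partial i f y * wave (- freq k) y)"
    by (rule integrable_compact_support[OF T(1)]) (auto intro!: continuous_on_mult continuous_wave cont simp: p0)
  have i2: "integrable lborel (\<lambda>y. f y * wave (- freq k) y)"
    by (rule integrable_compact_support[OF T(1)]) (auto intro!: continuous_on_mult continuous_wave cont simp: T)
  have "0 = (LINT y|lborel. partial i (\<lambda>y. f y * wave (- freq k) y) y)"
    by (rule integral_partial_eq_0[OF _ T(1), symmetric]) (auto intro!: smooth_on_mult f smooth_on_wave simp: T)
  also have "\<dots> = (LINT y|lborel. f y * wave (- freq k) y * - (\<i> * of_int (k i)) + partial i f y * wave (- freq k) y)"
    using partial_mult[OF smooth_on_differentiable_at[OF f open_UNIV UNIV_I] smooth_on_differentiable_at[OF smooth_on_wave open_UNIV UNIV_I]]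
       partial_wave[of i 1]
    by (simp add: ac_simps)
  also have "\<dots> = (LINT y|lborel. f y * wave (- freq k) y) * - (\<i> * of_int (k i)) + (LINT y|lborel. partial i f y * wave (- freq k) y)"
    using i1 i2 by (subst Bochner_Integration.integral_add) auto
  finally show ?thesis by (simp add: fourier_coeff_def field_simps)
qed

lemma fourier_coeff_foldr_partial:
  assumes f: "f \<in> smooth_on UNIV" and T: "compact T" "\<And>x. x \<notin> T \<Longrightarrow> f x = 0"
  shows "fourier_coeff (foldr partial is f) k = (\<Prod>i\<leftarrow>is. \<i> * of_int (k i)) * fourier_coeff f k"
proof (induction "is")
  case (Cons i "is")
  show ?case
    using fourier_coeff_partial[OF smooth_on_foldr_partial[OF f] T(1) foldr_partial_outside[OF compact_imp_closed[OF T(1)] T(2)]] Cons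
    by simp
qed simp

lemma fourier_coeff_bound:
  fixes f :: "'n::finite cfun"
  assumes "compact T" "continuous_on T f" "\<And>x. x \<notin> T \<Longrightarrow> f x = 0" and B: "\<And>x. x \<in> T \<Longrightarrow> cmod (f x) \<le> B"
  shows "cmod (fourier_coeff f k) \<le> B * measure lborel T"
proof -
  have "cmod (LINT y|lborel. f y * wave (- freq k) y) \<le> (LINT y|lborel. cmod (f y * wave (- freq k) y))"
    by (rule integral_norm_bound)
  also have "\<dots> \<le> (LINT y|lborel. indicator T y * B)"
  proof (rule integral_mono)
    show "integrable lborel (\<lambda>y. cmod (f y * wave (- freq k) y))"
      by (rule integrable_norm, rule integrable_compact_support[OF assms(1)])
         (auto intro!: continuous_on_mult continuous_wave assms(2) simp: assms(3))
    show "integrable lborel (\<lambda>y. indicator T y * B)"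
      using assms(1) by (auto intro!: integrable_mult_left integrable_real_indicator emeasure_compact_finite borel_compact)
    show "cmod (f y * wave (- freq k) y) \<le> indicator T y * B" for y
      using B[of y] assms(3)[of y] by (auto simp: norm_mult indicator_def)
  qed
  also have "\<dots> = B * measure lborel T" using assms(1) by simp
  finally have 1: "cmod (LINT y|lborel. f y * wave (- freq k) y) \<le> B * measure lborel T" .
  have "cmod (fourier_coeff f k) = cmod (LINT y|lborel. f y * wave (- freq k) y) / (2 * pi) ^ CARD('n)"
    by (simp add: fourier_coeff_def norm_divide norm_power norm_mult)
  also have "\<dots> \<le> cmod (LINT y|lborel. f y * wave (- freq k) y) / 1"
    by (intro divide_left_mono one_le_power) (use pi_gt3 in auto)
  finally show ?thesis using 1 by simp
qed

definition japanese :: "('n::finite \<Rightarrow> int) \<Rightarrow> real" where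
  "japanese k = (\<Prod>i\<in>UNIV. 1 + (of_int (k i))\<^sup>2)"

lemma japanese_ge_1: "japanese k \<ge> 1"
  unfolding japanese_def by (intro prod_ge_1) simp

lemma prod_list_count: "(\<Prod>i\<leftarrow>is. g i) = (\<Prod>i\<in>UNIV. g i ^ count_list is i)"
  for g :: "'n::finite \<Rightarrow> 'a::comm_monoid_mult"
proof (induction "is")
  case (Cons j "is")
  have "(\<Prod>i\<in>UNIV. g i ^ count_list (j # is) i) = (\<Prod>i\<in>UNIV. (if i = j then g j else 1) * g i ^ count_list is i)"
    by (rule prod.cong) auto
  also have "\<dots> = g j * (\<Prod>i\<in>UNIV. g i ^ count_list is i)" by (simp add: prod.distrib)
  finally show ?case using Cons by simp
qed simp

text \<open>For each frequency differentiate only in the directions of its nonzero components.\<close>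

lemma fourier_coeff_decay:
  fixes f :: "'n::finite cfun"
  assumes f: "f \<in> smooth_on UNIV" and T: "compact T" "\<And>x. x \<notin> T \<Longrightarrow> f x = 0"
    and B: "derivs_bounded T (2 * N * CARD('n)) B f" and "B \<ge> 0"
  shows "cmod (fourier_coeff f k) * japanese k ^ N \<le> 2 ^ (N * CARD('n)) * measure lborel T * B"
proof -
  obtain "is" where "is": "\<And>i. count_list is i = (if k i = 0 then 0 else 2 * N)" "length is = mi_order (\<lambda>i. if k i = 0 then 0 else 2 * N)"
    using mpartial_list[of "\<lambda>i. if k i = 0 then 0 else 2 * N"] by metis
  have len: "length is \<le> 2 * N * CARD('n)"
  proof -
    have "length is \<le> (\<Sum>i\<in>(UNIV::'n set). 2 * N)" unfolding "is"(2) mi_order_def by (intro sum_mono) auto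
    then show ?thesis by (simp add: mult.commute)
  qed
  have "japanese k ^ N \<le> (\<Prod>i\<in>UNIV. 2 ^ N * \<bar>of_int (k i)\<bar> ^ count_list is i)"
    unfolding japanese_def prod_power_distrib
  proof (rule prod_mono, intro conjI)
    fix i
    show "(1 + (real_of_int (k i))\<^sup>2) ^ N \<le> 2 ^ N * \<bar>real_of_int (k i)\<bar> ^ count_list is i"
    proof (cases "k i = 0")
      case False
      then have "1 \<le> \<bar>real_of_int (k i)\<bar>" by linarith
      then have "1 \<le> (real_of_int (k i))\<^sup>2" using one_le_power[of "\<bar>real_of_int (k i)\<bar>" 2] by simp
      then have "(1 + (real_of_int (k i))\<^sup>2) ^ N \<le> (2 * (real_of_int (k i))\<^sup>2) ^ N" by (intro power_mono) auto
      also have "\<dots> = 2 ^ N * \<bar>real_of_int (k i)\<bar> ^ count_list is i"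
        using False by (simp add: "is" power_mult_distrib power_mult)
      finally show ?thesis .
    qed (simp add: "is")
  qed simp
  also have "\<dots> = 2 ^ (N * CARD('n)) * cmod (\<Prod>i\<leftarrow>is. \<i> * of_int (k i))"
    by (simp add: prod_list_count prod.distrib prod_norm[symmetric] norm_power norm_mult power_mult)
  finally have 1: "japanese k ^ N \<le> 2 ^ (N * CARD('n)) * cmod (\<Prod>i\<leftarrow>is. \<i> * of_int (k i))" .
  have "cmod (fourier_coeff f k) * japanese k ^ N \<le> 2 ^ (N * CARD('n)) * (cmod (\<Prod>i\<leftarrow>is. \<i> * of_int (k i)) * cmod (fourier_coeff f k))"
    using mult_right_mono[OF 1 norm_ge_zero[of "fourier_coeff f k"]] by (simp add: mult_ac)
  also have "\<dots> = 2 ^ (N * CARD('n)) * cmod (fourier_coeff (foldr partial is f) k)"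
    by (simp add: fourier_coeff_foldr_partial[OF f T] norm_mult)
  also have "\<dots> \<le> 2 ^ (N * CARD('n)) * (B * measure lborel T)"
  proof (intro mult_left_mono fourier_coeff_bound T(1))
    show "continuous_on T (foldr partial is f)"
      using smooth_on_continuous[OF f] continuous_on_subset by blast
    show "foldr partial is f x = 0" if "x \<notin> T" for x
      by (rule foldr_partial_outside[OF compact_imp_closed[OF T(1)]]) (use T(2) that in auto)
    show "cmod (foldr partial is f x) \<le> B" if "x \<in> T" for x
      using B len that unfolding derivs_bounded_def by blast
  qed simp
  finally show ?thesis by (simp add: mult_ac)
qed

lemma summable_on_int_inverse_square: "(\<lambda>j::int. 1 / (1 + (real_of_int j)\<^sup>2)) summable_on UNIV"
proof -
  have s: "(\<lambda>n::nat. 1 / (1 + (real n)\<^sup>2)) summable_on UNIV"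
  proof (rule summable_nonneg_imp_summable_on)
    have "summable (\<lambda>n. 1 / (real (Suc n))\<^sup>2)" using inverse_squares_sums by (simp add: sums_iff)
    then have "summable (\<lambda>n. 1 / (1 + (real (Suc n))\<^sup>2))"
      by (rule summable_comparison_test'[where N = 0]) (auto intro!: divide_left_mono add_pos_nonneg mult_pos_pos)
    then show "summable (\<lambda>n. 1 / (1 + (real n)\<^sup>2))" by (rule iffD1[OF summable_Suc_iff])
  qed simp
  have 1: "(\<lambda>j::int. 1 / (1 + (real_of_int j)\<^sup>2)) summable_on range int"
    using s by (subst summable_on_reindex) (auto simp: o_def)
  have 2: "(\<lambda>j::int. 1 / (1 + (real_of_int j)\<^sup>2)) summable_on range (\<lambda>n. - int n)"
    using s by (subst summable_on_reindex) (auto simp: o_def inj_on_def)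
  have "UNIV = range int \<union> range (\<lambda>n. - int n)" by (auto simp: image_iff) (metis int_cases2)
  then show ?thesis using summable_on_union[OF 1 2] by simp
qed

lemma summable_on_japanese: "(\<lambda>k :: 'n::finite \<Rightarrow> int. 1 / japanese k) summable_on UNIV"
proof -
  have eq: "(\<lambda>k :: 'n \<Rightarrow> int. 1 / japanese k) = (\<lambda>k. \<Prod>i\<in>UNIV. 1 / (1 + (real_of_int (k i))\<^sup>2))"
    by (simp add: japanese_def prod_dividef)
  have "infsum (\<lambda>k :: 'n \<Rightarrow> int. 1 / japanese k) (PiE UNIV (\<lambda>_. UNIV))
      = (\<Prod>i\<in>(UNIV::'n set). infsum (\<lambda>j::int. 1 / (1 + (real_of_int j)\<^sup>2)) UNIV)"
    unfolding eq by (rule infsum_prod_PiE_abs) (use summable_on_int_inverse_square in auto)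
  moreover have "infsum (\<lambda>j::int. 1 / (1 + (real_of_int j)\<^sup>2)) UNIV \<ge> (\<Sum>j\<in>{0}. 1 / (1 + (real_of_int j)\<^sup>2))"
    by (rule finite_sum_le_infsum[OF summable_on_int_inverse_square]) auto
  ultimately have "infsum (\<lambda>k :: 'n \<Rightarrow> int. 1 / japanese k) UNIV \<noteq> 0" by simp
  then show ?thesis using infsum_not_exists by blast
qed

section \<open>Fourier inversion\<close>

lemma integral_prod_components:
  fixes g :: "'n::finite \<Rightarrow> real \<Rightarrow> complex"
  assumes g: "\<And>i. integrable lborel (g i)"
  shows "(LINT x|lborel. (\<Prod>i\<in>UNIV. g i ((x :: real^'n) $ i))) = (\<Prod>i\<in>UNIV. LINT t|lborel. g i t)"
proof -
  define ix :: "real^'n \<Rightarrow> 'n" where "ix = the_inv (\<lambda>i. axis i 1)"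
  have inj: "inj (\<lambda>i. axis i (1::real) :: real^'n)" by (auto simp: inj_on_def axis_eq_axis)
  have ix [simp]: "ix (axis i 1) = i" for i unfolding ix_def by (rule the_inv_f_f[OF inj])
  have B: "(Basis :: (real^'n) set) = range (\<lambda>i. axis i 1)" by (auto simp: Basis_vec_def)
  have re: "(\<Prod>b\<in>Basis. h b) = (\<Prod>i\<in>UNIV. h (axis i 1))" for h :: "real^'n \<Rightarrow> complex"
    unfolding B by (subst prod.reindex[OF inj]) simp
  interpret product_sigma_finite "\<lambda>b :: real^'n. lborel :: real measure" ..
  have [measurable]: "g i \<in> borel_measurable borel" for i using g[of i] by simp
  have m: "(\<lambda>f. \<Sum>b\<in>Basis. f b *\<^sub>R b) \<in> (\<Pi>\<^sub>M b\<in>(Basis :: (real^'n) set). lborel) \<rightarrow>\<^sub>M borel"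
    by measurable
  have gm: "(\<lambda>x::real^'n. \<Prod>b\<in>Basis. g (ix b) (x \<bullet> b)) \<in> borel_measurable borel" by measurable
  have "(LINT x|lborel. (\<Prod>i\<in>UNIV. g i ((x :: real^'n) $ i))) = (LINT x|lborel. (\<Prod>b\<in>Basis. g (ix b) ((x :: real^'n) \<bullet> b)))"
    by (simp add: re inner_axis)
  also have "\<dots> = (LINT f|(\<Pi>\<^sub>M b\<in>(Basis :: (real^'n) set). lborel). (\<Prod>b\<in>Basis. g (ix b) ((\<Sum>b\<in>Basis. f b *\<^sub>R b) \<bullet> b)))"
    by (subst lborel_eq) (rule integral_distr[OF m gm])
  also have "\<dots> = (LINT f|(\<Pi>\<^sub>M b\<in>(Basis :: (real^'n) set). lborel). (\<Prod>b\<in>Basis. g (ix b) (f b)))"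
    by (intro Bochner_Integration.integral_cong refl prod.cong) (simp add: inner_sum_left_Basis)
  also have "\<dots> = (\<Prod>b\<in>(Basis :: (real^'n) set). LINT t|lborel. g (ix b) t)"
    by (rule product_integral_prod) (use g in auto)
  finally show ?thesis by (simp add: re)
qed

definition torus :: "(real^'n::finite) set" where
  "torus = cbox (\<chi> i. - pi) (\<chi> i. pi)"

lemma in_torus: "x \<in> torus \<longleftrightarrow> (\<forall>i. \<bar>x $ i\<bar> \<le> pi)"
proof -
  have "\<bar>t\<bar> \<le> pi \<longleftrightarrow> - pi \<le> t \<and> t \<le> pi" for t by linarith
  then show ?thesis by (simp add: torus_def mem_box_cart)
qed

lemma compact_torus: "compact torus"
  unfolding torus_def by (rule compact_cbox)

lemma torus_borel [simp]: "torus \<in> sets borel"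
  unfolding torus_def by simp

lemma integrable_torus:
  fixes f :: "real^'n::finite \<Rightarrow> 'b::{banach, second_countable_topology}"
  assumes "continuous_on torus f"
  shows "integrable lborel (\<lambda>x. indicator torus x *\<^sub>R f x)"
  using borel_integrable_compact[OF compact_torus assms] .

lemma integral_wave_1d:
  "(LINT t|lborel. indicator {-pi..pi} t *\<^sub>R exp (\<i> * complex_of_real (of_int j * t))) = (if j = 0 then 2 * pi else 0)"
proof (cases "j = 0")
  case True
  then show ?thesis by (simp add: scaleR_conv_of_real)
next
  case False
  have "(LINT t|lborel. indicator {-pi..pi} t *\<^sub>R exp (\<i> * complex_of_real (of_int j * t)))
     = exp (\<i> * complex_of_real (of_int j * pi)) / (\<i> * of_int j) - exp (\<i> * complex_of_real (of_int j * (- pi))) / (\<i> * of_int j)"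
  proof (rule integral_FTC_Icc)
    fix x
    show "((\<lambda>t. exp (\<i> * complex_of_real (of_int j * t)) / (\<i> * of_int j)) has_vector_derivative
        exp (\<i> * complex_of_real (of_int j * x))) (at x within {- pi..pi})"
      using False by (auto intro!: derivative_eq_intros has_vector_derivative_real_field simp: mult_ac)
  qed (auto intro!: continuous_intros)
  also have "exp (\<i> * complex_of_real (of_int j * pi)) = exp (\<i> * complex_of_real (of_int j * (- pi)))"
    unfolding exp_eq by (intro exI[of _ j]) (simp add: algebra_simps)
  finally show ?thesis using False by simp
qed

lemma wave_freq_prod: "wave (freq k) x = (\<Prod>i\<in>UNIV. exp (\<i> * complex_of_real (of_int (k i) * x $ i)))"
  by (simp add: wave_def inner_vec_def sum_distrib_left exp_sum)

lemma indicator_torus: "indicator torus x = (\<Prod>i\<in>UNIV. indicator {-pi..pi} (x $ i) :: real)"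
proof (cases "x \<in> torus")
  case False
  then obtain i where "\<not> \<bar>x $ i\<bar> \<le> pi" by (auto simp: in_torus)
  then have "indicator {-pi..pi} (x $ i) = (0::real)" by (auto simp: indicator_def abs_le_iff)
  then have "(\<Prod>i\<in>UNIV. indicator {-pi..pi} (x $ i) :: real) = 0" by (intro prod_zero) auto
  then show ?thesis using False by simp
next
  case True
  then have "indicator {-pi..pi} (x $ i) = (1::real)" for i
  proof -
    have "\<bar>x $ i\<bar> \<le> pi" using True by (simp add: in_torus)
    then show ?thesis by (simp add: indicator_def) linarith
  qed
  then show ?thesis using True by simp
qed

lemma integral_wave_torus:
  fixes k :: "'n::finite \<Rightarrow> int"
  shows "(LINT x|lborel. indicator torus x *\<^sub>R wave (freq k) x) = (if k = (\<lambda>_. 0) then (2 * pi) ^ CARD('n) else 0)"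
proof -
  have "(LINT x|lborel. indicator torus x *\<^sub>R wave (freq k) x)
    = (LINT x|lborel. (\<Prod>i\<in>UNIV. indicator {-pi..pi} (x $ i) *\<^sub>R exp (\<i> * complex_of_real (of_int (k i) * x $ i))))"
    unfolding indicator_torus wave_freq_prod by (simp add: scaleR_conv_of_real prod.distrib)
  also have "\<dots> = (\<Prod>i\<in>UNIV. LINT t|lborel. indicator {-pi..pi} t *\<^sub>R exp (\<i> * complex_of_real (of_int (k i) * t)))"
    by (rule integral_prod_components) (auto intro!: borel_integrable_compact continuous_intros)
  also have "\<dots> = (\<Prod>i\<in>UNIV. complex_of_real (if k i = 0 then 2 * pi else 0))"
    by (simp only: integral_wave_1d if_distrib[of complex_of_real])
  also have "\<dots> = (if k = (\<lambda>_. 0) then (2 * pi) ^ CARD('n) else 0)"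
    by (auto simp: fun_eq_iff intro!: prod_zero)
  finally show ?thesis .
qed

inductive trig_poly :: "'n::finite cfun \<Rightarrow> bool" where
  monomial: "trig_poly (\<lambda>x. c * wave (freq k) x)"
| plus: "trig_poly f \<Longrightarrow> trig_poly g \<Longrightarrow> trig_poly (\<lambda>x. f x + g x)"

lemma trig_poly_monomial_mult: "trig_poly g \<Longrightarrow> trig_poly (\<lambda>x. (c * wave (freq k) x) * g x)"
proof (induction rule: trig_poly.induct)
  case (monomial d l)
  have "(\<lambda>x. (c * wave (freq k) x) * (d * wave (freq l) x)) = (\<lambda>x. (c * d) * wave (freq (\<lambda>i. k i + l i)) x)"
    by (simp add: freq_add wave_add mult_ac)
  then show ?case by (simp only: trig_poly.monomial)
next
  case (plus f g)
  then show ?case using trig_poly.plus[OF plus.IH] by (simp add: distrib_left)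
qed

lemma trig_poly_mult: "trig_poly f \<Longrightarrow> trig_poly g \<Longrightarrow> trig_poly (\<lambda>x. f x * g x)"
proof (induction rule: trig_poly.induct)
  case (plus f1 f2)
  then show ?case using trig_poly.plus[OF plus.IH] by (simp add: distrib_right)
qed (rule trig_poly_monomial_mult)

lemma trig_poly_const: "trig_poly (\<lambda>x :: real^'n::finite. c)"
proof -
  have "freq (\<lambda>_ :: 'n. 0) = 0" by (simp add: vec_eq_iff)
  then show ?thesis using trig_poly.monomial[of c "\<lambda>_ :: 'n. 0"] by simp
qed

lemma trig_poly_power: "trig_poly f \<Longrightarrow> trig_poly (\<lambda>x. f x ^ N)"
  by (induction N) (auto intro: trig_poly_const trig_poly_mult)

lemma trig_poly_prod: "(\<And>i. i \<in> A \<Longrightarrow> trig_poly (f i)) \<Longrightarrow> trig_poly (\<lambda>x. \<Prod>i\<in>A. f i x)"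
  by (induction A rule: infinite_finite_induct) (auto intro: trig_poly_const trig_poly_mult)

lemma trig_poly_continuous: "trig_poly f \<Longrightarrow> continuous_on S f"
  by (induction rule: trig_poly.induct) (auto intro!: continuous_intros continuous_wave)

definition peak :: "real^'n::finite \<Rightarrow> real^'n \<Rightarrow> real" where
  "peak z x = (\<Prod>i\<in>UNIV. (1 + cos (x $ i - z $ i)) / 2)"

lemma trig_poly_peak: "trig_poly (\<lambda>x. complex_of_real (peak z x))"
proof -
  have "trig_poly (\<lambda>x. complex_of_real ((1 + cos (x $ i - z $ i)) / 2))" for i
  proof -
    let ?k = "\<lambda>j. if j = i then 1 else 0 :: int" and ?l = "\<lambda>j. if j = i then - 1 else 0 :: int"
    have in1: "freq ?k \<bullet> x = x $ i" "freq ?l \<bullet> x = - x $ i" for x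
      unfolding inner_vec_def by (subst sum.remove[of _ i]; simp)+
    have "complex_of_real ((1 + cos (x $ i - z $ i)) / 2) =
       1 / 2 + ((exp (- \<i> * z $ i) / 4) * wave (freq ?k) x + (exp (\<i> * z $ i) / 4) * wave (freq ?l) x)" for x
      unfolding wave_def in1
      by (simp add: cos_exp_eq field_simps flip: cos_of_real exp_add)
    then show ?thesis by (simp only:) (intro trig_poly.intros trig_poly_const)
  qed
  then show ?thesis unfolding peak_def of_real_prod by (rule trig_poly_prod)
qed

lemma peak_nonneg: "peak z x \<ge> 0"
proof -
  have "0 \<le> 1 + cos t" for t :: real using cos_ge_minus_one[of t] by linarith
  then show ?thesis unfolding peak_def by (intro prod_nonneg) auto
qed

lemma peak_self [simp]: "peak z z = 1"
  by (simp add: peak_def)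

lemma peak_less_1:
  assumes "x \<in> torus" "\<forall>i. \<bar>z $ i\<bar> < pi" "x \<noteq> z"
  shows "peak z x < 1"
proof -
  obtain j where j: "x $ j \<noteq> z $ j" using assms(3) by (auto simp: vec_eq_iff)
  have "cos (x $ j - z $ j) \<noteq> 1"
  proof
    assume "cos (x $ j - z $ j) = 1"
    then obtain m :: int where m: "x $ j - z $ j = of_int m * (2 * pi)" by (auto simp: cos_one_2pi_int)
    have "\<bar>x $ j - z $ j\<bar> < 2 * pi" using assms(1)[unfolded in_torus, rule_format, of j] assms(2)[rule_format, of j] by linarith
    then have "\<bar>of_int m\<bar> * (2 * pi) < 1 * (2 * pi)" by (simp add: m abs_mult)
    then have "\<bar>real_of_int m\<bar> < 1" by (subst (asm) mult_less_cancel_right_pos) auto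
    then have "m = 0" by linarith
    then show False using m j by simp
  qed
  then have "cos (x $ j - z $ j) < 1" using cos_le_one[of "x $ j - z $ j"] by linarith
  then have l: "(1 + cos (x $ j - z $ j)) / 2 < 1" by simp
  have b: "0 \<le> (1 + cos t) / 2 \<and> (1 + cos t) / 2 \<le> 1" for t :: real
  proof -
    have "0 \<le> 1 + cos t" using cos_ge_minus_one[of t] by linarith
    then show ?thesis by simp
  qed
  have "peak z x = (1 + cos (x $ j - z $ j)) / 2 * (\<Prod>i\<in>UNIV - {j}. (1 + cos (x $ i - z $ i)) / 2)"
    unfolding peak_def by (subst prod.remove[of _ j]) auto
  also have "\<dots> \<le> (1 + cos (x $ j - z $ j)) / 2 * 1"
    using b by (intro mult_left_mono prod_le_1) auto
  finally show ?thesis using l by simp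
qed

lemma peak_continuous: "continuous_on S (peak z)"
  unfolding peak_def by (intro continuous_intros) auto

lemma integral_trig_poly_zero:
  assumes h: "continuous_on torus h" and z: "\<And>k. (LINT x|lborel. indicator torus x *\<^sub>R (h x * wave (freq k) x)) = 0"
    and "trig_poly p"
  shows "(LINT x|lborel. indicator torus x *\<^sub>R (h x * p x)) = 0"
  using assms(3)
proof induction
  case (monomial c k)
  have "indicator torus x *\<^sub>R (h x * (c * wave (freq k) x)) = c * (indicator torus x *\<^sub>R (h x * wave (freq k) x))" for x
    by (simp add: scaleR_conv_of_real mult_ac)
  then show ?case using z[of k] by (simp only: integral_mult_right_zero mult_zero_right)
next
  case (plus f g)
  have "integrable lborel (\<lambda>x. indicator torus x *\<^sub>R (h x * f x))" "integrable lborel (\<lambda>x. indicator torus x *\<^sub>R (h x * g x))"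
    by (intro integrable_torus continuous_on_mult h trig_poly_continuous plus)+
  then show ?case using plus.IH by (simp add: distrib_left scaleR_add_right)
qed

lemma trig_peak_uniqueness:
  fixes h :: "'n::finite cfun"
  assumes h: "continuous_on torus h" and zero: "\<And>k. (LINT x|lborel. indicator torus x *\<^sub>R (h x * wave (freq k) x)) = 0"
    and z: "\<forall>i. \<bar>z $ i\<bar> < pi"
  shows "h z = 0"
proof (rule ccontr)
  assume hz: "h z \<noteq> 0"
  define g where "g x = Re (h x / h z)" for x
  have gc: "continuous_on torus g" unfolding g_def using hz by (intro continuous_intros h) auto
  have zt: "z \<in> torus" using z by (auto simp: in_torus intro: less_imp_le)
  have op: "open {x :: real^'n. \<forall>i. \<bar>x $ i\<bar> < pi}"
  proof -
    have "{x :: real^'n. \<forall>i. \<bar>x $ i\<bar> < pi} = box (\<chi> i. - pi) (\<chi> i. pi)"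
    proof -
      have "\<bar>t\<bar> < pi \<longleftrightarrow> - pi < t \<and> t < pi" for t by linarith
      then show ?thesis by (simp add: mem_box_cart set_eq_iff)
    qed
    then show ?thesis by (simp only: open_box)
  qed
  have "0 < (1/2::real)" by simp
  then obtain d0 where d0: "d0 > 0" "\<And>x. x \<in> torus \<Longrightarrow> dist x z < d0 \<Longrightarrow> dist (g x) (g z) < 1/2"
    using gc zt unfolding continuous_on_iff by meson
  have "z \<in> {x. \<forall>i. \<bar>x $ i\<bar> < pi}" using z by simp
  then obtain d1 where d1: "d1 > 0" "ball z d1 \<subseteq> {x. \<forall>i. \<bar>x $ i\<bar> < pi}"
    by (rule openE[OF op])
  define d where "d = min d0 d1"
  have d: "d > 0" using d0 d1 by (simp add: d_def)
  have dt: "x \<in> torus" if "x \<in> ball z d" for x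
  proof -
    have "x \<in> ball z d1" using that by (simp add: d_def)
    then have "x \<in> {x. \<forall>i. \<bar>x $ i\<bar> < pi}" using d1(2) by blast
    then show ?thesis by (auto simp: in_torus intro: less_imp_le)
  qed
  have g_half: "g x \<ge> 1/2" if "x \<in> ball z d" for x
  proof -
    have "dist (g x) (g z) < 1/2" using d0(2)[OF dt[OF that]] that by (simp add: d_def dist_commute)
    moreover have "g z = 1" using hz by (simp add: g_def)
    ultimately show ?thesis by (simp only: dist_real_def abs_diff_less_iff) simp
  qed
  obtain M where M: "\<And>x. x \<in> torus \<Longrightarrow> \<bar>g x\<bar> \<le> M"
    using compact_imp_bounded[OF compact_continuous_image[OF gc compact_torus]] bounded_iff by (metis imageI real_norm_def)
  have M0: "M \<ge> 0" using M[OF zt] by linarith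
  have K: "compact (torus - ball z d)" using compact_torus by (intro compact_diff) auto
  obtain \<rho> where \<rho>: "0 \<le> \<rho>" "\<rho> < 1" "\<And>x. x \<in> torus - ball z d \<Longrightarrow> peak z x \<le> \<rho>"
  proof (cases "torus - ball z d = {}")
    case True
    show ?thesis by (rule that[of 0]) (simp_all only: True empty_iff order_refl zero_less_one)
  next
    case False
    then obtain y where y: "y \<in> torus - ball z d" "\<forall>x\<in>torus - ball z d. peak z x \<le> peak z y"
      using continuous_attains_sup[OF K False peak_continuous] by blast
    then have "y \<in> torus" "y \<noteq> z" using d by auto
    show ?thesis
      by (rule that[OF peak_nonneg peak_less_1[OF \<open>y \<in> torus\<close> z \<open>y \<noteq> z\<close>]]) (use y(2) in blast)
  qed
  define \<sigma> where "\<sigma> = (1 + \<rho>) / 2"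
  have \<sigma>: "\<sigma> < 1" "\<rho> < \<sigma>" "\<sigma> > 0" using \<rho> by (simp_all add: \<sigma>_def)
  have "isCont (peak z) z" using peak_continuous[of UNIV z] by (simp add: continuous_on_eq_continuous_at)
  then obtain e0 where e0: "e0 > 0" "\<And>x. dist x z < e0 \<Longrightarrow> dist (peak z x) (peak z z) < 1 - \<sigma>"
    using \<sigma> unfolding continuous_at_eps_delta by (elim allE[of _ "1 - \<sigma>"]) auto
  define e where "e = min e0 d"
  have e: "e > 0" using e0 d by (simp add: e_def)
  have peak_e: "peak z x \<ge> \<sigma>" if "x \<in> ball z e" for x
    using e0(2)[of x] that by (simp add: e_def dist_commute dist_real_def abs_less_iff)
  let ?v = "measure lborel (ball z e)" and ?V = "measure lborel (torus :: (real^'n) set)"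
  have v: "?v > 0" using e by (simp add: content_ball_pos)
  have ib: "integrable lborel (indicator (ball z e) :: real^'n \<Rightarrow> real)"
    using emeasure_bounded_finite[of "ball z e"] by (intro integrable_real_indicator) auto
  have it: "integrable lborel (indicator torus :: real^'n \<Rightarrow> real)"
    using compact_torus emeasure_compact_finite[OF compact_torus] by (intro integrable_real_indicator) auto
  have ineq: "1/2 * \<sigma> ^ N * ?v \<le> M * \<rho> ^ N * ?V" for N
  proof -
    have "(LINT x|lborel. indicator torus x *\<^sub>R ((h x / h z) * complex_of_real (peak z x) ^ N)) = 
        (LINT x|lborel. (1 / h z) * (indicator torus x *\<^sub>R (h x * complex_of_real (peak z x) ^ N)))"
      by (intro Bochner_Integration.integral_cong) (auto simp: indicator_def)
    also have "\<dots> = 0"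
      using integral_trig_poly_zero[OF h zero trig_poly_power[OF trig_poly_peak[of z], of N]]
      by (simp only: integral_mult_right_zero mult_zero_right)
    finally have 0: "(LINT x|lborel. indicator torus x *\<^sub>R ((h x / h z) * complex_of_real (peak z x) ^ N)) = 0" .
    have "integrable lborel (\<lambda>x. indicator torus x *\<^sub>R ((h x / h z) * complex_of_real (peak z x) ^ N))"
      using hz by (intro integrable_torus continuous_intros h trig_poly_continuous trig_poly_power trig_poly_peak) auto
    from integral_Re[OF this] 0
    have "(LINT x|lborel. Re (indicator torus x *\<^sub>R ((h x / h z) * complex_of_real (peak z x) ^ N))) = 0" by simp
    moreover have "Re (indicator torus x *\<^sub>R ((h x / h z) * complex_of_real (peak z x) ^ N)) = indicator torus x *\<^sub>R (g x * peak z x ^ N)" for x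
    proof -
      have "Re (w * complex_of_real r ^ N) = Re w * r ^ N" for w r by (simp flip: of_real_power)
      then show ?thesis by (simp only: g_def scaleR_complex.simps real_scaleR_def)
    qed
    ultimately have 1: "(LINT x|lborel. indicator torus x *\<^sub>R (g x * peak z x ^ N)) = 0" by (simp only:)
    have "(LINT x|lborel. indicator (ball z e) x * (1/2 * \<sigma> ^ N) - indicator torus x * (M * \<rho> ^ N)) \<le>
          (LINT x|lborel. indicator torus x *\<^sub>R (g x * peak z x ^ N))"
    proof (rule integral_mono)
      show "integrable lborel (\<lambda>x. indicator (ball z e) x * (1/2 * \<sigma> ^ N) - indicator torus x * (M * \<rho> ^ N))"
        using ib it by (intro Bochner_Integration.integrable_diff integrable_mult_left)
      show "integrable lborel (\<lambda>x. indicator torus x *\<^sub>R (g x * peak z x ^ N))"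
        by (intro integrable_torus continuous_intros gc peak_continuous)
      fix x :: "real^'n"
      consider "x \<in> ball z e" | "x \<in> ball z d" "x \<notin> ball z e" | "x \<in> torus - ball z d" | "x \<notin> torus" by blast
      then show "indicator (ball z e) x * (1/2 * \<sigma> ^ N) - indicator torus x * (M * \<rho> ^ N) \<le> indicator torus x *\<^sub>R (g x * peak z x ^ N)"
      proof cases
        case 1
        then have xd: "x \<in> ball z d" by (simp add: e_def)
        have "1/2 * \<sigma> ^ N \<le> g x * peak z x ^ N"
          using g_half[OF xd] peak_e[OF 1] \<sigma> by (intro mult_mono power_mono) auto
        moreover have "0 \<le> M * \<rho> ^ N" using M0 \<rho> by simp
        ultimately show ?thesis using 1 dt[OF xd] by simp
      next
        case 2
        have "0 \<le> g x * peak z x ^ N" using g_half[OF 2(1)] peak_nonneg[of z x] by simp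
        moreover have "0 \<le> M * \<rho> ^ N" using M0 \<rho> by simp
        ultimately show ?thesis using 2 dt[OF 2(1)] by simp
      next
        case 3
        then have "x \<notin> ball z e" by (auto simp: e_def)
        have "\<bar>g x * peak z x ^ N\<bar> \<le> M * \<rho> ^ N"
          unfolding abs_mult power_abs
          using M[of x] \<rho>(3)[OF 3] peak_nonneg[of z x] 3 M0 by (intro mult_mono power_mono) auto
        then show ?thesis using 3 \<open>x \<notin> ball z e\<close> by (simp del: mem_ball)
      next
        case 4
        then have "x \<notin> ball z e" using dt by (force simp: e_def)
        then show ?thesis using 4 by (simp del: mem_ball)
      qed
    qed
    also have "(LINT x|lborel. indicator (ball z e) x * (1/2 * \<sigma> ^ N) - indicator torus x * (M * \<rho> ^ N)) = ?v * (1/2 * \<sigma> ^ N) - ?V * (M * \<rho> ^ N)"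
      using ib it by (subst Bochner_Integration.integral_diff) auto
    finally show ?thesis using 1 by (simp add: mult_ac)
  qed
  have "(\<lambda>N. M * (\<rho> / \<sigma>) ^ N * ?V) \<longlonglongrightarrow> M * 0 * ?V"
    using \<rho> \<sigma> by (intro tendsto_intros LIMSEQ_realpow_zero) auto
  moreover have "1/2 * ?v \<le> M * (\<rho> / \<sigma>) ^ N * ?V" for N
    using ineq[of N] \<sigma> by (simp add: power_divide field_simps)
  ultimately have "1/2 * ?v \<le> M * 0 * ?V" by (intro LIMSEQ_le_const) auto
  then show False using v by simp
qed

lemma continuous_on_infsum:
  fixes f :: "'a \<Rightarrow> 'b::topological_space \<Rightarrow> 'c::banach"
  assumes "\<And>k x. x \<in> S \<Longrightarrow> norm (f k x) \<le> M k" "M summable_on UNIV" "\<And>k. continuous_on S (f k)"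
  shows "continuous_on S (\<lambda>x. \<Sum>\<^sub>\<infinity>k. f k x)"
proof (rule uniform_limit_theorem)
  show "uniform_limit S (\<lambda>X x. \<Sum>k\<in>X. f k x) (\<lambda>x. \<Sum>\<^sub>\<infinity>k. f k x) (finite_subsets_at_top UNIV)"
    by (rule Weierstrass_m_test_general[OF _ assms(2)]) (use assms in auto)
  show "\<forall>\<^sub>F X in finite_subsets_at_top UNIV. continuous_on S (\<lambda>x. \<Sum>k\<in>X. f k x)"
    by (intro always_eventually allI continuous_on_sum assms)
qed simp

lemma has_sum_integral_torus:
  fixes f :: "'a \<Rightarrow> real^'n::finite \<Rightarrow> complex"
  assumes f: "\<And>k x. x \<in> torus \<Longrightarrow> cmod (f k x) \<le> M k" "M summable_on UNIV" "\<And>k. continuous_on torus (f k)"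
  shows "((\<lambda>k. LINT x|lborel. indicator torus x *\<^sub>R f k x) has_sum
     (LINT x|lborel. indicator torus x *\<^sub>R (\<Sum>\<^sub>\<infinity>k. f k x))) UNIV"
proof -
  define V where "V = measure lborel (torus :: (real^'n) set)"
  have V: "V \<ge> 0" by (simp add: V_def)
  have lim: "uniform_limit torus (\<lambda>X x. \<Sum>k\<in>X. f k x) (\<lambda>x. \<Sum>\<^sub>\<infinity>k. f k x) (finite_subsets_at_top UNIV)"
    by (rule Weierstrass_m_test_general[OF _ f(2)]) (use f in auto)
  have cont: "continuous_on torus (\<lambda>x. \<Sum>\<^sub>\<infinity>k. f k x)"
    by (rule continuous_on_infsum[OF f])
  have "((\<lambda>X. \<Sum>k\<in>X. LINT x|lborel. indicator torus x *\<^sub>R f k x) \<longlongrightarrow>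
     (LINT x|lborel. indicator torus x *\<^sub>R (\<Sum>\<^sub>\<infinity>k. f k x))) (finite_subsets_at_top UNIV)"
  proof (rule tendstoI)
    fix e :: real assume e: "e > 0"
    define e' where "e' = e / (V + 1)"
    have e': "e' > 0" "V * e' < e" using e V by (simp_all add: e'_def field_simps)
    have "\<forall>\<^sub>F X in finite_subsets_at_top UNIV. \<forall>x\<in>torus. dist (\<Sum>k\<in>X. f k x) (\<Sum>\<^sub>\<infinity>k. f k x) < e'"
      using uniform_limitD[OF lim e'(1)] .
    then show "\<forall>\<^sub>F X in finite_subsets_at_top UNIV. dist (\<Sum>k\<in>X. LINT x|lborel. indicator torus x *\<^sub>R f k x)
        (LINT x|lborel. indicator torus x *\<^sub>R (\<Sum>\<^sub>\<infinity>k. f k x)) < e"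
    proof (rule eventually_mono)
      fix X assume X: "\<forall>x\<in>torus. dist (\<Sum>k\<in>X. f k x) (\<Sum>\<^sub>\<infinity>k. f k x) < e'"
      have int: "integrable lborel (\<lambda>x. indicator torus x *\<^sub>R ((\<Sum>k\<in>X. f k x) - (\<Sum>\<^sub>\<infinity>k. f k x)))"
        by (intro integrable_torus continuous_on_diff continuous_on_sum f cont)
      have "(\<Sum>k\<in>X. LINT x|lborel. indicator torus x *\<^sub>R f k x) = (LINT x|lborel. indicator torus x *\<^sub>R (\<Sum>k\<in>X. f k x))"
        unfolding scaleR_sum_right by (rule Bochner_Integration.integral_sum[symmetric]) (intro integrable_torus f)
      then have "dist (\<Sum>k\<in>X. LINT x|lborel. indicator torus x *\<^sub>R f k x) (LINT x|lborel. indicator torus x *\<^sub>R (\<Sum>\<^sub>\<infinity>k. f k x))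
        = cmod (LINT x|lborel. indicator torus x *\<^sub>R ((\<Sum>k\<in>X. f k x) - (\<Sum>\<^sub>\<infinity>k. f k x)))"
        unfolding dist_norm scaleR_diff_right
        by (subst Bochner_Integration.integral_diff) (auto intro!: integrable_torus continuous_on_sum f cont)
      also have "\<dots> \<le> (LINT x|lborel. cmod (indicator torus x *\<^sub>R ((\<Sum>k\<in>X. f k x) - (\<Sum>\<^sub>\<infinity>k. f k x))))"
        by (rule integral_norm_bound)
      also have "\<dots> \<le> (LINT x|lborel. indicator (torus :: (real^'n) set) x * e')"
      proof (rule integral_mono[OF integrable_norm[OF int]])
        show "integrable lborel (\<lambda>x. indicator (torus :: (real^'n) set) x * e')"
          using emeasure_compact_finite[OF compact_torus]
          by (intro integrable_mult_left integrable_real_indicator) auto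
        show "cmod (indicator torus x *\<^sub>R ((\<Sum>k\<in>X. f k x) - (\<Sum>\<^sub>\<infinity>k. f k x))) \<le> indicator torus x * e'" for x :: "real^'n"
          using X by (auto simp: dist_norm indicator_def intro: less_imp_le)
      qed
      also have "\<dots> = V * e'" by (simp add: V_def)
      finally show "dist (\<Sum>k\<in>X. LINT x|lborel. indicator torus x *\<^sub>R f k x)
        (LINT x|lborel. indicator torus x *\<^sub>R (\<Sum>\<^sub>\<infinity>k. f k x)) < e" using e'(2) by linarith
    qed
  qed
  then show ?thesis by (simp add: has_sum_def)
qed

lemma summable_fourier_coeff:
  fixes f :: "'n::finite cfun"
  assumes f: "f \<in> smooth_on UNIV" and T: "compact T" "\<And>x. x \<notin> T \<Longrightarrow> f x = 0"
  shows "(\<lambda>k. cmod (fourier_coeff f k)) summable_on UNIV"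
proof -
  obtain B where B: "B \<ge> 0" "derivs_bounded T (2 * 1 * CARD('n)) B f"
    using derivs_bounded_compact[OF f T(1) subset_UNIV] by blast
  define C where "C = 2 ^ (1 * CARD('n)) * measure lborel T * B"
  have "cmod (fourier_coeff f k) \<le> C * (1 / japanese k)" for k
    using fourier_coeff_decay[OF f T B(2,1), of k] japanese_ge_1[of k]
    by (simp add: C_def field_simps)
  then show ?thesis
    by (rule Infinite_Sum.abs_summable_on_comparison_test'[OF summable_on_cmult_right[OF summable_on_japanese]])
qed

lemma integral_torus_compact_support:
  fixes f :: "'n::finite cfun"
  assumes "\<And>x. x \<notin> torus \<Longrightarrow> f x = 0"
  shows "(LINT x|lborel. indicator torus x *\<^sub>R (f x * wave (freq k) x)) = of_real ((2 * pi) ^ CARD('n)) * fourier_coeff f (\<lambda>i. - k i)"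
proof -
  have "freq (\<lambda>i. - k i) = - freq k" by (simp add: vec_eq_iff)
  moreover have "indicator torus x *\<^sub>R (f x * wave (freq k) x) = f x * wave (freq k) x" for x
    using assms[of x] by (auto simp: indicator_def)
  ultimately show ?thesis by (simp add: fourier_coeff_def)
qed

theorem fourier_inversion:
  fixes f :: "'n::finite cfun"
  assumes f: "f \<in> smooth_on UNIV" and T: "compact T" "\<And>x. x \<notin> T \<Longrightarrow> f x = 0" "T \<subseteq> torus"
    and z: "\<forall>i. \<bar>z $ i\<bar> < pi"
  shows "f z = (\<Sum>\<^sub>\<infinity>k. fourier_coeff f k * wave (freq k) z)"
proof -
  define a where "a = fourier_coeff f"
  have s: "(\<lambda>k. cmod (a k)) summable_on UNIV" unfolding a_def by (rule summable_fourier_coeff[OF f T(1,2)])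
  define S where "S x = (\<Sum>\<^sub>\<infinity>k. a k * wave (freq k) x)" for x
  have Sc: "continuous_on torus S" unfolding S_def
    by (rule continuous_on_infsum[OF _ s]) (auto simp: norm_mult intro!: continuous_intros continuous_wave)
  have fc: "continuous_on torus f" using smooth_on_continuous[OF f, of "[]"] continuous_on_subset by auto
  have "(LINT x|lborel. indicator torus x *\<^sub>R ((f x - S x) * wave (freq l) x)) = 0" for l
  proof -
    have "((\<lambda>k. LINT x|lborel. indicator torus x *\<^sub>R (a k * wave (freq k) x * wave (freq l) x)) has_sum
       (LINT x|lborel. indicator torus x *\<^sub>R (\<Sum>\<^sub>\<infinity>k. a k * wave (freq k) x * wave (freq l) x))) UNIV"
      by (rule has_sum_integral_torus[OF _ s]) (auto simp: norm_mult intro!: continuous_intros continuous_wave)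
    moreover have "(LINT x|lborel. indicator torus x *\<^sub>R (a k * wave (freq k) x * wave (freq l) x))
       = (if k = (\<lambda>i. - l i) then a k * of_real ((2 * pi) ^ CARD('n)) else 0)" for k
    proof -
      have "indicator torus x *\<^sub>R (a k * wave (freq k) x * wave (freq l) x)
         = a k * (indicator torus x *\<^sub>R wave (freq (\<lambda>i. k i + l i)) x)" for x
        by (simp add: freq_add wave_add scaleR_conv_of_real)
      moreover have "(\<lambda>i. k i + l i) = (\<lambda>_. 0) \<longleftrightarrow> k = (\<lambda>i. - l i)"
        by (auto simp: fun_eq_iff eq_neg_iff_add_eq_0)
      ultimately show ?thesis by (simp only: integral_mult_right_zero integral_wave_torus) simp
    qed
    ultimately have "((\<lambda>k. if k = (\<lambda>i. - l i) then a k * of_real ((2 * pi) ^ CARD('n)) else 0) has_sum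
       (LINT x|lborel. indicator torus x *\<^sub>R (\<Sum>\<^sub>\<infinity>k. a k * wave (freq k) x * wave (freq l) x))) UNIV" by simp
    moreover have "((\<lambda>k. if k = (\<lambda>i. - l i) then a k * of_real ((2 * pi) ^ CARD('n)) else 0) has_sum
       (a (\<lambda>i. - l i) * of_real ((2 * pi) ^ CARD('n)))) UNIV"
      by (rule has_sum_finite_neutralI[of "{\<lambda>i. - l i}"]) auto
    moreover have "(\<Sum>\<^sub>\<infinity>k. a k * wave (freq k) x * wave (freq l) x) = S x * wave (freq l) x" for x
      unfolding S_def by (rule infsum_cmult_left')
    ultimately have "(LINT x|lborel. indicator torus x *\<^sub>R (S x * wave (freq l) x)) = a (\<lambda>i. - l i) * of_real ((2 * pi) ^ CARD('n))"
      using has_sum_unique by simp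
    moreover have "(LINT x|lborel. indicator torus x *\<^sub>R (f x * wave (freq l) x)) = a (\<lambda>i. - l i) * of_real ((2 * pi) ^ CARD('n))"
      unfolding a_def using integral_torus_compact_support[of f l] T by (simp add: mult.commute subset_iff) blast
    ultimately show ?thesis
      unfolding left_diff_distrib scaleR_diff_right
      by (subst Bochner_Integration.integral_diff)
         (auto intro!: integrable_torus continuous_intros continuous_wave fc Sc)
  qed
  then have "f z - S z = 0"
    by (intro trig_peak_uniqueness[OF _ _ z, of "\<lambda>x. f x - S x"] continuous_on_diff fc Sc)
  then show ?thesis by (simp add: S_def a_def)
qed

section \<open>Neumann series in weighted sequence spaces\<close>

lemma double_sum_bound:
  fixes f :: "'a \<Rightarrow> 'b \<Rightarrow> complex"
  assumes s: "\<And>x. (\<lambda>y. cmod (f x y)) summable_on UNIV" and le: "\<And>x. (\<Sum>\<^sub>\<infinity>y. cmod (f x y)) \<le> b x"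
    and b: "b summable_on UNIV"
  shows "(\<lambda>x. cmod (f x y)) summable_on UNIV"
    and "(\<lambda>y. \<Sum>\<^sub>\<infinity>x. cmod (f x y)) summable_on UNIV"
    and "(\<Sum>\<^sub>\<infinity>y. \<Sum>\<^sub>\<infinity>x. cmod (f x y)) \<le> (\<Sum>\<^sub>\<infinity>x. b x)"
    and "(\<Sum>\<^sub>\<infinity>x. \<Sum>\<^sub>\<infinity>y. f x y) = (\<Sum>\<^sub>\<infinity>y. \<Sum>\<^sub>\<infinity>x. f x y)"
    and "(\<lambda>x. \<Sum>\<^sub>\<infinity>y. cmod (f x y)) summable_on UNIV"
proof -
  have nn: "(\<Sum>\<^sub>\<infinity>y. cmod (f x y)) \<ge> 0" for x by (rule infsum_nonneg) simp
  show o: "(\<lambda>x. \<Sum>\<^sub>\<infinity>y. cmod (f x y)) summable_on UNIV"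
    by (rule summable_on_comparison_test[OF b]) (use nn le in auto)
  have 1: "(\<lambda>p. norm (case p of (x, y) \<Rightarrow> f x y)) summable_on UNIV \<times> UNIV"
    using s o nn by (subst Infinite_Sum.abs_summable_on_Sigma_iff) simp
  then have swp: "(\<lambda>(x, y). cmod (f x y)) summable_on UNIV \<times> UNIV" by (simp add: case_prod_unfold)
  have 2: "(\<lambda>p. norm (case p of (y, x) \<Rightarrow> f x y)) summable_on UNIV \<times> UNIV"
    using summable_on_swap[THEN iffD1, OF swp] by (simp add: case_prod_unfold)
  from 2[unfolded Infinite_Sum.abs_summable_on_Sigma_iff]
  show "(\<lambda>x. cmod (f x y)) summable_on UNIV" and
    s2: "(\<lambda>y. \<Sum>\<^sub>\<infinity>x. cmod (f x y)) summable_on UNIV"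
    using infsum_nonneg[of UNIV "\<lambda>x. cmod (f x y)" for y] by auto
  have "(\<Sum>\<^sub>\<infinity>y. \<Sum>\<^sub>\<infinity>x. cmod (f x y)) = (\<Sum>\<^sub>\<infinity>x. \<Sum>\<^sub>\<infinity>y. cmod (f x y))"
    by (rule infsum_swap_banach[symmetric, OF swp])
  also have "\<dots> \<le> (\<Sum>\<^sub>\<infinity>x. b x)" by (rule infsum_mono[OF o b]) (use le in auto)
  finally show "(\<Sum>\<^sub>\<infinity>y. \<Sum>\<^sub>\<infinity>x. cmod (f x y)) \<le> (\<Sum>\<^sub>\<infinity>x. b x)" .
  show "(\<Sum>\<^sub>\<infinity>x. \<Sum>\<^sub>\<infinity>y. f x y) = (\<Sum>\<^sub>\<infinity>y. \<Sum>\<^sub>\<infinity>x. f x y)"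
    by (rule infsum_swap_banach[OF abs_summable_summable[OF 1]])
qed

lemma norm_infsum_le':
  fixes f :: "'a \<Rightarrow> complex"
  assumes "(\<lambda>x. cmod (f x)) summable_on UNIV"
  shows "cmod (\<Sum>\<^sub>\<infinity>x. f x) \<le> (\<Sum>\<^sub>\<infinity>x. cmod (f x))"
  using norm_infsum_bound[of f UNIV] assms by simp

definition weighted_sum_le :: "('k \<Rightarrow> real) \<Rightarrow> ('k \<Rightarrow> complex) \<Rightarrow> real \<Rightarrow> bool" where
  "weighted_sum_le w v A \<longleftrightarrow> (\<lambda>k. w k * cmod (v k)) summable_on UNIV \<and> (\<Sum>\<^sub>\<infinity>k. w k * cmod (v k)) \<le> A"

lemma weighted_sum_le_mono:
  assumes v: "weighted_sum_le w v A" and le: "\<And>k. 0 \<le> w' k" "\<And>k. w' k * cmod (v' k) \<le> w k * cmod (v k)"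
  shows "weighted_sum_le w' v' A"
proof -
  have s: "(\<lambda>k. w' k * cmod (v' k)) summable_on UNIV"
    by (rule summable_on_comparison_test[of "\<lambda>k. w k * cmod (v k)"]) (use v le in \<open>auto simp: weighted_sum_le_def\<close>)
  have "(\<Sum>\<^sub>\<infinity>k. w' k * cmod (v' k)) \<le> (\<Sum>\<^sub>\<infinity>k. w k * cmod (v k))"
    by (rule infsum_mono[OF s]) (use v le in \<open>auto simp: weighted_sum_le_def\<close>)
  then show ?thesis using v s by (simp add: weighted_sum_le_def)
qed

definition column_bounded :: "('k \<Rightarrow> real) \<Rightarrow> ('k \<Rightarrow> 'k \<Rightarrow> complex) \<Rightarrow> real \<Rightarrow> bool" where
  "column_bounded w K \<theta> \<longleftrightarrow> (\<forall>\<xi>. weighted_sum_le w (\<lambda>\<zeta>. K \<zeta> \<xi>) (\<theta> * w \<xi>))"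

lemma column_bounded_apply:
  assumes K: "column_bounded w K \<theta>" and w: "\<And>k. w k > 0" and \<theta>: "\<theta> \<ge> 0" and v: "weighted_sum_le w v A"
  shows "weighted_sum_le w (\<lambda>\<zeta>. - (\<Sum>\<^sub>\<infinity>\<xi>. K \<zeta> \<xi> * v \<xi>)) (\<theta> * A)"
    and "(\<lambda>\<xi>. cmod (K \<zeta> \<xi> * v \<xi>)) summable_on UNIV"
proof -
  define f where "f \<xi> \<zeta> = complex_of_real (w \<zeta>) * (K \<zeta> \<xi> * v \<xi>)" for \<xi> \<zeta>
  have nf: "cmod (f \<xi> \<zeta>) = w \<zeta> * cmod (K \<zeta> \<xi>) * cmod (v \<xi>)" "cmod (f \<xi> \<zeta>) = w \<zeta> * cmod (K \<zeta> \<xi> * v \<xi>)" for \<xi> \<zeta>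
    using w[of \<zeta>] by (simp_all add: f_def norm_mult)
  have s1: "(\<lambda>\<zeta>. cmod (f \<xi> \<zeta>)) summable_on UNIV" for \<xi>
    unfolding nf(1) using K by (intro summable_on_cmult_left) (simp add: column_bounded_def weighted_sum_le_def)
  have s2: "(\<Sum>\<^sub>\<infinity>\<zeta>. cmod (f \<xi> \<zeta>)) \<le> \<theta> * (w \<xi> * cmod (v \<xi>))" for \<xi>
  proof -
    have "(\<Sum>\<^sub>\<infinity>\<zeta>. cmod (f \<xi> \<zeta>)) = (\<Sum>\<^sub>\<infinity>\<zeta>. w \<zeta> * cmod (K \<zeta> \<xi>)) * cmod (v \<xi>)"
      unfolding nf(1) by (rule infsum_cmult_left')
    also have "\<dots> \<le> (\<theta> * w \<xi>) * cmod (v \<xi>)"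
      using K by (intro mult_right_mono) (simp_all add: column_bounded_def weighted_sum_le_def)
    finally show ?thesis by (simp add: mult.assoc)
  qed
  have s3: "(\<lambda>\<xi>. \<theta> * (w \<xi> * cmod (v \<xi>))) summable_on UNIV"
    using v by (intro summable_on_cmult_right) (simp add: weighted_sum_le_def)
  note ds = double_sum_bound[OF s1 s2 s3]
  have s4: "(\<lambda>\<xi>. cmod (K \<zeta> \<xi> * v \<xi>)) summable_on UNIV" for \<zeta>
    using ds(1)[of \<zeta>] w[of \<zeta>] unfolding nf(2) by (subst (asm) summable_on_cmult_right') auto
  then show "(\<lambda>\<xi>. cmod (K \<zeta> \<xi> * v \<xi>)) summable_on UNIV" .
  have le: "w \<zeta> * cmod (- (\<Sum>\<^sub>\<infinity>\<xi>. K \<zeta> \<xi> * v \<xi>)) \<le> (\<Sum>\<^sub>\<infinity>\<xi>. cmod (f \<xi> \<zeta>))" for \<zeta>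
    unfolding nf(2) infsum_cmult_right' norm_minus_cancel
    using w[of \<zeta>] norm_infsum_le'[OF s4] by (intro mult_left_mono) auto
  have s5: "(\<lambda>\<zeta>. w \<zeta> * cmod (- (\<Sum>\<^sub>\<infinity>\<xi>. K \<zeta> \<xi> * v \<xi>))) summable_on UNIV"
    by (rule summable_on_comparison_test[OF ds(2)]) (use le w less_imp_le in \<open>auto intro!: mult_nonneg_nonneg\<close>)
  have "(\<Sum>\<^sub>\<infinity>\<zeta>. w \<zeta> * cmod (- (\<Sum>\<^sub>\<infinity>\<xi>. K \<zeta> \<xi> * v \<xi>))) \<le> (\<Sum>\<^sub>\<infinity>\<zeta>. \<Sum>\<^sub>\<infinity>\<xi>. cmod (f \<xi> \<zeta>))"
    by (rule infsum_mono[OF s5 ds(2)]) (rule le)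
  also have "\<dots> \<le> (\<Sum>\<^sub>\<infinity>\<xi>. \<theta> * (w \<xi> * cmod (v \<xi>)))" by (rule ds(3))
  also have "\<dots> = \<theta> * (\<Sum>\<^sub>\<infinity>\<xi>. w \<xi> * cmod (v \<xi>))" by (rule infsum_cmult_right')
  also have "\<dots> \<le> \<theta> * A" using v \<theta> by (intro mult_left_mono) (auto simp: weighted_sum_le_def)
  finally show "weighted_sum_le w (\<lambda>\<zeta>. - (\<Sum>\<^sub>\<infinity>\<xi>. K \<zeta> \<xi> * v \<xi>)) (\<theta> * A)"
    using s5 by (simp add: weighted_sum_le_def)
qed

fun neumann_iter :: "('k \<Rightarrow> 'k \<Rightarrow> complex) \<Rightarrow> ('k \<Rightarrow> complex) \<Rightarrow> nat \<Rightarrow> 'k \<Rightarrow> complex" where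
  "neumann_iter K g 0 = g"
| "neumann_iter K g (Suc j) = (\<lambda>\<zeta>. - (\<Sum>\<^sub>\<infinity>\<xi>. K \<zeta> \<xi> * neumann_iter K g j \<xi>))"

definition neumann :: "('k \<Rightarrow> 'k \<Rightarrow> complex) \<Rightarrow> ('k \<Rightarrow> complex) \<Rightarrow> 'k \<Rightarrow> complex" where
  "neumann K g \<zeta> = (\<Sum>\<^sub>\<infinity>j. neumann_iter K g j \<zeta>)"

context
  fixes w :: "'k \<Rightarrow> real" and K :: "'k \<Rightarrow> 'k \<Rightarrow> complex" and g :: "'k \<Rightarrow> complex" and \<theta> A :: real
  assumes K: "column_bounded w K \<theta>" and w: "\<And>k. w k > 0" and \<theta>: "0 \<le> \<theta>" "\<theta> < 1"
    and g: "weighted_sum_le w g A"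
begin

lemma neumann_iter_bound: "weighted_sum_le w (neumann_iter K g j) (\<theta> ^ j * A)"
proof (induction j)
  case (Suc j)
  show ?case using column_bounded_apply(1)[OF K w \<theta>(1) Suc] by (simp add: mult.assoc)
qed (use g in simp)

lemma geometric_has_sum: "((\<lambda>j. \<theta> ^ j * A) has_sum (A / (1 - \<theta>))) UNIV"
proof -
  have "((\<lambda>j. \<theta> ^ j) has_sum (1 / (1 - \<theta>))) UNIV"
    using \<theta> by (intro sums_nonneg_imp_has_sum geometric_sums) auto
  from has_sum_cmult_left[OF this, of A] show ?thesis by simp
qed

lemma neumann_bound: "weighted_sum_le w (neumann K g) (A / (1 - \<theta>))"
  and neumann_iter_summable: "(\<lambda>j. cmod (neumann_iter K g j \<zeta>)) summable_on UNIV"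
proof -
  define f where "f j \<zeta> = complex_of_real (w \<zeta>) * neumann_iter K g j \<zeta>" for j \<zeta>
  have nf: "cmod (f j \<zeta>) = w \<zeta> * cmod (neumann_iter K g j \<zeta>)" for j \<zeta>
    using w[of \<zeta>] by (simp add: f_def norm_mult)
  have s1: "(\<lambda>\<zeta>. cmod (f j \<zeta>)) summable_on UNIV" and s2: "(\<Sum>\<^sub>\<infinity>\<zeta>. cmod (f j \<zeta>)) \<le> \<theta> ^ j * A" for j
    unfolding nf using neumann_iter_bound[of j] by (simp_all add: weighted_sum_le_def)
  note ds = double_sum_bound[OF s1 s2 has_sum_imp_summable[OF geometric_has_sum]]
  have s4: "(\<lambda>j. cmod (neumann_iter K g j \<zeta>)) summable_on UNIV" for \<zeta>
    using ds(1)[of \<zeta>] w[of \<zeta>] unfolding nf by (subst (asm) summable_on_cmult_right') auto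
  then show "(\<lambda>j. cmod (neumann_iter K g j \<zeta>)) summable_on UNIV" .
  have le: "w \<zeta> * cmod (neumann K g \<zeta>) \<le> (\<Sum>\<^sub>\<infinity>j. cmod (f j \<zeta>))" for \<zeta>
    unfolding nf infsum_cmult_right' neumann_def
    using w[of \<zeta>] norm_infsum_le'[OF s4] by (intro mult_left_mono) auto
  have s5: "(\<lambda>\<zeta>. w \<zeta> * cmod (neumann K g \<zeta>)) summable_on UNIV"
    by (rule summable_on_comparison_test[OF ds(2)]) (use le w less_imp_le in \<open>auto intro!: mult_nonneg_nonneg\<close>)
  have "(\<Sum>\<^sub>\<infinity>\<zeta>. w \<zeta> * cmod (neumann K g \<zeta>)) \<le> (\<Sum>\<^sub>\<infinity>\<zeta>. \<Sum>\<^sub>\<infinity>j. cmod (f j \<zeta>))"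
    by (rule infsum_mono[OF s5 ds(2)]) (rule le)
  also have "\<dots> \<le> (\<Sum>\<^sub>\<infinity>j. \<theta> ^ j * A)" by (rule ds(3))
  also have "\<dots> = A / (1 - \<theta>)" using geometric_has_sum by (rule infsumI)
  finally show "weighted_sum_le w (neumann K g) (A / (1 - \<theta>))" using s5 by (simp add: weighted_sum_le_def)
qed

end

lemma infsum_nat_split:
  fixes f :: "nat \<Rightarrow> complex"
  assumes "(\<lambda>j. cmod (f j)) summable_on UNIV"
  shows "(\<Sum>\<^sub>\<infinity>j. f j) = f 0 + (\<Sum>\<^sub>\<infinity>j. f (Suc j))"
proof -
  have s: "f summable_on A" for A
    using summable_on_subset_banach[OF abs_summable_summable[of f UNIV]] assms by auto
  have "(\<Sum>\<^sub>\<infinity>j. f j) = (\<Sum>\<^sub>\<infinity>j\<in>insert 0 (range Suc). f j)" by (simp only: UNIV_nat_eq[symmetric])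
  also have "\<dots> = f 0 + (\<Sum>\<^sub>\<infinity>j\<in>range Suc. f j)" by (rule infsum_insert[OF s]) auto
  also have "(\<Sum>\<^sub>\<infinity>j\<in>range Suc. f j) = (\<Sum>\<^sub>\<infinity>j. f (Suc j))" by (subst infsum_reindex) (auto simp: o_def)
  finally show ?thesis .
qed

lemma neumann_equation:
  assumes K: "column_bounded (\<lambda>_. 1) K \<theta>" and \<theta>: "0 \<le> \<theta>" "\<theta> < 1" and g: "weighted_sum_le (\<lambda>_. 1) g A"
  shows "neumann K g \<zeta> = g \<zeta> - (\<Sum>\<^sub>\<infinity>\<xi>. K \<zeta> \<xi> * neumann K g \<xi>)"
proof -
  note b = neumann_iter_bound[OF K zero_less_one \<theta> g]
  have Kb: "cmod (K \<zeta> \<xi>) \<le> \<theta>" for \<xi>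
  proof -
    have s: "(\<lambda>\<zeta>. cmod (K \<zeta> \<xi>)) summable_on UNIV" "(\<Sum>\<^sub>\<infinity>\<zeta>. cmod (K \<zeta> \<xi>)) \<le> \<theta>"
      using K by (simp_all add: column_bounded_def weighted_sum_le_def)
    have "cmod (K \<zeta> \<xi>) \<le> (\<Sum>\<^sub>\<infinity>\<zeta>. cmod (K \<zeta> \<xi>))"
      using finite_sum_le_infsum[OF s(1), of "{\<zeta>}"] by simp
    then show ?thesis using s by simp
  qed
  define f where "f j \<xi> = K \<zeta> \<xi> * neumann_iter K g j \<xi>" for j \<xi>
  have it: "(\<lambda>\<xi>. cmod (neumann_iter K g j \<xi>)) summable_on UNIV" "(\<Sum>\<^sub>\<infinity>\<xi>. cmod (neumann_iter K g j \<xi>)) \<le> \<theta> ^ j * A" for j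
    using b[of j] by (simp_all add: weighted_sum_le_def)
  have le: "cmod (f j \<xi>) \<le> cmod (neumann_iter K g j \<xi>)" for j \<xi>
    unfolding f_def norm_mult using Kb[of \<xi>] \<theta> by (intro mult_left_le_one_le) auto
  have s1: "(\<lambda>\<xi>. cmod (f j \<xi>)) summable_on UNIV" for j
    by (rule summable_on_comparison_test[OF it(1)]) (use le in auto)
  have s2: "(\<Sum>\<^sub>\<infinity>\<xi>. cmod (f j \<xi>)) \<le> \<theta> ^ j * A" for j
    using infsum_mono[OF s1 it(1) le] it(2) order_trans by blast
  note ds = double_sum_bound[OF s1 s2 has_sum_imp_summable[OF geometric_has_sum[OF K zero_less_one \<theta> g]]]
  have "neumann K g \<zeta> = g \<zeta> + (\<Sum>\<^sub>\<infinity>j. - (\<Sum>\<^sub>\<infinity>\<xi>. f j \<xi>))"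
    unfolding neumann_def
    by (subst infsum_nat_split[OF neumann_iter_summable[OF K zero_less_one \<theta> g]]) (simp add: f_def[abs_def])
  also have "(\<Sum>\<^sub>\<infinity>j. - (\<Sum>\<^sub>\<infinity>\<xi>. f j \<xi>)) = - (\<Sum>\<^sub>\<infinity>j. \<Sum>\<^sub>\<infinity>\<xi>. f j \<xi>)" by (rule infsum_uminus)
  also have "(\<Sum>\<^sub>\<infinity>j. \<Sum>\<^sub>\<infinity>\<xi>. f j \<xi>) = (\<Sum>\<^sub>\<infinity>\<xi>. \<Sum>\<^sub>\<infinity>j. f j \<xi>)" by (rule ds(4))
  also have "\<dots> = (\<Sum>\<^sub>\<infinity>\<xi>. K \<zeta> \<xi> * neumann K g \<xi>)"
    unfolding f_def neumann_def infsum_cmult_right' ..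
  finally show ?thesis by simp
qed

definition freq_size :: "('n::finite \<Rightarrow> int) \<Rightarrow> real" where
  "freq_size k = (\<Sum>i\<in>UNIV. \<bar>of_int (k i)\<bar>)"

lemma freq_size_nonneg: "freq_size k \<ge> 0"
  unfolding freq_size_def by (simp add: sum_nonneg)

lemma freq_size_add: "freq_size (\<lambda>i. k i + l i) \<le> freq_size k + freq_size l"
  unfolding freq_size_def sum.distrib[symmetric] by (rule sum_mono) simp

lemma freq_size_le_japanese: "1 + freq_size k \<le> japanese k"
proof -
  have "1 + (\<Sum>i\<in>A. \<bar>real_of_int (k i)\<bar>) \<le> (\<Prod>i\<in>A. 1 + (real_of_int (k i))\<^sup>2)" if "finite A" for A
    using that
  proof (induction A rule: finite_induct)
    case (insert a A)
    have "\<bar>real_of_int (k a)\<bar> \<le> (real_of_int (k a))\<^sup>2"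
    proof -
      have "\<bar>k a\<bar> \<le> \<bar>k a\<bar> * \<bar>k a\<bar>" 
      proof (cases "k a = 0")
        case False
        then have "1 \<le> \<bar>k a\<bar>" by linarith
        from mult_left_mono[OF this, of "\<bar>k a\<bar>"] show ?thesis by simp
      qed simp
      then have "real_of_int \<bar>k a\<bar> \<le> real_of_int (\<bar>k a\<bar> * \<bar>k a\<bar>)" by (simp only: of_int_le_iff)
      then show ?thesis by (simp add: power2_eq_square)
    qed
    moreover have "(1 + \<bar>real_of_int (k a)\<bar>) * (1 + (\<Sum>i\<in>A. \<bar>real_of_int (k i)\<bar>)) \<ge> 1 + \<bar>real_of_int (k a)\<bar> + (\<Sum>i\<in>A. \<bar>real_of_int (k i)\<bar>)"
      using mult_nonneg_nonneg[of "\<bar>real_of_int (k a)\<bar>" "\<Sum>i\<in>A. \<bar>real_of_int (k i)\<bar>"] by (simp add: algebra_simps sum_nonneg)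
    moreover have "(1 + \<bar>real_of_int (k a)\<bar>) * (1 + (\<Sum>i\<in>A. \<bar>real_of_int (k i)\<bar>)) \<le>
        (1 + (real_of_int (k a))\<^sup>2) * (\<Prod>i\<in>A. 1 + (real_of_int (k i))\<^sup>2)"
      using insert.IH calculation(1) by (intro mult_mono) (auto simp: sum_nonneg intro!: add_nonneg_nonneg)
    ultimately show ?case using insert by simp
  qed simp
  from this[of UNIV] show ?thesis by (simp add: freq_size_def japanese_def)
qed

definition japanese_sum :: "'n::finite itself \<Rightarrow> real" where
  "japanese_sum _ = (\<Sum>\<^sub>\<infinity>k :: 'n \<Rightarrow> int. 1 / japanese k)"

lemma japanese_sum_pos: "japanese_sum TYPE('n::finite) > 0"
proof -
  have "(\<Sum>k\<in>{\<lambda>_::'n. 0::int}. 1 / japanese k) \<le> (\<Sum>\<^sub>\<infinity>k :: 'n \<Rightarrow> int. 1 / japanese k)"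
    using japanese_ge_1 by (intro finite_sum_le_infsum[OF summable_on_japanese]) (auto intro: order_trans[OF zero_le_one])
  then show ?thesis by (simp add: japanese_sum_def japanese_def)
qed

lemma weighted_sum_le_decay:
  fixes b :: "('n::finite \<Rightarrow> int) \<Rightarrow> complex"
  assumes b: "\<And>k. cmod (b k) * japanese k ^ Suc s \<le> C"
  shows "weighted_sum_le (\<lambda>k. (1 + freq_size k) ^ s) b (C * japanese_sum TYPE('n))"
proof -
  have le: "(1 + freq_size k) ^ s * cmod (b k) \<le> C * (1 / japanese k)" for k
  proof -
    have "(1 + freq_size k) ^ s * cmod (b k) \<le> japanese k ^ s * cmod (b k)"
      using freq_size_nonneg[of k] by (intro mult_right_mono power_mono freq_size_le_japanese) auto
    also have "\<dots> = cmod (b k) * japanese k ^ Suc s * (1 / japanese k)"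
      using japanese_ge_1[of k] by simp
    also have "\<dots> \<le> C * (1 / japanese k)"
      using b[of k] japanese_ge_1[of k] by (intro mult_right_mono) auto
    finally show ?thesis .
  qed
  have s: "(\<lambda>k :: 'n \<Rightarrow> int. C * (1 / japanese k)) summable_on UNIV"
    by (rule summable_on_cmult_right[OF summable_on_japanese])
  have s': "(\<lambda>k. (1 + freq_size k) ^ s * cmod (b k)) summable_on UNIV"
    by (rule summable_on_comparison_test[OF s]) (use le freq_size_nonneg in \<open>auto intro!: mult_nonneg_nonneg zero_le_power add_nonneg_nonneg\<close>)
  have "(\<Sum>\<^sub>\<infinity>k. (1 + freq_size k) ^ s * cmod (b k)) \<le> (\<Sum>\<^sub>\<infinity>k :: 'n \<Rightarrow> int. C * (1 / japanese k))"
    by (rule infsum_mono[OF s' s]) (rule le)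
  also have "\<dots> = C * japanese_sum TYPE('n)" unfolding japanese_sum_def by (rule infsum_cmult_right')
  finally show ?thesis using s' by (simp add: weighted_sum_le_def)
qed

lemma power_interpolate:
  fixes \<delta> t :: real
  assumes "0 \<le> \<delta>" "\<delta> \<le> 1" "0 \<le> t"
  shows "(1 + \<delta> * t) ^ s \<le> 1 + \<delta> * ((1 + t) ^ s - 1)"
proof (induction s)
  case (Suc s)
  have A: "(1 + t) ^ s \<ge> 1" using assms by simp
  have "(1 + \<delta> * t) ^ Suc s \<le> (1 + \<delta> * t) * (1 + \<delta> * ((1 + t) ^ s - 1))"
    using Suc assms by (simp add: mult_left_mono)
  also have "\<dots> = 1 + \<delta> * t + \<delta> * ((1 + t) ^ s - 1) + \<delta> * (\<delta> * (t * ((1 + t) ^ s - 1)))"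
    by (simp add: algebra_simps)
  also have "\<dots> \<le> 1 + \<delta> * t + \<delta> * ((1 + t) ^ s - 1) + \<delta> * (1 * (t * ((1 + t) ^ s - 1)))"
    using assms A by (intro add_left_mono mult_left_mono mult_right_mono) auto
  also have "\<dots> = 1 + \<delta> * ((1 + t) ^ Suc s - 1)" by (simp add: algebra_simps)
  finally show ?case .
qed simp

lemma infsum_translate:
  fixes f :: "('n \<Rightarrow> int) \<Rightarrow> 'b::{t2_space, comm_monoid_add}"
  shows "(\<Sum>\<^sub>\<infinity>\<zeta>. f (\<lambda>i. \<zeta> i - \<xi> i)) = (\<Sum>\<^sub>\<infinity>\<eta>. f \<eta>)"
    and "(\<lambda>\<zeta>. f (\<lambda>i. \<zeta> i - \<xi> i)) summable_on UNIV \<longleftrightarrow> f summable_on UNIV"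
proof -
  have b: "bij_betw (\<lambda>\<zeta> i. \<zeta> i - \<xi> i) UNIV UNIV"
    by (rule bij_betw_byWitness[where f' = "\<lambda>\<zeta> i. \<zeta> i + \<xi> i"]) auto
  show "(\<Sum>\<^sub>\<infinity>\<zeta>. f (\<lambda>i. \<zeta> i - \<xi> i)) = (\<Sum>\<^sub>\<infinity>\<eta>. f \<eta>)"
    by (rule infsum_reindex_bij_betw[OF b])
  show "(\<lambda>\<zeta>. f (\<lambda>i. \<zeta> i - \<xi> i)) summable_on UNIV \<longleftrightarrow> f summable_on UNIV"
    by (rule summable_on_reindex_bij_betw[OF b])
qed

text \<open>The weights \<open>(1 + \<delta> |k|)\<^sup>s\<close> all yield equivalent norms, but the operator norm
  tends to the one of the unweighted space as \<open>\<delta> \<rightarrow> 0\<close>. This is why a single smallness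
  condition makes the same Neumann series converge for all \<open>s\<close>.\<close>

lemma convolution_kernel_column_bounded:
  fixes b :: "('n::finite \<Rightarrow> int) \<Rightarrow> ('n \<Rightarrow> int) \<Rightarrow> complex"
  assumes small: "\<And>\<xi> \<eta>. cmod (b \<xi> \<eta>) * japanese \<eta> \<le> 1 / (2 * japanese_sum TYPE('n))"
    and C: "\<And>\<xi> \<eta>. cmod (b \<xi> \<eta>) * japanese \<eta> ^ Suc s \<le> C" "C \<ge> 0"
    and \<delta>: "\<delta> = 1 / (4 * (C * japanese_sum TYPE('n) + 1))"
  shows "column_bounded (\<lambda>k. (1 + \<delta> * freq_size k) ^ s) (\<lambda>\<zeta> \<xi>. b \<xi> (\<lambda>i. \<zeta> i - \<xi> i)) (3 / 4)"
  unfolding column_bounded_def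
proof
  fix \<xi>
  let ?J = "japanese_sum TYPE('n)"
  define w where "w k = (1 + \<delta> * freq_size k) ^ s" for k :: "'n \<Rightarrow> int"
  have CJ: "C * ?J \<ge> 0" using C japanese_sum_pos[where 'n = 'n] by simp
  have \<delta>': "0 \<le> \<delta>" "\<delta> \<le> 1" "\<delta> * (C * ?J) \<le> 1 / 4" using CJ by (simp_all add: \<delta> field_simps)
  have wn: "w k \<ge> 0" for k using \<delta>' freq_size_nonneg[of k] by (simp add: w_def)
  have 0: "weighted_sum_le (\<lambda>k. (1 + freq_size k) ^ 0) (b \<xi>) (1 / (2 * ?J) * ?J)"
    by (rule weighted_sum_le_decay) (use small in simp)
  have 1: "weighted_sum_le (\<lambda>k. (1 + freq_size k) ^ s) (b \<xi>) (C * ?J)"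
    by (rule weighted_sum_le_decay) (rule C)
  have s0: "(\<lambda>k. cmod (b \<xi> k)) summable_on UNIV" "(\<Sum>\<^sub>\<infinity>k. cmod (b \<xi> k)) \<le> 1 / 2"
    using 0 japanese_sum_pos[where 'n = 'n] by (simp_all add: weighted_sum_le_def)
  have s1: "(\<lambda>k. \<delta> * ((1 + freq_size k) ^ s * cmod (b \<xi> k))) summable_on UNIV"
    using 1 by (intro summable_on_cmult_right) (simp add: weighted_sum_le_def)
  have i1: "(\<Sum>\<^sub>\<infinity>k. \<delta> * ((1 + freq_size k) ^ s * cmod (b \<xi> k))) \<le> 1 / 4"
    unfolding infsum_cmult_right'
    using 1 \<delta>' by (intro order_trans[OF mult_left_mono \<delta>'(3)]) (auto simp: weighted_sum_le_def)
  have s2: "(\<lambda>k. cmod (b \<xi> k) + \<delta> * ((1 + freq_size k) ^ s * cmod (b \<xi> k))) summable_on UNIV"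
    by (rule summable_on_add[OF s0(1) s1])
  have le: "w k * cmod (b \<xi> k) \<le> cmod (b \<xi> k) + \<delta> * ((1 + freq_size k) ^ s * cmod (b \<xi> k))" for k
  proof -
    have "w k \<le> 1 + \<delta> * (1 + freq_size k) ^ s"
      using power_interpolate[OF \<delta>'(1,2) freq_size_nonneg, of k s] \<delta>'(1) by (simp add: w_def right_diff_distrib)
    from mult_right_mono[OF this norm_ge_zero[of "b \<xi> k"]] show ?thesis by (simp add: algebra_simps)
  qed
  have s3: "(\<lambda>k. w k * cmod (b \<xi> k)) summable_on UNIV"
    by (rule summable_on_comparison_test[OF s2]) (use le wn in auto)
  have "(\<Sum>\<^sub>\<infinity>k. w k * cmod (b \<xi> k)) \<le> (\<Sum>\<^sub>\<infinity>k. cmod (b \<xi> k) + \<delta> * ((1 + freq_size k) ^ s * cmod (b \<xi> k)))"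
    by (rule infsum_mono[OF s3 s2]) (rule le)
  also have "\<dots> \<le> 3 / 4" using infsum_add[OF s0(1) s1] s0(2) i1 by simp
  finally have i3: "(\<Sum>\<^sub>\<infinity>k. w k * cmod (b \<xi> k)) \<le> 3 / 4" .
  have sub: "w \<zeta> \<le> w \<xi> * w (\<lambda>i. \<zeta> i - \<xi> i)" for \<zeta>
  proof -
    have "freq_size \<zeta> \<le> freq_size \<xi> + freq_size (\<lambda>i. \<zeta> i - \<xi> i)"
      using freq_size_add[of \<xi> "\<lambda>i. \<zeta> i - \<xi> i"] by simp
    then have "\<delta> * freq_size \<zeta> \<le> \<delta> * (freq_size \<xi> + freq_size (\<lambda>i. \<zeta> i - \<xi> i))" using \<delta>'(1) by (rule mult_left_mono)
    moreover have "0 \<le> (\<delta> * freq_size \<xi>) * (\<delta> * freq_size (\<lambda>i. \<zeta> i - \<xi> i))"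
      using \<delta>'(1) by (intro mult_nonneg_nonneg freq_size_nonneg)
    ultimately have "1 + \<delta> * freq_size \<zeta> \<le> (1 + \<delta> * freq_size \<xi>) * (1 + \<delta> * freq_size (\<lambda>i. \<zeta> i - \<xi> i))"
      by (simp add: algebra_simps)
    then show ?thesis unfolding w_def power_mult_distrib[symmetric]
      using \<delta>'(1) freq_size_nonneg[of \<zeta>] by (intro power_mono) auto
  qed
  have s4: "(\<lambda>\<zeta>. w \<xi> * (w (\<lambda>i. \<zeta> i - \<xi> i) * cmod (b \<xi> (\<lambda>i. \<zeta> i - \<xi> i)))) summable_on UNIV"
    using s3 by (intro summable_on_cmult_right) (simp add: infsum_translate(2)[of "\<lambda>k. w k * cmod (b \<xi> k)"])
  have le4: "w \<zeta> * cmod (b \<xi> (\<lambda>i. \<zeta> i - \<xi> i)) \<le> w \<xi> * (w (\<lambda>i. \<zeta> i - \<xi> i) * cmod (b \<xi> (\<lambda>i. \<zeta> i - \<xi> i)))" for \<zeta>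
    using mult_right_mono[OF sub norm_ge_zero] by (simp add: mult.assoc)
  have s5: "(\<lambda>\<zeta>. w \<zeta> * cmod (b \<xi> (\<lambda>i. \<zeta> i - \<xi> i))) summable_on UNIV"
    by (rule summable_on_comparison_test[OF s4]) (use le4 wn in auto)
  have "(\<Sum>\<^sub>\<infinity>\<zeta>. w \<zeta> * cmod (b \<xi> (\<lambda>i. \<zeta> i - \<xi> i))) \<le> (\<Sum>\<^sub>\<infinity>\<zeta>. w \<xi> * (w (\<lambda>i. \<zeta> i - \<xi> i) * cmod (b \<xi> (\<lambda>i. \<zeta> i - \<xi> i))))"
    by (rule infsum_mono[OF s5 s4]) (rule le4)
  also have "\<dots> = w \<xi> * (\<Sum>\<^sub>\<infinity>k. w k * cmod (b \<xi> k))"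
    unfolding infsum_cmult_right' by (subst infsum_translate(1)[of "\<lambda>k. w k * cmod (b \<xi> k)"]) simp
  also have "\<dots> \<le> w \<xi> * (3 / 4)" using i3 wn by (rule mult_left_mono)
  finally show "weighted_sum_le (\<lambda>k. (1 + \<delta> * freq_size k) ^ s) (\<lambda>\<zeta>. b \<xi> (\<lambda>i. \<zeta> i - \<xi> i)) (3 / 4 * (1 + \<delta> * freq_size \<xi>) ^ s)"
    using s5 by (simp add: weighted_sum_le_def w_def mult.commute)
qed

lemma convolution_neumann:
  fixes b :: "('n::finite \<Rightarrow> int) \<Rightarrow> ('n \<Rightarrow> int) \<Rightarrow> complex"
  assumes small: "\<And>\<xi> \<eta>. cmod (b \<xi> \<eta>) * japanese \<eta> \<le> 1 / (2 * japanese_sum TYPE('n))"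
    and C: "\<And>\<xi> \<eta>. cmod (b \<xi> \<eta>) * japanese \<eta> ^ Suc s \<le> C" "C \<ge> 0"
    and g: "\<And>k. cmod (g k) * japanese k ^ Suc s \<le> G"
  defines "v \<equiv> neumann (\<lambda>\<zeta> \<xi>. b \<xi> (\<lambda>i. \<zeta> i - \<xi> i)) g"
  shows "v \<zeta> = g \<zeta> - (\<Sum>\<^sub>\<infinity>\<xi>. b \<xi> (\<lambda>i. \<zeta> i - \<xi> i) * v \<xi>)"
    and "weighted_sum_le (\<lambda>k. (1 + freq_size k) ^ s) v
      (4 * japanese_sum TYPE('n) * (4 * (C * japanese_sum TYPE('n) + 1)) ^ s * G)"
proof -
  let ?J = "japanese_sum TYPE('n)"
  have J: "?J > 0" by (rule japanese_sum_pos)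
  have G: "G \<ge> 0" using g[of "\<lambda>_. 0"] japanese_ge_1[of "\<lambda>_::'n. 0"]
    by (meson mult_nonneg_nonneg norm_ge_zero order_trans zero_le_one zero_le_power)
  have g1: "weighted_sum_le (\<lambda>k. (1 + freq_size k) ^ s) g (G * ?J)"
    by (rule weighted_sum_le_decay[OF g])
  have "column_bounded (\<lambda>k. (1 + (1 / (4 * (1 / (2 * ?J) * ?J + 1))) * freq_size k) ^ 0) (\<lambda>\<zeta> \<xi>. b \<xi> (\<lambda>i. \<zeta> i - \<xi> i)) (3 / 4)"
    using J by (intro convolution_kernel_column_bounded[OF small _ _ refl]) (use small in auto)
  then have c0: "column_bounded (\<lambda>k. 1) (\<lambda>\<zeta> \<xi>. b \<xi> (\<lambda>i. \<zeta> i - \<xi> i)) (3 / 4)" by simp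
  have g0: "weighted_sum_le (\<lambda>_. 1) g (G * ?J)"
  proof (rule weighted_sum_le_mono[OF g1])
    show "1 * cmod (g k) \<le> (1 + freq_size k) ^ s * cmod (g k)" for k
      using freq_size_nonneg[of k] by (intro mult_right_mono one_le_power) auto
  qed simp
  show "v \<zeta> = g \<zeta> - (\<Sum>\<^sub>\<infinity>\<xi>. b \<xi> (\<lambda>i. \<zeta> i - \<xi> i) * v \<xi>)"
    unfolding v_def by (rule neumann_equation[OF c0 _ _ g0]) auto
  define \<delta> where "\<delta> = 1 / (4 * (C * ?J + 1))"
  have D: "4 * (C * ?J + 1) \<ge> 1" using C J by simp
  have \<delta>: "0 < \<delta>" "\<delta> \<le> 1" using D by (simp_all add: \<delta>_def)
  have pos: "(1 + \<delta> * freq_size k) ^ s > 0" for k :: "'n \<Rightarrow> int"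
    using \<delta> freq_size_nonneg[of k] by (simp add: add_pos_nonneg)
  have cb: "column_bounded (\<lambda>k. (1 + \<delta> * freq_size k) ^ s) (\<lambda>\<zeta> \<xi>. b \<xi> (\<lambda>i. \<zeta> i - \<xi> i)) (3 / 4)"
    by (rule convolution_kernel_column_bounded[OF small C \<delta>_def])
  have "weighted_sum_le (\<lambda>k. (1 + \<delta> * freq_size k) ^ s) g (G * ?J)"
  proof (rule weighted_sum_le_mono[OF g1 less_imp_le[OF pos]])
    fix k :: "'n \<Rightarrow> int"
    have "\<delta> * freq_size k \<le> freq_size k" "0 \<le> \<delta> * freq_size k"
      using \<delta> freq_size_nonneg[of k] by (auto intro: mult_left_le_one_le)
    then show "(1 + \<delta> * freq_size k) ^ s * cmod (g k) \<le> (1 + freq_size k) ^ s * cmod (g k)"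
      by (intro mult_right_mono power_mono) auto
  qed
  from neumann_bound[OF cb pos _ _ this]
  have v1: "weighted_sum_le (\<lambda>k. (1 + \<delta> * freq_size k) ^ s) v (4 * (G * ?J))"
    by (simp add: v_def mult.commute)
  have le: "(1 + freq_size k) ^ s \<le> (1 / \<delta>) ^ s * (1 + \<delta> * freq_size k) ^ s" for k :: "'n \<Rightarrow> int"
    unfolding power_mult_distrib[symmetric]
    using \<delta> freq_size_nonneg[of k] by (intro power_mono) (auto simp: field_simps)
  have s: "(\<lambda>k. (1 / \<delta>) ^ s * ((1 + \<delta> * freq_size k) ^ s * cmod (v k))) summable_on UNIV"
    using v1 by (intro summable_on_cmult_right) (simp add: weighted_sum_le_def)
  have le': "(1 + freq_size k) ^ s * cmod (v k) \<le> (1 / \<delta>) ^ s * ((1 + \<delta> * freq_size k) ^ s * cmod (v k))" for k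
    using mult_right_mono[OF le norm_ge_zero] by (simp add: mult.assoc)
  have s': "(\<lambda>k. (1 + freq_size k) ^ s * cmod (v k)) summable_on UNIV"
    by (rule summable_on_comparison_test[OF s]) (use le' freq_size_nonneg in \<open>auto intro!: mult_nonneg_nonneg zero_le_power add_nonneg_nonneg\<close>)
  have "(\<Sum>\<^sub>\<infinity>k. (1 + freq_size k) ^ s * cmod (v k)) \<le> (\<Sum>\<^sub>\<infinity>k. (1 / \<delta>) ^ s * ((1 + \<delta> * freq_size k) ^ s * cmod (v k)))"
    by (rule infsum_mono[OF s' s]) (rule le')
  also have "\<dots> \<le> (1 / \<delta>) ^ s * (4 * (G * ?J))"
    unfolding infsum_cmult_right' using v1 \<delta> by (intro mult_left_mono) (auto simp: weighted_sum_le_def)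
  finally show "weighted_sum_le (\<lambda>k. (1 + freq_size k) ^ s) v (4 * ?J * (4 * (C * ?J + 1)) ^ s * G)"
    using s' by (simp add: weighted_sum_le_def \<delta>_def mult_ac)
qed

section \<open>Trigonometric series with rapidly decreasing coefficients\<close>

definition wave_series :: "('k \<Rightarrow> real^'n::finite) \<Rightarrow> ('k \<Rightarrow> complex) \<Rightarrow> 'n cfun" where
  "wave_series \<xi> a x = (\<Sum>\<^sub>\<infinity>k. a k * wave (\<xi> k) x)"

definition rapid :: "('k \<Rightarrow> real^'n::finite) \<Rightarrow> ('k \<Rightarrow> complex) \<Rightarrow> bool" where
  "rapid \<xi> a \<longleftrightarrow> (\<forall>s::nat. (\<lambda>k. (1 + norm (\<xi> k)) ^ s * cmod (a k)) summable_on UNIV)"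

lemma rapid_summable: "rapid \<xi> a \<Longrightarrow> (\<lambda>k. cmod (a k * wave (\<xi> k) x)) summable_on UNIV"
proof -
  assume "rapid \<xi> a"
  then have "(\<lambda>k. (1 + norm (\<xi> k)) ^ 0 * cmod (a k)) summable_on UNIV" unfolding rapid_def by blast
  then show ?thesis by (simp add: norm_mult)
qed

lemma rapid_mult:
  assumes a: "rapid \<xi> a" and c: "\<And>k. cmod (c k) \<le> B * (1 + norm (\<xi> k)) ^ d"
  shows "rapid \<xi> (\<lambda>k. a k * c k)"
  unfolding rapid_def
proof
  fix s
  have "(\<lambda>k. B * ((1 + norm (\<xi> k)) ^ (s + d) * cmod (a k))) summable_on UNIV"
    using a unfolding rapid_def by (intro summable_on_cmult_right) blast
  then show "(\<lambda>k. (1 + norm (\<xi> k)) ^ s * cmod (a k * c k)) summable_on UNIV"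
  proof (rule summable_on_comparison_test)
    fix k
    have "(1 + norm (\<xi> k)) ^ s * (cmod (a k) * cmod (c k)) \<le> (1 + norm (\<xi> k)) ^ s * (cmod (a k) * (B * (1 + norm (\<xi> k)) ^ d))"
      by (intro mult_left_mono c) auto
    then show "(1 + norm (\<xi> k)) ^ s * cmod (a k * c k) \<le> B * ((1 + norm (\<xi> k)) ^ (s + d) * cmod (a k))"
      by (simp add: norm_mult power_add mult_ac)
  qed simp
qed

lemma rapid_partial:
  assumes "rapid \<xi> a"
  shows "rapid \<xi> (\<lambda>k. a k * (\<i> * complex_of_real (\<xi> k $ i)))"
proof (rule rapid_mult[OF assms, of _ 1 1])
  show "cmod (\<i> * complex_of_real (\<xi> k $ i)) \<le> 1 * (1 + norm (\<xi> k)) ^ 1" for k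
    using component_le_norm_cart[of "\<xi> k" i] by (simp add: norm_mult)
qed

lemma infsum_diff_complex:
  fixes f g :: "'a \<Rightarrow> complex"
  assumes "f summable_on A" "g summable_on A"
  shows "(\<Sum>\<^sub>\<infinity>k\<in>A. f k - g k) = infsum f A - infsum g A" "(\<lambda>k. f k - g k) summable_on A"
proof -
  have s: "(\<lambda>k. - g k) summable_on A" using assms(2) by (simp only: summable_on_uminus)
  show "(\<Sum>\<^sub>\<infinity>k\<in>A. f k - g k) = infsum f A - infsum g A"
    by (simp only: diff_conv_add_uminus infsum_add[OF assms(1) s] infsum_uminus)
  show "(\<lambda>k. f k - g k) summable_on A"
    unfolding diff_conv_add_uminus by (rule summable_on_add[OF assms(1) s])
qed

lemma infsum_finite_sum:
  fixes f :: "'b \<Rightarrow> 'a \<Rightarrow> complex"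
  assumes "\<And>\<alpha>. \<alpha> \<in> A \<Longrightarrow> f \<alpha> summable_on S" "finite A"
  shows "(\<Sum>\<^sub>\<infinity>k\<in>S. \<Sum>\<alpha>\<in>A. f \<alpha> k) = (\<Sum>\<alpha>\<in>A. infsum (f \<alpha>) S) \<and> (\<lambda>k. \<Sum>\<alpha>\<in>A. f \<alpha> k) summable_on S"
  using assms(2,1)
proof (induction A rule: finite_induct)
  case (insert b A)
  then have "(\<lambda>k. \<Sum>\<alpha>\<in>A. f \<alpha> k) summable_on S" "f b summable_on S"
    "(\<Sum>\<^sub>\<infinity>k\<in>S. \<Sum>\<alpha>\<in>A. f \<alpha> k) = (\<Sum>\<alpha>\<in>A. infsum (f \<alpha>) S)" by auto
  then show ?case
    using insert.hyps infsum_add[of "f b" S "\<lambda>k. \<Sum>\<alpha>\<in>A. f \<alpha> k"] summable_on_add[of "f b" S "\<lambda>k. \<Sum>\<alpha>\<in>A. f \<alpha> k"]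
    by simp
qed simp

lemma wave_series_has_derivative:
  assumes a: "rapid \<xi> a"
  shows "(wave_series \<xi> a has_derivative (\<lambda>h. \<Sum>\<^sub>\<infinity>k. a k * (\<i> * complex_of_real (\<xi> k \<bullet> h) * wave (\<xi> k) x))) (at x)"
proof -
  define D where "D h = (\<Sum>\<^sub>\<infinity>k. a k * (\<i> * complex_of_real (\<xi> k \<bullet> h) * wave (\<xi> k) x))" for h
  define A where "A s = (\<Sum>\<^sub>\<infinity>k. (1 + norm (\<xi> k)) ^ s * cmod (a k))" for s :: nat
  have sA: "(\<lambda>k. (1 + norm (\<xi> k)) ^ s * cmod (a k)) summable_on UNIV" for s
    using a by (simp add: rapid_def)
  have ip: "\<bar>\<xi> k \<bullet> h\<bar> \<le> (1 + norm (\<xi> k)) * norm h" for k h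
    by (rule order_trans[OF Cauchy_Schwarz_ineq2]) (simp add: mult_right_mono)
  have le1: "cmod (a k * (\<i> * complex_of_real (\<xi> k \<bullet> h) * wave (\<xi> k) x)) \<le> norm h * ((1 + norm (\<xi> k)) ^ 1 * cmod (a k))" for h k
    using mult_left_mono[OF ip[of k h], of "cmod (a k)"] by (simp add: norm_mult mult_ac)
  have sD: "(\<lambda>k. cmod (a k * (\<i> * complex_of_real (\<xi> k \<bullet> h) * wave (\<xi> k) x))) summable_on UNIV" for h
    by (rule summable_on_comparison_test[OF summable_on_cmult_right[OF sA[of 1], of "norm h"]]) (rule le1, simp)
  have sD': "(\<lambda>k. a k * (\<i> * complex_of_real (\<xi> k \<bullet> h) * wave (\<xi> k) x)) summable_on UNIV" for h
    by (rule abs_summable_summable[OF sD])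
  have sf: "(\<lambda>k. a k * wave (\<xi> k) y) summable_on UNIV" for y
    by (rule abs_summable_summable[OF rapid_summable[OF a]])
  have bl: "bounded_linear D"
  proof (rule bounded_linear_intro[where K = "A 1"])
    show "D (h + h') = D h + D h'" for h h'
      unfolding D_def by (subst infsum_add[symmetric, OF sD' sD']) (simp add: inner_add_right algebra_simps)
    show "D (r *\<^sub>R h) = r *\<^sub>R D h" for r h
      unfolding D_def scaleR_conv_of_real[where 'a = complex] infsum_cmult_right'[symmetric]
      by (intro infsum_cong) (simp add: mult_ac)
    show "norm (D h) \<le> norm h * A 1" for h
    proof -
      have "norm (D h) \<le> (\<Sum>\<^sub>\<infinity>k. cmod (a k * (\<i> * complex_of_real (\<xi> k \<bullet> h) * wave (\<xi> k) x)))"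
        unfolding D_def by (rule norm_infsum_le'[OF sD])
      also have "\<dots> \<le> (\<Sum>\<^sub>\<infinity>k. norm h * ((1 + norm (\<xi> k)) ^ 1 * cmod (a k)))"
        by (rule infsum_mono[OF sD summable_on_cmult_right[OF sA]]) (rule le1)
      finally show ?thesis unfolding A_def infsum_cmult_right' .
    qed
  qed
  have bound: "cmod (wave_series \<xi> a (x + h) - wave_series \<xi> a x - D h) \<le> A 2 * (norm h)\<^sup>2" for h
  proof -
    define r where "r k = a k * wave (\<xi> k) (x + h) - a k * wave (\<xi> k) x - a k * (\<i> * complex_of_real (\<xi> k \<bullet> h) * wave (\<xi> k) x)" for k
    have eq: "(\<Sum>\<^sub>\<infinity>k. r k) = wave_series \<xi> a (x + h) - wave_series \<xi> a x - D h"
      unfolding r_def wave_series_def D_def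
      by (simp only: infsum_diff_complex sf sD')
    have le: "cmod (r k) \<le> (norm h)\<^sup>2 * ((1 + norm (\<xi> k)) ^ 2 * cmod (a k))" for k
    proof -
      have "r k = a k * wave (\<xi> k) x * (iexp (\<xi> k \<bullet> h) - (\<Sum>j\<le>1. (\<i> * complex_of_real (\<xi> k \<bullet> h)) ^ j / fact j))"
      proof -
        have "wave (\<xi> k) (x + h) = wave (\<xi> k) x * iexp (\<xi> k \<bullet> h)"
          by (simp add: wave_def inner_add_right ring_distribs exp_add)
        moreover have "(\<Sum>j\<le>1. (\<i> * complex_of_real (\<xi> k \<bullet> h)) ^ j / fact j) = 1 + \<i> * complex_of_real (\<xi> k \<bullet> h)"
          by simp
        ultimately show ?thesis unfolding r_def by (simp add: algebra_simps)
      qed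
      then have "cmod (r k) = cmod (a k) * cmod (iexp (\<xi> k \<bullet> h) - (\<Sum>j\<le>1. (\<i> * complex_of_real (\<xi> k \<bullet> h)) ^ j / fact j))"
        by (simp only: norm_mult norm_wave mult_1_right)
      also have "\<dots> \<le> cmod (a k) * (\<bar>\<xi> k \<bullet> h\<bar> ^ Suc 1 / fact (Suc 1))"
        by (intro mult_left_mono iexp_approx1) simp
      also have "\<dots> \<le> cmod (a k) * (\<bar>\<xi> k \<bullet> h\<bar> ^ 2)" by (intro mult_left_mono) (auto simp: numeral_2_eq_2)
      also have "\<dots> \<le> cmod (a k) * (((1 + norm (\<xi> k)) * norm h) ^ 2)"
        by (intro mult_left_mono power_mono ip) auto
      finally show ?thesis by (simp add: power_mult_distrib mult_ac)
    qed
    have s: "(\<lambda>k. (norm h)\<^sup>2 * ((1 + norm (\<xi> k)) ^ 2 * cmod (a k))) summable_on UNIV"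
      by (rule summable_on_cmult_right[OF sA])
    have sr: "(\<lambda>k. cmod (r k)) summable_on UNIV"
      by (rule summable_on_comparison_test[OF s le]) simp
    have "cmod (\<Sum>\<^sub>\<infinity>k. r k) \<le> (\<Sum>\<^sub>\<infinity>k. cmod (r k))" by (rule norm_infsum_le'[OF sr])
    also have "\<dots> \<le> (\<Sum>\<^sub>\<infinity>k. (norm h)\<^sup>2 * ((1 + norm (\<xi> k)) ^ 2 * cmod (a k)))"
      by (rule infsum_mono[OF sr s]) (rule le)
    also have "\<dots> = A 2 * (norm h)\<^sup>2" unfolding A_def infsum_cmult_right' by simp
    finally show ?thesis unfolding eq .
  qed
  have "(wave_series \<xi> a has_derivative D) (at x)"
    unfolding has_derivative_at
  proof (intro conjI bl)
    have "((\<lambda>h :: real^'b. A 2 * norm h) \<longlongrightarrow> 0) (at 0)"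
      by (rule tendsto_mult_right_zero[OF tendsto_norm_zero[OF tendsto_ident_at]])
    then show "((\<lambda>h. norm (wave_series \<xi> a (x + h) - wave_series \<xi> a x - D h) / norm h) \<longlongrightarrow> 0) (at 0)"
    proof (rule Lim_null_comparison[rotated], intro always_eventually allI)
      fix h :: "real^'b"
      show "norm (norm (wave_series \<xi> a (x + h) - wave_series \<xi> a x - D h) / norm h) \<le> A 2 * norm h"
      proof (cases "h = 0")
        case False
        then show ?thesis using bound[of h] by (simp add: divide_le_eq power2_eq_square mult.assoc)
      qed simp
    qed
  qed
  then show ?thesis unfolding D_def .
qed

lemma partial_wave_series:
  assumes "rapid \<xi> a"
  shows "partial i (wave_series \<xi> a) = wave_series \<xi> (\<lambda>k. a k * (\<i> * complex_of_real (\<xi> k $ i)))"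
proof
  fix x
  show "partial i (wave_series \<xi> a) x = wave_series \<xi> (\<lambda>k. a k * (\<i> * complex_of_real (\<xi> k $ i))) x"
    using partial_eqI[OF wave_series_has_derivative[OF assms]]
    by (simp add: wave_series_def inner_axis mult.assoc)
qed

lemma smooth_on_wave_series:
  assumes "rapid \<xi> a"
  shows "wave_series \<xi> a \<in> smooth_on S"
proof -
  have "wave_series \<xi> a \<in> smooth_on UNIV"
  proof (rule smooth_on_coinduct[where X = "\<lambda>f. \<exists>a. rapid \<xi> a \<and> f = wave_series \<xi> a"])
    fix f assume "\<exists>a. rapid \<xi> a \<and> f = wave_series \<xi> a"
    then obtain a where f: "rapid \<xi> a" "f = wave_series \<xi> a" by blast
    show "f differentiable_on UNIV \<and> (\<forall>i. \<exists>g. (\<exists>a. rapid \<xi> a \<and> g = wave_series \<xi> a) \<and> (\<forall>x\<in>UNIV. partial i f x = g x))"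
      using has_derivative_differentiable_on[OF open_UNIV wave_series_has_derivative[OF f(1)]] rapid_partial[OF f(1)]
      unfolding f(2) partial_wave_series[OF f(1)] by blast
  qed (use assms in auto)
  then show ?thesis by (rule smooth_on_subset) simp
qed

lemma foldr_partial_wave_series:
  assumes "rapid \<xi> a"
  shows "rapid \<xi> (\<lambda>k. a k * (\<Prod>i\<leftarrow>is. \<i> * complex_of_real (\<xi> k $ i))) \<and>
    foldr partial is (wave_series \<xi> a) = wave_series \<xi> (\<lambda>k. a k * (\<Prod>i\<leftarrow>is. \<i> * complex_of_real (\<xi> k $ i)))"
proof (induction "is")
  case (Cons i "is")
  then have IH: "rapid \<xi> (\<lambda>k. a k * (\<Prod>i\<leftarrow>is. \<i> * complex_of_real (\<xi> k $ i)))"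
    "foldr partial is (wave_series \<xi> a) = wave_series \<xi> (\<lambda>k. a k * (\<Prod>i\<leftarrow>is. \<i> * complex_of_real (\<xi> k $ i)))" by auto
  show ?case
    using rapid_partial[OF IH(1), of i] partial_wave_series[OF IH(1), of i]
    by (simp add: IH(2) mult_ac)
qed (use assms in simp)

lemma mpartial_wave_series:
  assumes "rapid \<xi> a"
  shows "mpartial \<alpha> (wave_series \<xi> a) x = (\<Sum>\<^sub>\<infinity>k. a k * (\<i> ^ mi_order \<alpha> * monomial_at (\<xi> k) \<alpha>) * wave (\<xi> k) x)"
proof -
  obtain "is" where "is": "mpartial \<alpha> = foldr partial is" "\<And>i. count_list is i = \<alpha> i" "length is = mi_order \<alpha>"
    using mpartial_list[of \<alpha>] by metis
  have "(\<Prod>i\<leftarrow>is. \<i> * complex_of_real (\<xi> k $ i)) = \<i> ^ mi_order \<alpha> * monomial_at (\<xi> k) \<alpha>" for k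
    by (simp add: prod_list_count "is" power_mult_distrib prod.distrib monomial_at_def mi_order_def power_sum)
  then show ?thesis unfolding "is"(1) using foldr_partial_wave_series[OF assms, of "is"] by (simp add: wave_series_def)
qed

lemma norm_monomial_at: "cmod (monomial_at \<xi> \<alpha>) \<le> (1 + norm \<xi>) ^ mi_order \<alpha>"
proof -
  have "cmod (monomial_at \<xi> \<alpha>) = (\<Prod>i\<in>UNIV. \<bar>\<xi> $ i\<bar> ^ \<alpha> i)"
    by (simp add: monomial_at_def prod_norm[symmetric] norm_power)
  also have "\<dots> \<le> (\<Prod>i\<in>UNIV. (1 + norm \<xi>) ^ \<alpha> i)"
  proof (intro prod_mono conjI power_mono)
    show "\<bar>\<xi> $ i\<bar> \<le> 1 + norm \<xi>" for i using component_le_norm_cart[of \<xi> i] by simp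
  qed auto
  finally show ?thesis by (simp add: mi_order_def power_sum)
qed

lemma mpartial_wave_series_bound:
  assumes "rapid \<xi> a"
  shows "cmod (mpartial \<alpha> (wave_series \<xi> a) x) \<le> (\<Sum>\<^sub>\<infinity>k. (1 + norm (\<xi> k)) ^ mi_order \<alpha> * cmod (a k))"
proof -
  have le: "cmod (a k * (\<i> ^ mi_order \<alpha> * monomial_at (\<xi> k) \<alpha>) * wave (\<xi> k) x) \<le> (1 + norm (\<xi> k)) ^ mi_order \<alpha> * cmod (a k)" for k
    using mult_right_mono[OF norm_monomial_at norm_ge_zero[of "a k"]] by (simp add: norm_mult norm_power mult_ac)
  have s: "(\<lambda>k. (1 + norm (\<xi> k)) ^ mi_order \<alpha> * cmod (a k)) summable_on UNIV"
    using assms by (simp add: rapid_def)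
  have s': "(\<lambda>k. cmod (a k * (\<i> ^ mi_order \<alpha> * monomial_at (\<xi> k) \<alpha>) * wave (\<xi> k) x)) summable_on UNIV"
    by (rule summable_on_comparison_test[OF s le]) simp
  show ?thesis unfolding mpartial_wave_series[OF assms]
    by (rule order_trans[OF norm_infsum_le'[OF s'] infsum_mono[OF s' s le]])
qed

lemma finite_mi_order: "finite {\<alpha> :: 'n::finite multiindex. mi_order \<alpha> \<le> m}"
proof (rule finite_subset)
  have "\<alpha> i \<le> mi_order \<alpha>" for \<alpha> :: "'n multiindex" and i
    unfolding mi_order_def by (rule member_le_sum) auto
  then show "{\<alpha> :: 'n multiindex. mi_order \<alpha> \<le> m} \<subseteq> PiE UNIV (\<lambda>_. {..m})"
    by (auto simp: PiE_def extensional_def intro: order_trans)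
  show "finite (PiE (UNIV :: 'n set) (\<lambda>_. {..m}))" by (rule finite_PiE) auto
qed

lemma apply_op_rep_wave_series:
  assumes a: "rapid \<xi> a" and u: "u \<epsilon> = wave_series \<xi> a"
  shows "apply_op_rep m C u \<epsilon> x = (\<Sum>\<^sub>\<infinity>k. a k * op_symbol m C \<epsilon> x (\<xi> k) * wave (\<xi> k) x)"
proof -
  have s: "(\<lambda>k. C \<alpha> \<epsilon> x * (a k * monomial_at (\<xi> k) \<alpha> * wave (\<xi> k) x)) summable_on UNIV" for \<alpha>
  proof -
    have "rapid \<xi> (\<lambda>k. a k * monomial_at (\<xi> k) \<alpha>)"
      by (rule rapid_mult[OF a, of _ 1 "mi_order \<alpha>"]) (simp add: norm_monomial_at)
    from rapid_summable[OF this] show ?thesis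
      by (rule summable_on_cmult_right[OF abs_summable_summable])
  qed
  have "C \<alpha> \<epsilon> x * Dpartial \<alpha> (u \<epsilon>) x = (\<Sum>\<^sub>\<infinity>k. C \<alpha> \<epsilon> x * (a k * monomial_at (\<xi> k) \<alpha> * wave (\<xi> k) x))" for \<alpha>
  proof -
    have i: "(- \<i>) ^ d * \<i> ^ d = 1" for d :: nat
      unfolding power_mult_distrib[symmetric] by simp
    have "(- \<i>) ^ mi_order \<alpha> * (a k * (\<i> ^ mi_order \<alpha> * monomial_at (\<xi> k) \<alpha>) * wave (\<xi> k) x)
       = ((- \<i>) ^ mi_order \<alpha> * \<i> ^ mi_order \<alpha>) * (a k * monomial_at (\<xi> k) \<alpha> * wave (\<xi> k) x)" for k
      by (simp only: mult_ac)
    then have "(- \<i>) ^ mi_order \<alpha> * (a k * (\<i> ^ mi_order \<alpha> * monomial_at (\<xi> k) \<alpha>) * wave (\<xi> k) x)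
       = a k * monomial_at (\<xi> k) \<alpha> * wave (\<xi> k) x" for k
      unfolding i by simp
    then have "(- \<i>) ^ mi_order \<alpha> * mpartial \<alpha> (wave_series \<xi> a) x = (\<Sum>\<^sub>\<infinity>k. a k * monomial_at (\<xi> k) \<alpha> * wave (\<xi> k) x)"
      by (simp only: mpartial_wave_series[OF a] flip: infsum_cmult_right')
    then show ?thesis unfolding Dpartial_def u by (simp only: infsum_cmult_right')
  qed
  then have "apply_op_rep m C u \<epsilon> x = (\<Sum>\<alpha> | mi_order \<alpha> \<le> m. \<Sum>\<^sub>\<infinity>k. C \<alpha> \<epsilon> x * (a k * monomial_at (\<xi> k) \<alpha> * wave (\<xi> k) x))"
    by (simp add: apply_op_rep_def)
  also have "\<dots> = (\<Sum>\<^sub>\<infinity>k. \<Sum>\<alpha> | mi_order \<alpha> \<le> m. C \<alpha> \<epsilon> x * (a k * monomial_at (\<xi> k) \<alpha> * wave (\<xi> k) x))"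
    by (rule infsum_finite_sum[THEN conjunct1, OF s finite_mi_order, symmetric])
  also have "\<dots> = (\<Sum>\<^sub>\<infinity>k. a k * op_symbol m C \<epsilon> x (\<xi> k) * wave (\<xi> k) x)"
    unfolding op_symbol_def sum_distrib_left sum_distrib_right
    by (intro infsum_cong sum.cong refl) (simp only: mult_ac)
  finally show ?thesis .
qed

section \<open>Solution for one value of the parameter\<close>

definition half_shift :: "real^'n::finite" where
  "half_shift = (\<chi> i. 1 / 2)"

text \<open>The half-integer shift keeps all frequencies away from the origin, where the symbol may vanish.\<close>

definition lattice_freq :: "real \<Rightarrow> ('n::finite \<Rightarrow> int) \<Rightarrow> real^'n" where
  "lattice_freq M k = M *\<^sub>R (freq k + half_shift)"

lemma norm_lattice_freq_ge:
  fixes k :: "'n::finite \<Rightarrow> int"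
  assumes "M \<ge> 0"
  shows "norm (lattice_freq M k) \<ge> M / 2"
proof -
  fix i :: 'n
  have "\<bar>real_of_int (k i) + 1 / 2\<bar> \<ge> 1 / 2"
  proof (cases "k i \<ge> 0")
    case False
    then have "k i \<le> -1" by simp
    then have "real_of_int (k i) \<le> -1" by linarith
    then show ?thesis by linarith
  qed simp
  then have "M * (1 / 2) \<le> M * \<bar>real_of_int (k i) + 1 / 2\<bar>" using assms by (rule mult_left_mono)
  also have "\<dots> = \<bar>lattice_freq M k $ i\<bar>" using assms by (simp add: lattice_freq_def half_shift_def abs_mult)
  also have "\<dots> \<le> norm (lattice_freq M k)" by (rule component_le_norm_cart)
  finally show ?thesis by simp
qed

lemma norm_lattice_freq_le:
  fixes k :: "'n::finite \<Rightarrow> int"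
  assumes "M \<ge> 1"
  shows "1 + norm (lattice_freq M k) \<le> (M * (real CARD('n) + 1)) * (1 + freq_size k)"
proof -
  have "norm (lattice_freq M k) \<le> (\<Sum>i\<in>UNIV. \<bar>lattice_freq M k $ i\<bar>)" by (rule norm_le_l1_cart)
  also have "\<dots> \<le> (\<Sum>i\<in>UNIV. M * (\<bar>of_int (k i)\<bar> + 1))"
    using assms by (intro sum_mono) (auto simp: lattice_freq_def half_shift_def abs_mult intro!: mult_left_mono)
  also have "\<dots> = M * (freq_size k + real CARD('n))"
    by (simp add: freq_size_def sum.distrib flip: sum_distrib_left)
  finally have 1: "1 + norm (lattice_freq M k) \<le> M + M * (freq_size k + real CARD('n))" using assms by simp
  have "0 \<le> M * (real CARD('n) * freq_size k)" using assms freq_size_nonneg[of k] by simp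
  with 1 show ?thesis by (simp add: algebra_simps)
qed

definition rel_symbol :: "(real^'n::finite \<Rightarrow> real^'n \<Rightarrow> complex) \<Rightarrow> real^'n \<Rightarrow> real \<Rightarrow> ('n \<Rightarrow> int) \<Rightarrow> 'n cfun" where
  "rel_symbol p x0 M k y = bump y * (p (x0 + (1 / M) *\<^sub>R y) (lattice_freq M k) / p x0 (lattice_freq M k) - 1)"

definition source :: "real^'n::finite \<Rightarrow> real \<Rightarrow> 'n cfun \<Rightarrow> 'n cfun" where
  "source x0 M f y = wave (- half_shift) y * (bump (2 *\<^sub>R y) * f (x0 + (1 / M) *\<^sub>R y))"

definition neumann_coeff :: "(real^'n::finite \<Rightarrow> real^'n \<Rightarrow> complex) \<Rightarrow> real^'n \<Rightarrow> real \<Rightarrow> 'n cfun \<Rightarrow> ('n \<Rightarrow> int) \<Rightarrow> complex" where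
  "neumann_coeff p x0 M f = neumann (\<lambda>\<zeta> \<xi>. fourier_coeff (rel_symbol p x0 M \<xi>) (\<lambda>i. \<zeta> i - \<xi> i)) (fourier_coeff (source x0 M f))"

definition sol_coeff :: "(real^'n::finite \<Rightarrow> real^'n \<Rightarrow> complex) \<Rightarrow> real^'n \<Rightarrow> real \<Rightarrow> 'n cfun \<Rightarrow> ('n \<Rightarrow> int) \<Rightarrow> complex" where
  "sol_coeff p x0 M f k = neumann_coeff p x0 M f k / p x0 (lattice_freq M k) * wave (lattice_freq M k) (- x0)"

definition bump_bound :: "'n::finite itself \<Rightarrow> nat \<Rightarrow> real" where
  "bump_bound _ J = (SOME B. B \<ge> 0 \<and> derivs_bounded (cball 0 2) J B (bump :: 'n cfun))"

lemma bump_bound: "bump_bound TYPE('n::finite) J \<ge> 0"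
    "derivs_bounded (cball 0 2) J (bump_bound TYPE('n) J) (bump :: 'n cfun)"
proof -
  have "\<exists>B. B \<ge> 0 \<and> derivs_bounded (cball 0 2) J B (bump :: 'n cfun)"
    using derivs_bounded_compact[OF bump_smooth compact_cball subset_UNIV] by metis
  from someI_ex[OF this]
  show "bump_bound TYPE('n::finite) J \<ge> 0" "derivs_bounded (cball 0 2) J (bump_bound TYPE('n) J) (bump :: 'n cfun)"
    by (simp_all add: bump_bound_def)
qed

definition decay_const :: "'n::finite itself \<Rightarrow> nat \<Rightarrow> real" where
  "decay_const T N = 2 ^ (N * CARD('n)) * measure lborel (cball (0::real^'n) (3 / 2)) * (2 ^ (2 * N * CARD('n)) * bump_bound T (2 * N * CARD('n)))"

lemma decay_const_nonneg: "decay_const TYPE('n::finite) N \<ge> 0"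
  using bump_bound(1)[where 'n = 'n] by (simp add: decay_const_def)

lemma bump_cutoff_decay:
  fixes g :: "'n::finite cfun"
  assumes g: "g \<in> smooth_on (ball 0 2)" and J: "derivs_bounded (ball 0 2) (2 * N * CARD('n)) B g" and B: "B \<ge> 0"
  shows "(\<lambda>y. bump y * g y) \<in> smooth_on UNIV"
    and "cmod (fourier_coeff (\<lambda>y. bump y * g y) k) * japanese k ^ N \<le> decay_const TYPE('n) N * B"
proof -
  let ?f = "\<lambda>y. bump y * g y" and ?T = "cball (0 :: real^'n) (3 / 2)" and ?J = "2 * N * CARD('n)"
  have 0: "?f y = 0" if "y \<notin> ?T" for y using that bump_eq_0[of y] by simp
  have s1: "?f \<in> smooth_on (ball 0 2)" by (intro smooth_on_mult bump_smooth g open_ball)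
  have "foldr partial is ?f differentiable at y" for "is" y
  proof (cases "y \<in> ball 0 2")
    case True
    then show ?thesis by (intro smooth_on_differentiable_at[OF smooth_on_foldr_partial[OF s1]]) auto
  next
    case False
    then have y: "y \<in> - ?T" by auto
    have "foldr partial is ?f z = 0" if "z \<in> - ?T" for z
      by (rule foldr_partial_outside[of ?T]) (use 0 that in auto)
    then have "(foldr partial is ?f has_derivative (\<lambda>_. 0)) (at y)"
      by (intro has_derivative_transform_within_open[OF has_derivative_const, of "- ?T" y 0]) (use y in auto)
    then show ?thesis by (auto simp: differentiable_def)
  qed
  then show s: "?f \<in> smooth_on UNIV" by (simp add: smooth_on_def differentiable_on_eq_differentiable_at)
  have "derivs_bounded (ball 0 2) ?J (2 ^ ?J * (bump_bound TYPE('n) ?J * B)) ?f"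
    by (intro derivs_bounded_mult bump_smooth g J open_ball derivs_bounded_mono[OF bump_bound(2)]) auto
  then have d: "derivs_bounded ?T ?J (2 ^ ?J * (bump_bound TYPE('n) ?J * B)) ?f"
    by (rule derivs_bounded_mono) auto
  have "cmod (fourier_coeff ?f k) * japanese k ^ N \<le> 2 ^ (N * CARD('n)) * measure lborel ?T * (2 ^ ?J * (bump_bound TYPE('n) ?J * B))"
    by (rule fourier_coeff_decay[OF s compact_cball 0 d]) (use B bump_bound(1)[where 'n = 'n] in auto)
  then show "cmod (fourier_coeff ?f k) * japanese k ^ N \<le> decay_const TYPE('n) N * B"
    by (simp add: decay_const_def mult.assoc)
qed

lemma cball_subset_torus: "cball (0 :: real^'n::finite) (3 / 2) \<subseteq> torus"
proof
  fix x :: "real^'n" assume "x \<in> cball 0 (3 / 2)"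
  then have "\<bar>x $ i\<bar> \<le> 3 / 2" for i using component_le_norm_cart[of x i] by simp
  moreover have "3 / 2 \<le> pi" using pi_gt3 by simp
  ultimately show "x \<in> torus" unfolding in_torus by (meson order_trans)
qed

lemma derivs_bounded_rescale:
  assumes f: "f \<in> smooth_on UNIV" and M: "M \<ge> 1"
    and B: "derivs_bounded (ball x0 (2 / M)) J B f"
  shows "derivs_bounded (ball 0 2) J B (\<lambda>y. f (x0 + (1 / M) *\<^sub>R y))"
    and "0 < length is \<Longrightarrow> length is \<le> J \<Longrightarrow> y \<in> ball 0 2 \<Longrightarrow> cmod (foldr partial is (\<lambda>y. f (x0 + (1 / M) *\<^sub>R y)) y) \<le> 1 / M * B"
    and "(\<lambda>y. f (x0 + (1 / M) *\<^sub>R y)) \<in> smooth_on S"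
proof -
  have in_ball: "x0 + (1 / M) *\<^sub>R y \<in> ball x0 (2 / M)" if "y \<in> ball 0 2" for y
    using that M by (simp add: dist_norm divide_strict_right_mono)
  have eq: "cmod (foldr partial is (\<lambda>y. f (x0 + (1 / M) *\<^sub>R y)) y) = (1 / M) ^ length is * cmod (foldr partial is f (x0 + (1 / M) *\<^sub>R y))" for "is" y
    using foldr_partial_affine[OF f open_UNIV, of x0 "1 / M" y "is"] M by (simp add: norm_mult norm_power norm_divide)
  have le: "(1 / M) ^ l \<le> 1" for l using M by (intro power_le_one) auto
  show "derivs_bounded (ball 0 2) J B (\<lambda>y. f (x0 + (1 / M) *\<^sub>R y))"
    unfolding derivs_bounded_def eq
  proof (intro allI impI ballI)
    fix "is" :: "'a list" and y :: "real^'a" assume *: "length is \<le> J" "y \<in> ball 0 2"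
    have "cmod (foldr partial is f (x0 + (1 / M) *\<^sub>R y)) \<le> B" using B * in_ball unfolding derivs_bounded_def by blast
    moreover have "(1 / M) ^ length is * cmod (foldr partial is f (x0 + (1 / M) *\<^sub>R y)) \<le> cmod (foldr partial is f (x0 + (1 / M) *\<^sub>R y))"
      using le M by (intro mult_left_le_one_le) auto
    ultimately show "(1 / M) ^ length is * cmod (foldr partial is f (x0 + (1 / M) *\<^sub>R y)) \<le> B" by simp
  qed
  show "cmod (foldr partial is (\<lambda>y. f (x0 + (1 / M) *\<^sub>R y)) y) \<le> 1 / M * B"
    if *: "0 < length is" "length is \<le> J" "y \<in> ball 0 2" for "is" y
  proof -
    have "(1 / M) ^ length is \<le> (1 / M) ^ 1" using * M by (intro power_decreasing) (auto simp: Suc_le_eq)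
    moreover have "cmod (foldr partial is f (x0 + (1 / M) *\<^sub>R y)) \<le> B" using B * in_ball unfolding derivs_bounded_def by blast
    ultimately show ?thesis unfolding eq using M by (intro mult_mono) auto
  qed
  show "(\<lambda>y. f (x0 + (1 / M) *\<^sub>R y)) \<in> smooth_on S"
    using smooth_on_affine[OF f open_UNIV, of x0 "1 / M"] by (auto intro: smooth_on_subset)
qed

lemma half_shift_component_le: "cmod (\<Prod>i\<leftarrow>is. \<i> * complex_of_real ((- half_shift) $ i)) \<le> 1"
  by (induction "is") (auto simp: norm_mult half_shift_def intro!: mult_le_one)

lemma source_decay:
  fixes f :: "'n::finite cfun"
  assumes f: "f \<in> smooth_on UNIV" and M: "M \<ge> 1"
    and B: "derivs_bounded (ball x0 (2 / M)) (2 * N * CARD('n)) B f" "B \<ge> 0"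
  shows "source x0 M f \<in> smooth_on UNIV"
    and "cmod (fourier_coeff (source x0 M f) k) * japanese k ^ N \<le>
      decay_const TYPE('n) N * (8 ^ (2 * N * CARD('n)) * bump_bound TYPE('n) (2 * N * CARD('n)) * B)"
proof -
  let ?J = "2 * N * CARD('n)"
  define g where "g y = wave (- half_shift) y * (bump (0 + 2 *\<^sub>R y) * f (x0 + (1 / M) *\<^sub>R y))" for y
  have bs: "(\<lambda>y. bump (0 + 2 *\<^sub>R y) :: complex) \<in> smooth_on S" for S :: "(real^'n) set"
    using smooth_on_affine[OF bump_smooth open_UNIV, of 0 2] by (auto intro: smooth_on_subset)
  note fs = derivs_bounded_rescale[OF f M B(1)]
  have g: "g \<in> smooth_on (ball 0 2)"
    unfolding g_def by (intro smooth_on_mult smooth_on_wave bs fs open_ball)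
  have bb: "derivs_bounded (ball 0 2) ?J (2 ^ ?J * bump_bound TYPE('n) ?J) (\<lambda>y :: real^'n. bump (0 + 2 *\<^sub>R y))"
    unfolding derivs_bounded_def
  proof (intro allI impI ballI)
    fix "is" :: "'n list" and y :: "real^'n" assume l: "length is \<le> ?J"
    have "cmod (foldr partial is bump (0 + 2 *\<^sub>R y)) \<le> bump_bound TYPE('n) ?J"
    proof (cases "norm (2 *\<^sub>R y) \<le> 2")
      case True
      then show ?thesis using bump_bound(2)[where 'n = 'n, of ?J] l by (auto simp: derivs_bounded_def)
    next
      case False
      have "foldr partial is bump (0 + 2 *\<^sub>R y) = 0"
        by (rule foldr_partial_outside[of "cball 0 (3 / 2)"]) (use False in \<open>auto intro: bump_eq_0\<close>)
      then show ?thesis using bump_bound(1)[where 'n = 'n] by simp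
    qed
    moreover have "(2::real) ^ length is \<le> 2 ^ ?J" using l by (intro power_increasing) auto
    ultimately show "cmod (foldr partial is (\<lambda>y :: real^'n. bump (0 + 2 *\<^sub>R y)) y) \<le> 2 ^ ?J * bump_bound TYPE('n) ?J"
      using foldr_partial_affine[OF bump_smooth open_UNIV, of 0 2 y "is"]
      by (simp add: norm_mult norm_power mult_mono)
  qed
  have wb: "derivs_bounded (ball 0 2) ?J 1 (wave (- half_shift :: real^'n))"
    unfolding derivs_bounded_def foldr_partial_wave norm_mult norm_wave mult_1_right
    using half_shift_component_le by blast
  have gb: "derivs_bounded (ball 0 2) ?J (2 ^ ?J * (1 * (2 ^ ?J * ((2 ^ ?J * bump_bound TYPE('n) ?J) * B)))) g"
    unfolding g_def by (intro derivs_bounded_mult smooth_on_mult smooth_on_wave bs fs wb bb open_ball)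
  have eq: "source x0 M f = (\<lambda>y. bump y * g y)"
  proof
    fix y :: "real^'n"
    show "source x0 M f y = bump y * g y"
    proof (cases "norm y \<le> 1")
      case True then show ?thesis by (simp add: source_def g_def bump_eq_1)
    next
      case False
      then have "bump (2 *\<^sub>R y) = 0" by (intro bump_eq_0) simp
      then show ?thesis by (simp add: source_def g_def)
    qed
  qed
  have nn: "0 \<le> 2 ^ ?J * (1 * (2 ^ ?J * ((2 ^ ?J * bump_bound TYPE('n) ?J) * B)))"
    using B bump_bound(1)[where 'n = 'n] by simp
  have "(8::real) ^ l = 2 ^ l * 2 ^ l * 2 ^ l" for l by (simp flip: power_mult_distrib)
  then show "source x0 M f \<in> smooth_on UNIV"
    and "cmod (fourier_coeff (source x0 M f) k) * japanese k ^ N \<le>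
      decay_const TYPE('n) N * (8 ^ (2 * N * CARD('n)) * bump_bound TYPE('n) (2 * N * CARD('n)) * B)"
    unfolding eq using bump_cutoff_decay[OF g gb nn] by (simp_all add: mult_ac)
qed

definition log_deriv_bounded :: "(real^'n::finite \<Rightarrow> real^'n \<Rightarrow> complex) \<Rightarrow> real \<Rightarrow> nat \<Rightarrow> real \<Rightarrow> bool" where
  "log_deriv_bounded p R J D \<longleftrightarrow> (\<forall>\<xi> is x. norm \<xi> \<ge> R \<longrightarrow> length is \<le> J \<longrightarrow>
     cmod (foldr partial is (\<lambda>y. p y \<xi>) x) \<le> D * cmod (p x \<xi>))"

lemma symbol_comparable:
  fixes p :: "real^'n::finite \<Rightarrow> real^'n \<Rightarrow> complex"
  assumes s: "(\<lambda>y. p y \<xi>) \<in> smooth_on UNIV" and D: "log_deriv_bounded p R (Suc J) D" "D \<ge> 0"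
    and \<xi>: "norm \<xi> \<ge> R" and r: "r \<ge> 0" "real CARD('n) * D * r \<le> 1 / 4" and x: "norm (x - x0) \<le> r"
  shows "cmod (p x \<xi>) \<le> 2 * cmod (p x0 \<xi>)"
    and "cmod (p x \<xi> - p x0 \<xi>) \<le> real CARD('n) * D * (4 * cmod (p x0 \<xi>)) * norm (x - x0)"
proof -
  let ?n = "real CARD('n)"
  have "continuous_on (cball x0 (2 * r)) (\<lambda>y. cmod (p y \<xi>))"
    using smooth_on_continuous[OF s, of "[]"] by (intro continuous_on_norm) (auto intro: continuous_on_subset)
  then obtain z where z: "z \<in> cball x0 (2 * r)" "\<And>y. y \<in> cball x0 (2 * r) \<Longrightarrow> cmod (p y \<xi>) \<le> cmod (p z \<xi>)"
    using continuous_attains_sup[of "cball x0 (2 * r)" "\<lambda>y. cmod (p y \<xi>)"] r by auto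
  have lip: "cmod (p y \<xi> - p y' \<xi>) \<le> ?n * (D * cmod (p z \<xi>)) * norm (y - y')"
    if "y \<in> cball x0 (2 * r)" "y' \<in> cball x0 (2 * r)" for y y'
  proof (cases "r = 0")
    case True
    then show ?thesis using that by simp
  next
    case False
    define P where "P t = p (y' + t *\<^sub>R (y - y')) \<xi>" for t :: real
    have seg: "y' + t *\<^sub>R (y - y') \<in> cball x0 (2 * r)" if "t \<in> {0..1}" for t
      using convexD_alt[OF convex_cball \<open>y' \<in> cball x0 (2 * r)\<close> \<open>y \<in> cball x0 (2 * r)\<close>, of t] that
      by (simp add: algebra_simps)
    have "norm (P 1 - P 0) \<le> (?n * (D * cmod (p z \<xi>)) * norm (y - y')) * norm (1 - 0 :: real)"
    proof (rule differentiable_bound[of "{0..1}"])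
      fix t :: real assume t: "t \<in> {0..1}"
      have d1: "((\<lambda>t. y' + t *\<^sub>R (y - y')) has_derivative (\<lambda>h. h *\<^sub>R (y - y'))) (at t)"
        by (auto intro!: derivative_eq_intros)
      show "(P has_derivative (\<lambda>h. \<Sum>i\<in>UNIV. (h *\<^sub>R (y - y')) $ i *\<^sub>R partial i (\<lambda>y. p y \<xi>) (y' + t *\<^sub>R (y - y')))) (at t within {0..1})"
        unfolding P_def
        using has_derivative_compose[OF d1 smooth_on_frechet[OF s open_UNIV UNIV_I]] by (rule has_derivative_at_withinI)
      show "onorm (\<lambda>h. \<Sum>i\<in>UNIV. (h *\<^sub>R (y - y')) $ i *\<^sub>R partial i (\<lambda>y. p y \<xi>) (y' + t *\<^sub>R (y - y'))) \<le> ?n * (D * cmod (p z \<xi>)) * norm (y - y')"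
      proof (rule onorm_le)
        fix h :: real
        have b: "cmod (partial i (\<lambda>y. p y \<xi>) (y' + t *\<^sub>R (y - y'))) \<le> D * cmod (p z \<xi>)" for i
        proof -
          have "cmod (foldr partial [i] (\<lambda>y. p y \<xi>) (y' + t *\<^sub>R (y - y'))) \<le> D * cmod (p (y' + t *\<^sub>R (y - y')) \<xi>)"
            using D(1) \<xi> unfolding log_deriv_bounded_def by (auto simp del: foldr.simps)
          also have "\<dots> \<le> D * cmod (p z \<xi>)" using D(2) z(2)[OF seg[OF t]] by (rule mult_left_mono[rotated])
          finally show ?thesis by simp
        qed
        have "norm (\<Sum>i\<in>UNIV. (h *\<^sub>R (y - y')) $ i *\<^sub>R partial i (\<lambda>y. p y \<xi>) (y' + t *\<^sub>R (y - y')))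
          \<le> (\<Sum>i\<in>(UNIV :: 'n set). (\<bar>h\<bar> * norm (y - y')) * (D * cmod (p z \<xi>)))"
        proof (rule sum_norm_le)
          fix i
          have "\<bar>(h *\<^sub>R (y - y')) $ i\<bar> \<le> \<bar>h\<bar> * norm (y - y')"
            using component_le_norm_cart[of "h *\<^sub>R (y - y')" i] by simp
          then show "norm ((h *\<^sub>R (y - y')) $ i *\<^sub>R partial i (\<lambda>y. p y \<xi>) (y' + t *\<^sub>R (y - y'))) \<le> (\<bar>h\<bar> * norm (y - y')) * (D * cmod (p z \<xi>))"
            unfolding norm_scaleR by (intro mult_mono b) auto
        qed
        then show "norm (\<Sum>i\<in>UNIV. (h *\<^sub>R (y - y')) $ i *\<^sub>R partial i (\<lambda>y. p y \<xi>) (y' + t *\<^sub>R (y - y'))) \<le> ?n * (D * cmod (p z \<xi>)) * norm (y - y') * norm h"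
          by (simp add: mult_ac)
      qed
    qed (auto simp: convex_real_interval)
    then show ?thesis by (simp add: P_def)
  qed
  have x0: "x0 \<in> cball x0 (2 * r)" and x': "x \<in> cball x0 (2 * r)"
    using r x by (auto simp: dist_norm norm_minus_commute)
  have "cmod (p z \<xi> - p x0 \<xi>) \<le> ?n * (D * cmod (p z \<xi>)) * (2 * r)"
    using lip[OF z(1) x0] z(1) D(2) by (elim order_trans) (auto intro!: mult_left_mono simp: dist_norm norm_minus_commute)
  also have "\<dots> = (?n * D * r) * (2 * cmod (p z \<xi>))" by simp
  also have "\<dots> \<le> (1 / 4) * (2 * cmod (p z \<xi>))" by (intro mult_right_mono r) auto
  finally have "cmod (p z \<xi>) \<le> 2 * cmod (p x0 \<xi>)"
    using norm_triangle_ineq2[of "p z \<xi>" "p x0 \<xi>"] by linarith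
  then show "cmod (p x \<xi>) \<le> 2 * cmod (p x0 \<xi>)" using z(2)[OF x'] by simp
  have "cmod (p x \<xi> - p x0 \<xi>) \<le> ?n * (D * cmod (p z \<xi>)) * norm (x - x0)" by (rule lip[OF x' x0])
  also have "\<dots> \<le> ?n * (D * (4 * cmod (p x0 \<xi>))) * norm (x - x0)"
    using D(2) \<open>cmod (p z \<xi>) \<le> 2 * cmod (p x0 \<xi>)\<close>
    by (intro mult_right_mono mult_left_mono order_trans[OF \<open>cmod (p z \<xi>) \<le> 2 * cmod (p x0 \<xi>)\<close>]) auto
  finally show "cmod (p x \<xi> - p x0 \<xi>) \<le> ?n * D * (4 * cmod (p x0 \<xi>)) * norm (x - x0)" by (simp add: mult_ac)
qed

lemma foldr_partial_const_Cons: "foldr partial (i # is) (\<lambda>x. c) = (\<lambda>x. 0)"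
proof (induction "is" arbitrary: i)
  case (Cons j "is")
  show ?case using Cons[of j] by simp
qed simp

lemma rel_symbol_decay:
  fixes p :: "real^'n::finite \<Rightarrow> real^'n \<Rightarrow> complex"
  assumes s: "\<And>\<xi>. (\<lambda>y. p y \<xi>) \<in> smooth_on UNIV"
    and D0: "log_deriv_bounded p R 1 D0" "D0 \<ge> 0" and D: "log_deriv_bounded p R (2 * N * CARD('n)) D" "D \<ge> D0"
    and M: "M \<ge> 1" "M \<ge> 2 * R" "M \<ge> 8 * real CARD('n) * D0"
    and nz: "p x0 (lattice_freq M k) \<noteq> 0"
  shows "rel_symbol p x0 M k \<in> smooth_on UNIV"
    and "cmod (fourier_coeff (rel_symbol p x0 M k) l) * japanese l ^ N \<le> decay_const TYPE('n) N * (1 / M * (10 * real CARD('n) * D))"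
proof -
  let ?n = "real CARD('n)" and ?\<xi> = "lattice_freq M k" and ?J = "2 * N * CARD('n)"
  define c where "c = p x0 ?\<xi>"
  have n1: "?n \<ge> 1" by (simp add: Suc_leI)
  have c: "cmod c > 0" using nz by (simp add: c_def)
  have \<xi>: "norm ?\<xi> \<ge> R" using norm_lattice_freq_ge[of M k] M by simp
  have r: "2 / M \<ge> 0" "?n * D0 * (2 / M) \<le> 1 / 4" using M by (simp_all add: field_simps)
  have D0': "log_deriv_bounded p R (Suc 0) D0" using D0(1) by simp
  note comp = symbol_comparable[OF s D0' D0(2) \<xi> r]
  have q: "derivs_bounded (ball x0 (2 / M)) ?J (2 * D * cmod c) (\<lambda>y. p y ?\<xi>)"
    unfolding derivs_bounded_def
  proof (intro allI impI ballI)
    fix "is" :: "'n list" and x assume *: "length is \<le> ?J" "x \<in> ball x0 (2 / M)"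
    have "cmod (foldr partial is (\<lambda>y. p y ?\<xi>) x) \<le> D * cmod (p x ?\<xi>)"
      using D(1) \<xi> *(1) unfolding log_deriv_bounded_def by blast
    also have "\<dots> \<le> D * (2 * cmod c)"
      using comp(1)[of x x0] *(2) D(2) D0(2) by (intro mult_left_mono) (auto simp: c_def dist_norm norm_minus_commute)
    finally show "cmod (foldr partial is (\<lambda>y. p y ?\<xi>) x) \<le> 2 * D * cmod c" by (simp add: mult_ac)
  qed
  define h where "h y = p (x0 + (1 / M) *\<^sub>R y) ?\<xi>" for y
  note hr = derivs_bounded_rescale[OF s M(1) q, folded h_def]
  define g where "g y = (1 / c) * (h y - c)" for y
  have g: "g \<in> smooth_on (ball 0 2)"
    unfolding g_def by (intro smooth_on_mult smooth_on_diff smooth_on_const hr(3) open_ball)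
  have gb: "derivs_bounded (ball 0 2) ?J (1 / M * (10 * ?n * D)) g"
    unfolding derivs_bounded_def
  proof (intro allI impI ballI)
    fix "is" :: "'n list" and y :: "real^'n" assume *: "length is \<le> ?J" "y \<in> ball 0 2"
    have y: "norm y \<le> 2" using * by simp
    have e1: "foldr partial is g y = 1 / c * foldr partial is (\<lambda>y. h y - c) y"
      unfolding g_def by (rule foldr_partial_cmult[OF smooth_on_diff[OF open_ball hr(3) smooth_on_const] open_ball *(2)])
    have "cmod (foldr partial is (\<lambda>y. h y - c) y) \<le> 1 / M * (10 * ?n * D) * cmod c"
    proof (cases "is")
      case Nil
      have "norm ((x0 + (1 / M) *\<^sub>R y) - x0) \<le> 2 / M" using y M by (simp add: divide_right_mono)
      from comp(2)[OF this] have "cmod (h y - c) \<le> ?n * D0 * (4 * cmod c) * norm ((x0 + (1 / M) *\<^sub>R y) - x0)"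
        by (simp add: h_def c_def)
      also have "\<dots> \<le> ?n * D0 * (4 * cmod c) * (2 / M)"
        using y M D0(2) by (intro mult_left_mono) (auto simp: divide_right_mono)
      also have "\<dots> = 1 / M * (8 * ?n * D0) * cmod c" by simp
      also have "\<dots> \<le> 1 / M * (10 * ?n * D) * cmod c"
        using D(2) D0(2) M by (intro mult_right_mono mult_left_mono mult_mono) auto
      finally show ?thesis using Nil by simp
    next
      case (Cons i js)
      have z: "foldr partial is (\<lambda>x. c) y = 0" unfolding Cons foldr_partial_const_Cons ..
      have "foldr partial is (\<lambda>y. h y - c) y = foldr partial is h y"
        using foldr_partial_diff[OF hr(3) smooth_on_const open_ball *(2), of "is" c] unfolding z by simp
      then have "cmod (foldr partial is (\<lambda>y. h y - c) y) \<le> 1 / M * (2 * D * cmod c)"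
        using hr(2)[of "is" y] * Cons by simp
      also have "\<dots> = 1 / M * (2 * 1 * D) * cmod c" by simp
      also have "\<dots> \<le> 1 / M * (10 * ?n * D) * cmod c"
        using D(2) D0(2) M n1 by (intro mult_right_mono mult_left_mono mult_mono) auto
      finally show ?thesis .
    qed
    then show "cmod (foldr partial is g y) \<le> 1 / M * (10 * ?n * D)"
      unfolding e1 using c by (simp add: norm_mult norm_divide divide_le_eq mult.commute)
  qed
  have eq: "rel_symbol p x0 M k = (\<lambda>y. bump y * g y)"
    using c by (simp add: rel_symbol_def[abs_def] g_def h_def c_def field_simps)
  have nn: "1 / M * (10 * ?n * D) \<ge> 0" using M D D0 by simp
  show "rel_symbol p x0 M k \<in> smooth_on UNIV"
    and "cmod (fourier_coeff (rel_symbol p x0 M k) l) * japanese l ^ N \<le> decay_const TYPE('n) N * (1 / M * (10 * ?n * D))"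
    unfolding eq using bump_cutoff_decay[OF g gb nn] by auto
qed

lemma rel_symbol_outside: "y \<notin> cball 0 (3 / 2) \<Longrightarrow> rel_symbol p x0 M k y = 0"
  using bump_eq_0[of y] by (simp add: rel_symbol_def)

lemma source_outside: "y \<notin> cball 0 (3 / 2) \<Longrightarrow> source x0 M f y = 0"
  using bump_eq_0[of "2 *\<^sub>R y"] by (simp add: source_def)

locale local_problem =
  fixes p :: "real^'n::finite \<Rightarrow> real^'n \<Rightarrow> complex" and x0 :: "real^'n" and R M D0 \<kappa> :: real
  assumes smooth: "\<And>\<xi>. (\<lambda>y. p y \<xi>) \<in> smooth_on UNIV"
    and D0: "log_deriv_bounded p R (2 * CARD('n)) D0" "D0 \<ge> 0"
    and logd: "\<And>J. \<exists>D. log_deriv_bounded p R J D"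
    and M: "M \<ge> 1" "M \<ge> 2 * R" "M \<ge> 8 * real CARD('n) * D0"
      "M \<ge> 20 * real CARD('n) * japanese_sum TYPE('n) * decay_const TYPE('n) 1 * D0"
    and \<kappa>: "\<kappa> > 0" "\<And>\<xi>. norm \<xi> \<ge> R \<Longrightarrow> cmod (p x0 \<xi>) \<ge> \<kappa>"
begin

lemma freq_large: "norm (lattice_freq M k) \<ge> R" for k :: "'n \<Rightarrow> int"
  using norm_lattice_freq_ge[of M k] M by simp

lemma symbol_lower: "cmod (p x0 (lattice_freq M k)) \<ge> \<kappa>"
  by (rule \<kappa>(2)[OF freq_large])

lemma symbol_nz: "p x0 (lattice_freq M k) \<noteq> 0"
  using symbol_lower[of k] \<kappa>(1) by auto

lemma D0_1: "log_deriv_bounded p R 1 D0"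
proof -
  have "1 \<le> 2 * CARD('n)" by (simp add: Suc_leI)
  then show ?thesis using D0(1) unfolding log_deriv_bounded_def by (meson order_trans)
qed

lemma small: "cmod (fourier_coeff (rel_symbol p x0 M \<xi>) \<eta>) * japanese \<eta> \<le> 1 / (2 * japanese_sum TYPE('n))"
proof -
  let ?n = "real CARD('n)" and ?J = "japanese_sum TYPE('n)"
  have J: "?J > 0" by (rule japanese_sum_pos)
  have "cmod (fourier_coeff (rel_symbol p x0 M \<xi>) \<eta>) * japanese \<eta> ^ 1 \<le> decay_const TYPE('n) 1 * (1 / M * (10 * ?n * D0))"
    by (rule rel_symbol_decay(2)[OF smooth D0_1 D0(2) _ _ M(1-3) symbol_nz]) (use D0(1) in simp_all)
  also have "\<dots> \<le> 1 / (2 * ?J)"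
    using M(1,4) J by (simp add: field_simps)
  finally show ?thesis by simp
qed

lemma decay:
  assumes D: "log_deriv_bounded p R (2 * Suc s * CARD('n)) D" "D \<ge> D0"
  shows "cmod (fourier_coeff (rel_symbol p x0 M \<xi>) \<eta>) * japanese \<eta> ^ Suc s \<le> decay_const TYPE('n) (Suc s) * (10 * real CARD('n) * D)"
proof -
  have "cmod (fourier_coeff (rel_symbol p x0 M \<xi>) \<eta>) * japanese \<eta> ^ Suc s \<le> decay_const TYPE('n) (Suc s) * (1 / M * (10 * real CARD('n) * D))"
    by (rule rel_symbol_decay(2)[OF smooth D0_1 D0(2) D M(1-3) symbol_nz])
  also have "\<dots> \<le> decay_const TYPE('n) (Suc s) * (1 * (10 * real CARD('n) * D))"
    using M(1) D(2) D0(2) decay_const_nonneg[where 'n = 'n] by (intro mult_left_mono mult_right_mono) auto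
  finally show ?thesis by simp
qed

end

definition sol_const :: "'n::finite itself \<Rightarrow> real \<Rightarrow> nat \<Rightarrow> real \<Rightarrow> real" where
  "sol_const T M s D = (M * (real CARD('n) + 1)) ^ s * (4 * japanese_sum T *
     (4 * (decay_const T (Suc s) * (10 * real CARD('n) * D) * japanese_sum T + 1)) ^ s *
     (decay_const T (Suc s) * (8 ^ (2 * Suc s * CARD('n)) * bump_bound T (2 * Suc s * CARD('n)))))"

context local_problem
begin

lemma neumann_coeff_bound:
  assumes D: "log_deriv_bounded p R (2 * Suc s * CARD('n)) D" "D \<ge> D0"
    and f: "f \<in> smooth_on UNIV" "derivs_bounded (ball x0 (2 / M)) (2 * Suc s * CARD('n)) B f" "B \<ge> 0"
  shows "weighted_sum_le (\<lambda>k. (1 + freq_size k) ^ s) (neumann_coeff p x0 M f)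
      (4 * japanese_sum TYPE('n) *
     (4 * (decay_const TYPE('n) (Suc s) * (10 * real CARD('n) * D) * japanese_sum TYPE('n) + 1)) ^ s *
     (decay_const TYPE('n) (Suc s) * (8 ^ (2 * Suc s * CARD('n)) * bump_bound TYPE('n) (2 * Suc s * CARD('n)) * B)))"
    and "neumann_coeff p x0 M f \<zeta> = fourier_coeff (source x0 M f) \<zeta> -
      (\<Sum>\<^sub>\<infinity>\<xi>. fourier_coeff (rel_symbol p x0 M \<xi>) (\<lambda>i. \<zeta> i - \<xi> i) * neumann_coeff p x0 M f \<xi>)"
proof -
  have C0: "decay_const TYPE('n) (Suc s) * (10 * real CARD('n) * D) \<ge> 0"
    using decay_const_nonneg[where 'n = 'n] D(2) D0(2) by (intro mult_nonneg_nonneg) auto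
  note cn = convolution_neumann[of "\<lambda>\<xi>. fourier_coeff (rel_symbol p x0 M \<xi>)", OF small decay[OF D] C0 source_decay(2)[OF f(1) M(1) f(2,3)]]
  show "weighted_sum_le (\<lambda>k. (1 + freq_size k) ^ s) (neumann_coeff p x0 M f)
      (4 * japanese_sum TYPE('n) *
     (4 * (decay_const TYPE('n) (Suc s) * (10 * real CARD('n) * D) * japanese_sum TYPE('n) + 1)) ^ s *
     (decay_const TYPE('n) (Suc s) * (8 ^ (2 * Suc s * CARD('n)) * bump_bound TYPE('n) (2 * Suc s * CARD('n)) * B)))"
    using cn(2) unfolding neumann_coeff_def .
  show "neumann_coeff p x0 M f \<zeta> = fourier_coeff (source x0 M f) \<zeta> -
      (\<Sum>\<^sub>\<infinity>\<xi>. fourier_coeff (rel_symbol p x0 M \<xi>) (\<lambda>i. \<zeta> i - \<xi> i) * neumann_coeff p x0 M f \<xi>)"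
    using cn(1) unfolding neumann_coeff_def .
qed

lemma sol_coeff_bound:
  assumes D: "log_deriv_bounded p R (2 * Suc s * CARD('n)) D" "D \<ge> D0"
    and f: "f \<in> smooth_on UNIV" "derivs_bounded (ball x0 (2 / M)) (2 * Suc s * CARD('n)) B f" "B \<ge> 0"
  shows "weighted_sum_le (\<lambda>k. (1 + norm (lattice_freq M k)) ^ s) (sol_coeff p x0 M f) (sol_const TYPE('n) M s D * B / \<kappa>)"
proof -
  define A where "A = 4 * japanese_sum TYPE('n) *
     (4 * (decay_const TYPE('n) (Suc s) * (10 * real CARD('n) * D) * japanese_sum TYPE('n) + 1)) ^ s *
     (decay_const TYPE('n) (Suc s) * (8 ^ (2 * Suc s * CARD('n)) * bump_bound TYPE('n) (2 * Suc s * CARD('n)) * B))"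
  define c where "c = (M * (real CARD('n) + 1)) ^ s / \<kappa>"
  have c: "c \<ge> 0" using M \<kappa> by (simp add: c_def)
  have w: "weighted_sum_le (\<lambda>k. (1 + freq_size k) ^ s) (neumann_coeff p x0 M f) A"
    unfolding A_def by (rule neumann_coeff_bound[OF D f])
  have s: "(\<lambda>k. c * ((1 + freq_size k) ^ s * cmod (neumann_coeff p x0 M f k))) summable_on UNIV"
    using w by (intro summable_on_cmult_right) (simp add: weighted_sum_le_def)
  have le: "(1 + norm (lattice_freq M k)) ^ s * cmod (sol_coeff p x0 M f k) \<le> c * ((1 + freq_size k) ^ s * cmod (neumann_coeff p x0 M f k))" for k
  proof -
    have "(1 + norm (lattice_freq M k)) ^ s \<le> ((M * (real CARD('n) + 1)) * (1 + freq_size k)) ^ s"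
      by (intro power_mono norm_lattice_freq_le M) simp
    moreover have "cmod (sol_coeff p x0 M f k) \<le> cmod (neumann_coeff p x0 M f k) / \<kappa>"
      unfolding sol_coeff_def norm_mult norm_divide norm_wave mult_1_right
      using \<kappa>(1) symbol_lower[of k] by (intro divide_left_mono mult_pos_pos) auto
    ultimately have "(1 + norm (lattice_freq M k)) ^ s * cmod (sol_coeff p x0 M f k) \<le>
       ((M * (real CARD('n) + 1)) * (1 + freq_size k)) ^ s * (cmod (neumann_coeff p x0 M f k) / \<kappa>)"
      using M(1) freq_size_nonneg[of k] by (intro mult_mono) auto
    then show ?thesis by (simp add: c_def power_mult_distrib)
  qed
  have s': "(\<lambda>k. (1 + norm (lattice_freq M k)) ^ s * cmod (sol_coeff p x0 M f k)) summable_on UNIV"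
    by (rule summable_on_comparison_test[OF s le]) simp
  have "(\<Sum>\<^sub>\<infinity>k. (1 + norm (lattice_freq M k)) ^ s * cmod (sol_coeff p x0 M f k)) \<le> (\<Sum>\<^sub>\<infinity>k. c * ((1 + freq_size k) ^ s * cmod (neumann_coeff p x0 M f k)))"
    by (rule infsum_mono[OF s' s le])
  also have "\<dots> \<le> c * A"
    unfolding infsum_cmult_right' using w c by (intro mult_left_mono) (auto simp: weighted_sum_le_def)
  also have "c * A = sol_const TYPE('n) M s D * B / \<kappa>"
    by (simp add: c_def A_def sol_const_def)
  finally show ?thesis using s' by (simp add: weighted_sum_le_def)
qed

lemma derivs_bounded_ball:
  assumes "f \<in> smooth_on (UNIV :: (real^'n) set)"
  obtains B where "B \<ge> 0" "derivs_bounded (ball x0 (2 / M)) J B f"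
proof -
  obtain B where "B \<ge> 0" "derivs_bounded (cball x0 (2 / M)) J B f"
    using derivs_bounded_compact[OF assms compact_cball subset_UNIV] by blast
  then show ?thesis using that derivs_bounded_mono[of "cball x0 (2 / M)" J B f J B "ball x0 (2 / M)"] by auto
qed

lemma log_deriv_ge:
  obtains D where "log_deriv_bounded p R J D" "D \<ge> D0"
proof -
  obtain D where D: "log_deriv_bounded p R J D" using logd by blast
  have "log_deriv_bounded p R J (max D D0)"
    unfolding log_deriv_bounded_def
  proof (intro allI impI)
    fix \<xi> x :: "real^'n" and "is" :: "'n list" assume "norm \<xi> \<ge> R" "length is \<le> J"
    then have "cmod (foldr partial is (\<lambda>y. p y \<xi>) x) \<le> D * cmod (p x \<xi>)" using D by (simp add: log_deriv_bounded_def)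
    also have "\<dots> \<le> max D D0 * cmod (p x \<xi>)" by (intro mult_right_mono) auto
    finally show "cmod (foldr partial is (\<lambda>y. p y \<xi>) x) \<le> max D D0 * cmod (p x \<xi>)" .
  qed
  then show ?thesis using that by auto
qed

lemma sol_coeff_rapid:
  assumes f: "f \<in> smooth_on UNIV"
  shows "rapid (lattice_freq M) (sol_coeff p x0 M f)"
  unfolding rapid_def
proof
  fix s
  obtain B where "B \<ge> 0" "derivs_bounded (ball x0 (2 / M)) (2 * Suc s * CARD('n)) B f"
    using derivs_bounded_ball[OF f] .
  moreover obtain D where "log_deriv_bounded p R (2 * Suc s * CARD('n)) D" "D \<ge> D0" using log_deriv_ge .
  ultimately show "(\<lambda>k. (1 + norm (lattice_freq M k)) ^ s * cmod (sol_coeff p x0 M f k)) summable_on UNIV"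
    using sol_coeff_bound f by (simp add: weighted_sum_le_def)
qed

theorem local_solution:
  assumes f: "f \<in> smooth_on UNIV" and x: "x \<in> ball x0 (1 / M)"
  shows "(\<Sum>\<^sub>\<infinity>k. sol_coeff p x0 M f k * p x (lattice_freq M k) * wave (lattice_freq M k) x)
    = bump ((2 * M) *\<^sub>R (x - x0)) * f x"
proof -
  define y where "y = M *\<^sub>R (x - x0)"
  define v where "v = neumann_coeff p x0 M f"
  define b where "b \<xi> = fourier_coeff (rel_symbol p x0 M \<xi>)" for \<xi>
  define g where "g = fourier_coeff (source x0 M f)"
  have M0: "M > 0" using M(1) by simp
  have y: "norm y < 1"
  proof -
    have "norm y = M * norm (x - x0)" using M0 by (simp add: y_def)
    moreover have "norm (x - x0) < 1 / M" using x by (simp add: dist_norm norm_minus_commute)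
    ultimately show ?thesis using M0 by (simp add: field_simps)
  qed
  have yi: "\<forall>i. \<bar>y $ i\<bar> < pi"
  proof
    fix i
    have "\<bar>y $ i\<bar> < 1" using component_le_norm_cart[of y i] y by simp
    then show "\<bar>y $ i\<bar> < pi" using pi_gt3 by simp
  qed
  have xy: "x0 + (1 / M) *\<^sub>R y = x" using M0 by (simp add: y_def)
  obtain B where B: "B \<ge> 0" "derivs_bounded (ball x0 (2 / M)) (2 * Suc 0 * CARD('n)) B f"
    using derivs_bounded_ball[OF f] .
  have D0': "log_deriv_bounded p R (2 * Suc 0 * CARD('n)) D0" using D0(1) by simp
  note nb = neumann_coeff_bound[OF D0' order_refl f B(2,1), folded v_def]
  have vs: "(\<lambda>k. cmod (v k)) summable_on UNIV" using nb(1) by (simp add: weighted_sum_le_def)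
  have gs: "(\<lambda>k. cmod (g k)) summable_on UNIV" unfolding g_def
    by (rule summable_fourier_coeff[OF source_decay(1)[OF f M(1) B(2,1)] compact_cball source_outside])
  have inv_g: "source x0 M f y = (\<Sum>\<^sub>\<infinity>k. g k * wave (freq k) y)" unfolding g_def
    by (rule fourier_inversion[OF source_decay(1)[OF f M(1) B(2,1)] compact_cball source_outside cball_subset_torus yi])
  have rs: "rel_symbol p x0 M \<xi> \<in> smooth_on UNIV" for \<xi>
    by (rule rel_symbol_decay(1)[OF smooth D0_1 D0(2) _ _ M(1-3) symbol_nz, of 1 D0]) (use D0(1) in simp_all)
  have inv_b: "rel_symbol p x0 M \<xi> y = (\<Sum>\<^sub>\<infinity>k. b \<xi> k * wave (freq k) y)" for \<xi> unfolding b_def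
    by (rule fourier_inversion[OF rs compact_cball rel_symbol_outside cball_subset_torus yi])
  have cb: "column_bounded (\<lambda>k. 1) (\<lambda>\<zeta> \<xi>. b \<xi> (\<lambda>i. \<zeta> i - \<xi> i)) (3 / 4)"
    using convolution_kernel_column_bounded[where b = b and s = 0 and C = "1 / (2 * japanese_sum TYPE('n))", OF _ _ _ refl]
      small japanese_sum_pos[where 'n = 'n] by (simp add: b_def)
  define F where "F \<xi> \<zeta> = v \<xi> * (b \<xi> (\<lambda>i. \<zeta> i - \<xi> i) * wave (freq \<zeta>) y)" for \<xi> \<zeta>
  have nF: "cmod (F \<xi> \<zeta>) = cmod (v \<xi>) * cmod (b \<xi> (\<lambda>i. \<zeta> i - \<xi> i))" for \<xi> \<zeta> by (simp add: F_def norm_mult)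
  have F1: "(\<lambda>\<zeta>. cmod (F \<xi> \<zeta>)) summable_on UNIV" for \<xi>
    unfolding nF using cb by (intro summable_on_cmult_right) (simp add: column_bounded_def weighted_sum_le_def)
  have F2: "(\<Sum>\<^sub>\<infinity>\<zeta>. cmod (F \<xi> \<zeta>)) \<le> cmod (v \<xi>) * (3 / 4)" for \<xi>
    unfolding nF infsum_cmult_right' using cb by (intro mult_left_mono) (simp_all add: column_bounded_def weighted_sum_le_def)
  note ds = double_sum_bound[OF F1 F2 summable_on_cmult_left[OF vs]]
  have Fin: "(\<Sum>\<^sub>\<infinity>\<zeta>. F \<xi> \<zeta>) = v \<xi> * wave (freq \<xi>) y * rel_symbol p x0 M \<xi> y" for \<xi>
  proof -
    have "F \<xi> \<zeta> = v \<xi> * wave (freq \<xi>) y * (b \<xi> (\<lambda>i. \<zeta> i - \<xi> i) * wave (freq (\<lambda>i. \<zeta> i - \<xi> i)) y)" for \<zeta>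
    proof -
      have "wave (freq \<zeta>) y = wave (freq \<xi>) y * wave (freq (\<lambda>i. \<zeta> i - \<xi> i)) y"
        unfolding freq_diff wave_add[symmetric] by simp
      then show ?thesis by (simp add: F_def)
    qed
    then have "(\<Sum>\<^sub>\<infinity>\<zeta>. F \<xi> \<zeta>) = v \<xi> * wave (freq \<xi>) y * (\<Sum>\<^sub>\<infinity>\<zeta>. b \<xi> (\<lambda>i. \<zeta> i - \<xi> i) * wave (freq (\<lambda>i. \<zeta> i - \<xi> i)) y)"
      by (simp only: infsum_cmult_right')
    then show ?thesis unfolding infsum_translate(1)[of "\<lambda>\<zeta>. b \<xi> \<zeta> * wave (freq \<zeta>) y"] inv_b .
  qed
  have sv: "(\<lambda>k. v k * wave (freq k) y) summable_on UNIV" and sg: "(\<lambda>k. g k * wave (freq k) y) summable_on UNIV"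
    by (rule abs_summable_summable, simp add: norm_mult vs gs)+
  have sF: "(\<lambda>\<zeta>. \<Sum>\<^sub>\<infinity>\<xi>. F \<xi> \<zeta>) summable_on UNIV"
  proof (rule abs_summable_summable, rule summable_on_comparison_test[OF ds(2)])
    show "norm (\<Sum>\<^sub>\<infinity>\<xi>. F \<xi> \<zeta>) \<le> (\<Sum>\<^sub>\<infinity>\<xi>. cmod (F \<xi> \<zeta>))" for \<zeta>
      by (rule norm_infsum_le'[OF ds(1)])
  qed simp
  have veq: "v \<zeta> * wave (freq \<zeta>) y = g \<zeta> * wave (freq \<zeta>) y - (\<Sum>\<^sub>\<infinity>\<xi>. F \<xi> \<zeta>)" for \<zeta>
  proof -
    define S where "S = (\<Sum>\<^sub>\<infinity>\<xi>. b \<xi> (\<lambda>i. \<zeta> i - \<xi> i) * v \<xi>)"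
    have "(\<Sum>\<^sub>\<infinity>\<xi>. F \<xi> \<zeta>) = (\<Sum>\<^sub>\<infinity>\<xi>. (b \<xi> (\<lambda>i. \<zeta> i - \<xi> i) * v \<xi>) * wave (freq \<zeta>) y)"
      unfolding F_def by (intro infsum_cong) (simp add: mult_ac)
    also have "\<dots> = S * wave (freq \<zeta>) y" unfolding S_def by (rule infsum_cmult_left')
    finally have "(\<Sum>\<^sub>\<infinity>\<xi>. F \<xi> \<zeta>) = S * wave (freq \<zeta>) y" .
    moreover have "v \<zeta> = g \<zeta> - S" using nb(2)[of \<zeta>] by (simp only: b_def g_def S_def)
    ultimately show ?thesis by (simp add: left_diff_distrib)
  qed
  have "(\<Sum>\<^sub>\<infinity>\<zeta>. v \<zeta> * wave (freq \<zeta>) y) = source x0 M f y - (\<Sum>\<^sub>\<infinity>\<zeta>. \<Sum>\<^sub>\<infinity>\<xi>. F \<xi> \<zeta>)"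
    unfolding veq inv_g by (rule infsum_diff_complex[OF sg sF])
  also have "(\<Sum>\<^sub>\<infinity>\<zeta>. \<Sum>\<^sub>\<infinity>\<xi>. F \<xi> \<zeta>) = (\<Sum>\<^sub>\<infinity>\<xi>. v \<xi> * wave (freq \<xi>) y * rel_symbol p x0 M \<xi> y)"
    unfolding ds(4)[symmetric] Fin ..
  finally have main: "(\<Sum>\<^sub>\<infinity>\<zeta>. v \<zeta> * wave (freq \<zeta>) y) + (\<Sum>\<^sub>\<infinity>\<xi>. v \<xi> * wave (freq \<xi>) y * rel_symbol p x0 M \<xi> y) = source x0 M f y"
    by simp
  have sr: "(\<lambda>\<xi>. v \<xi> * wave (freq \<xi>) y * rel_symbol p x0 M \<xi> y) summable_on UNIV"
  proof (rule abs_summable_summable, rule summable_on_comparison_test[OF ds(5)])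
    show "norm (v \<xi> * wave (freq \<xi>) y * rel_symbol p x0 M \<xi> y) \<le> (\<Sum>\<^sub>\<infinity>\<zeta>. cmod (F \<xi> \<zeta>))" for \<xi>
      unfolding Fin[symmetric] by (rule norm_infsum_le'[OF F1])
  qed simp
  have summand_eq: "sol_coeff p x0 M f k * p x (lattice_freq M k) * wave (lattice_freq M k) x
      = wave half_shift y * (v k * wave (freq k) y + v k * wave (freq k) y * rel_symbol p x0 M k y)" for k
  proof -
    have "lattice_freq M k \<bullet> (- x0) + lattice_freq M k \<bullet> x = (freq k + half_shift) \<bullet> y"
      by (simp add: lattice_freq_def y_def inner_diff_right algebra_simps)
    then have "wave (lattice_freq M k) (- x0) * wave (lattice_freq M k) x = wave (freq k + half_shift) y"
      unfolding wave_def exp_add[symmetric] distrib_left[symmetric] of_real_add[symmetric] by (simp only:)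
    moreover have "1 + rel_symbol p x0 M k y = p x (lattice_freq M k) / p x0 (lattice_freq M k)"
      using y by (simp add: rel_symbol_def bump_eq_1 xy)
    then have "v k * wave (freq k) y + v k * wave (freq k) y * rel_symbol p x0 M k y
       = v k * wave (freq k) y * (p x (lattice_freq M k) / p x0 (lattice_freq M k))"
      by (metis distrib_left mult.right_neutral)
    ultimately show ?thesis
      unfolding sol_coeff_def v_def[symmetric] by (simp add: wave_add mult_ac)
  qed
  have "(\<Sum>\<^sub>\<infinity>k. sol_coeff p x0 M f k * p x (lattice_freq M k) * wave (lattice_freq M k) x)
    = wave half_shift y * source x0 M f y"
    unfolding summand_eq infsum_cmult_right' infsum_add[OF sv sr] main ..
  also have "\<dots> = (wave half_shift y * wave (- half_shift) y) * (bump (2 *\<^sub>R y) * f x)"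
    by (simp add: source_def xy)
  also have "wave half_shift y * wave (- half_shift) y = 1"
    unfolding wave_add[symmetric] by simp
  finally show ?thesis by (simp add: y_def)
qed

lemma local_solution_bound:
  assumes D: "log_deriv_bounded p R (2 * Suc (mi_order \<alpha>) * CARD('n)) D" "D \<ge> D0"
    and f: "f \<in> smooth_on UNIV" "derivs_bounded (ball x0 (2 / M)) (2 * Suc (mi_order \<alpha>) * CARD('n)) B f" "B \<ge> 0"
  shows "cmod (mpartial \<alpha> (wave_series (lattice_freq M) (sol_coeff p x0 M f)) x) \<le> sol_const TYPE('n) M (mi_order \<alpha>) D * B / \<kappa>"
  using mpartial_wave_series_bound[OF sol_coeff_rapid[OF f(1)], of \<alpha> x] sol_coeff_bound[OF D f]
  by (simp add: weighted_sum_le_def)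

end

section \<open>Weak derivatives\<close>

lemma integral_by_parts_list:
  fixes f \<psi> :: "'n::finite cfun"
  assumes f: "f \<in> smooth_on UNIV" and \<psi>: "\<psi> \<in> smooth_on UNIV" and T: "compact T" "\<And>x. x \<notin> T \<Longrightarrow> \<psi> x = 0"
  shows "(LINT x|lborel. f x * foldr partial is \<psi> x) = (-1) ^ length is * (LINT x|lborel. foldr partial (rev is) f x * \<psi> x)"
  using f
proof (induction "is" arbitrary: f)
  case (Cons i "is")
  define \<Psi> where "\<Psi> = foldr partial is \<psi>"
  have \<Psi>: "\<Psi> \<in> smooth_on UNIV" unfolding \<Psi>_def by (rule smooth_on_foldr_partial[OF \<psi>])
  have 0: "\<Psi> x = 0" "partial i \<Psi> x = 0" if "x \<notin> T" for x
  proof -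
    show "\<Psi> x = 0" unfolding \<Psi>_def
      by (rule foldr_partial_outside[OF compact_imp_closed[OF T(1)]]) (use T(2) that in auto)
    have "foldr partial (i # is) \<psi> x = 0"
      by (rule foldr_partial_outside[OF compact_imp_closed[OF T(1)]]) (use T(2) that in auto)
    then show "partial i \<Psi> x = 0" by (simp add: \<Psi>_def)
  qed
  have c: "continuous_on T f" "continuous_on T (partial i f)" "continuous_on T \<Psi>" "continuous_on T (partial i \<Psi>)"
    using smooth_on_continuous[OF Cons.prems, of "[]"] smooth_on_continuous[OF Cons.prems, of "[i]"]
      smooth_on_continuous[OF \<Psi>, of "[]"] smooth_on_continuous[OF \<Psi>, of "[i]"] continuous_on_subset by auto
  have "0 = (LINT x|lborel. partial i (\<lambda>x. f x * \<Psi> x) x)"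
    by (rule integral_partial_eq_0[OF _ T(1), symmetric]) (auto intro!: smooth_on_mult Cons.prems \<Psi> simp: 0)
  also have "\<dots> = (LINT x|lborel. f x * partial i \<Psi> x + partial i f x * \<Psi> x)"
    by (intro Bochner_Integration.integral_cong refl partial_mult smooth_on_differentiable_at[OF _ open_UNIV UNIV_I] Cons.prems \<Psi>)
  also have "\<dots> = (LINT x|lborel. f x * partial i \<Psi> x) + (LINT x|lborel. partial i f x * \<Psi> x)"
    by (rule Bochner_Integration.integral_add; rule integrable_compact_support[OF T(1)])
       (auto intro!: continuous_on_mult c simp: 0)
  finally have "(LINT x|lborel. f x * partial i \<Psi> x) = - (LINT x|lborel. partial i f x * \<Psi> x)"
    by (simp add: eq_neg_iff_add_eq_0)
  also have "(LINT x|lborel. partial i f x * \<Psi> x) = (-1) ^ length is * (LINT x|lborel. foldr partial (rev is) (partial i f) x * \<psi> x)"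
    unfolding \<Psi>_def by (rule Cons.IH[OF smooth_on_partial[OF Cons.prems]])
  finally show ?case by (simp add: \<Psi>_def)
qed simp

lemma integral_by_parts_mpartial:
  fixes f \<psi> :: "'n::finite cfun"
  assumes f: "f \<in> smooth_on UNIV" and \<psi>: "\<psi> \<in> smooth_on UNIV" and T: "compact T" "\<And>x. x \<notin> T \<Longrightarrow> \<psi> x = 0"
  shows "(LINT x|lborel. f x * mpartial \<alpha> \<psi> x) = (-1) ^ mi_order \<alpha> * (LINT x|lborel. mpartial \<alpha> f x * \<psi> x)"
proof -
  obtain "is" where "is": "mpartial \<alpha> = foldr partial is" "length is = mi_order \<alpha>"
    using mpartial_list[of \<alpha>] by metis
  have "foldr partial (rev is) f = foldr partial is f"
    using foldr_partial_perm[OF f open_UNIV UNIV_I, of "rev is" "is"] by auto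
  then show ?thesis using integral_by_parts_list[OF f \<psi> T, of "is"] by (simp add: "is")
qed

lemma lebesgue_lborel_integral:
  fixes f :: "'a::euclidean_space \<Rightarrow> complex"
  assumes "continuous_on UNIV f"
  shows "(LINT x|lebesgue. f x) = (LINT x|lborel. f x)"
  by (rule integral_completion) (use borel_measurable_continuous_onI[OF assms] in simp)

lemma L_infty_AE:
  assumes "g \<in> L_infty"
  shows "AE x in lebesgue. cmod (g x) \<le> L_infty_norm g"
proof -
  let ?f = "\<lambda>x. ereal (cmod (g x))"
  have g[measurable]: "g \<in> borel_measurable lebesgue" and fin: "esssup lebesgue ?f < \<infinity>"
    using assms by (auto simp: L_infty_def)
  have ae: "AE x in lebesgue. ?f x \<le> esssup lebesgue ?f" by (rule esssup_AE)
  have "esssup lebesgue ?f \<noteq> - \<infinity>"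
  proof
    assume "esssup lebesgue ?f = - \<infinity>"
    with ae have "AE x :: real^'a in lebesgue. False" by simp
    moreover have "(AE x :: real^'a in lebesgue. False) \<longleftrightarrow> emeasure lebesgue (UNIV :: (real^'a) set) = 0"
      by (rule AE_iff_measurable) auto
    ultimately have "emeasure lborel (UNIV :: (real^'a) set) = 0" by simp
    then show False by (simp add: emeasure_lborel_UNIV)
  qed
  then have "ereal (L_infty_norm g) = esssup lebesgue ?f"
    using fin unfolding L_infty_norm_def by (intro ereal_real') auto
  with ae show ?thesis by (auto simp flip: ereal_less_eq(3))
qed

lemma weak_deriv_bound:
  fixes f :: "'n::finite cfun"
  assumes f: "f \<in> smooth_on UNIV" and g: "g \<in> L_infty" "is_weak_deriv \<alpha> f g"
  shows "cmod (mpartial \<alpha> f x0) \<le> L_infty_norm g"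
proof (rule ccontr)
  define h where "h = mpartial \<alpha> f"
  define G where "G = L_infty_norm g"
  assume "\<not> ?thesis"
  then have lt: "G < cmod (h x0)" by (simp add: h_def G_def)
  define \<eta> where "\<eta> = (cmod (h x0) - G) / 2"
  have \<eta>: "\<eta> > 0" using lt by (simp add: \<eta>_def)
  have hs: "h \<in> smooth_on UNIV" unfolding h_def by (rule smooth_on_mpartial[OF f])
  have hc: "continuous_on UNIV h" using smooth_on_continuous[OF hs, of "[]"] by simp
  then obtain r where r: "r > 0" "\<And>x. dist x x0 < 2 * r \<Longrightarrow> dist (h x) (h x0) < \<eta>"
  proof -
    obtain d where "d > 0" "\<And>x. dist x x0 < d \<Longrightarrow> dist (h x) (h x0) < \<eta>"
      using hc \<eta> unfolding continuous_on_iff by (metis UNIV_I)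
    then show ?thesis using that[of "d / 2"] by simp
  qed
  define \<psi> where "\<psi> x = bump ((- (1 / r)) *\<^sub>R x0 + (1 / r) *\<^sub>R x)" for x :: "real^'n"
  have arg: "norm ((- (1 / r)) *\<^sub>R x0 + (1 / r) *\<^sub>R x) = dist x x0 / r" for x
  proof -
    have "(- (1 / r)) *\<^sub>R x0 + (1 / r) *\<^sub>R x = (1 / r) *\<^sub>R (x - x0)" by (simp add: algebra_simps)
    then show ?thesis using r by (simp add: dist_norm)
  qed
  have \<psi>s: "\<psi> \<in> smooth_on UNIV"
    using smooth_on_affine[OF bump_smooth open_UNIV, of "(- (1 / r)) *\<^sub>R x0" "1 / r"] by (simp add: \<psi>_def[abs_def])
  have \<psi>c: "continuous_on S \<psi>" for S using smooth_on_continuous[OF \<psi>s, of "[]"] by (auto intro: continuous_on_subset)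
  have \<psi>0: "\<psi> x = 0" if "x \<notin> cball x0 (3 / 2 * r)" for x
    unfolding \<psi>_def using that r by (intro bump_eq_0) (simp only: arg, simp add: field_simps dist_commute)
  have \<psi>n: "\<psi> x = of_real (cmod (\<psi> x))" for x
    using bump_nonneg[of "(- (1 / r)) *\<^sub>R x0 + (1 / r) *\<^sub>R x"] unfolding \<psi>_def by force
  have \<psi>test: "\<psi> \<in> test_functions UNIV"
  proof -
    have sub: "closure {x. \<psi> x \<noteq> 0} \<subseteq> cball x0 (3 / 2 * r)"
      by (rule closure_minimal[OF _ closed_cball]) (use \<psi>0 in blast)
    then have "compact (closure {x. \<psi> x \<noteq> 0})"
      using compact_Int_closed[OF compact_cball closed_closure, of x0 "3 / 2 * r" "{x. \<psi> x \<noteq> 0}"] by (simp add: Int_absorb1)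
    then show ?thesis using \<psi>s by (simp add: test_functions_def)
  qed
  have int: "integrable lborel \<psi>" by (rule integrable_compact_support[OF compact_cball \<psi>c \<psi>0])
  have inth: "integrable lborel (\<lambda>x. h x * \<psi> x)"
    by (rule integrable_compact_support[OF compact_cball, of x0 "3 / 2 * r"])
       (auto intro!: continuous_on_mult \<psi>c continuous_on_subset[OF hc] simp: \<psi>0)
  have intn: "integrable lborel (\<lambda>x. cmod (\<psi> x))" by (rule integrable_norm[OF int])
  define I where "I = (LINT x|lborel. cmod (\<psi> x))"
  have I: "I > 0"
  proof -
    have "(LINT x|lborel. indicator (ball x0 r) x) \<le> I"
      unfolding I_def
    proof (rule integral_mono[OF _ intn])
      show "integrable lborel (indicator (ball x0 r) :: real^'n \<Rightarrow> real)"
        using emeasure_bounded_finite[of "ball x0 r"] by (intro integrable_real_indicator) auto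
      show "indicator (ball x0 r) x \<le> cmod (\<psi> x)" for x
      proof (cases "x \<in> ball x0 r")
        case True
        then have "\<psi> x = 1" unfolding \<psi>_def using r by (intro bump_eq_1) (simp only: arg, simp add: dist_commute)
        then show ?thesis by simp
      qed simp
    qed
    moreover have "(LINT x|lborel. indicator (ball x0 r) x) = measure lborel (ball x0 r)" by simp
    ultimately show ?thesis using content_ball_pos[OF r(1), of x0] by linarith
  qed
  have "(LINT x|lebesgue. f x * mpartial \<alpha> \<psi> x) = (-1) ^ mi_order \<alpha> * (LINT x|lebesgue. g x * \<psi> x)"
    using g(2) \<psi>test by (simp add: is_weak_deriv_def)
  moreover have "(LINT x|lebesgue. f x * mpartial \<alpha> \<psi> x) = (LINT x|lborel. f x * mpartial \<alpha> \<psi> x)"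
    using smooth_on_continuous[OF f, of "[]"] smooth_on_continuous[OF smooth_on_mpartial[OF \<psi>s], of "[]"]
    by (intro lebesgue_lborel_integral continuous_on_mult) auto
  moreover have "(LINT x|lborel. f x * mpartial \<alpha> \<psi> x) = (-1) ^ mi_order \<alpha> * (LINT x|lborel. h x * \<psi> x)"
    unfolding h_def by (rule integral_by_parts_mpartial[OF f \<psi>s compact_cball \<psi>0])
  ultimately have eq: "(LINT x|lborel. h x * \<psi> x) = (LINT x|lebesgue. g x * \<psi> x)" by simp
  have le1: "cmod (LINT x|lebesgue. g x * \<psi> x) \<le> G * I"
  proof -
    have iG: "integrable lebesgue (\<lambda>x. G * cmod (\<psi> x))"
      using intn borel_measurable_integrable[OF intn] by (intro integrable_mult_right) (simp add: integrable_completion)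
    have ae: "AE x in lebesgue. cmod (g x * \<psi> x) \<le> G * cmod (\<psi> x)"
      using L_infty_AE[OF g(1)] by eventually_elim (auto simp: norm_mult G_def intro: mult_right_mono)
    have "g \<in> borel_measurable lebesgue" "\<psi> \<in> borel_measurable lebesgue"
      using g(1) measurable_completion[OF borel_measurable_integrable[OF int]] by (auto simp: L_infty_def)
    then have "(\<lambda>x. g x * \<psi> x) \<in> borel_measurable lebesgue" by measurable
    then have i: "integrable lebesgue (\<lambda>x. g x * \<psi> x)"
      by (rule Bochner_Integration.integrable_bound[OF iG]) (use ae in \<open>eventually_elim, auto intro: order_trans\<close>)
    have "cmod (LINT x|lebesgue. g x * \<psi> x) \<le> (LINT x|lebesgue. cmod (g x * \<psi> x))" by (rule integral_norm_bound)
    also have "\<dots> \<le> (LINT x|lebesgue. G * cmod (\<psi> x))" by (rule integral_mono_AE[OF integrable_norm[OF i] iG ae])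
    also have "\<dots> = G * I"
      using \<psi>c[of UNIV] borel_measurable_integrable[OF intn] by (simp add: I_def integral_completion)
    finally show ?thesis .
  qed
  have "h x0 * of_real I = (LINT x|lborel. h x0 * \<psi> x)"
  proof -
    have "complex_of_real I = (LINT x|lborel. complex_of_real (cmod (\<psi> x)))" unfolding I_def by (rule integral_of_real[OF intn, symmetric])
    then show ?thesis unfolding \<psi>n[symmetric] by simp
  qed
  then have "(LINT x|lborel. h x * \<psi> x) - h x0 * of_real I = (LINT x|lborel. (h x - h x0) * \<psi> x)"
    using inth int by (simp add: left_diff_distrib)
  also have "cmod \<dots> \<le> (LINT x|lborel. \<eta> * cmod (\<psi> x))"
  proof (rule Bochner_Integration.integral_norm_bound_integral)
    show "integrable lborel (\<lambda>x. (h x - h x0) * \<psi> x)" using inth int by (simp add: left_diff_distrib)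
    show "cmod ((h x - h x0) * \<psi> x) \<le> \<eta> * cmod (\<psi> x)" for x
    proof (cases "x \<in> cball x0 (3 / 2 * r)")
      case True
      then have "dist (h x) (h x0) < \<eta>" using r by (intro r(2)) (simp add: dist_commute)
      then show ?thesis unfolding norm_mult by (intro mult_right_mono) (auto simp: dist_norm)
    next
      case False
      then show ?thesis using \<psi>0[OF False] by simp
    qed
  qed (use intn in simp)
  also have "\<dots> = \<eta> * I" by (simp add: I_def)
  finally have "cmod (h x0 * of_real I) \<le> G * I + \<eta> * I"
    using le1 eq norm_triangle_sub[of "h x0 * of_real I" "LINT x|lborel. h x * \<psi> x"] by (simp add: norm_minus_commute)
  then have "cmod (h x0) * I \<le> (G + \<eta>) * I" using I by (simp add: norm_mult distrib_right)
  then have "cmod (h x0) \<le> G + \<eta>" using I by simp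
  then show False using \<eta> by (simp add: \<eta>_def field_simps)
qed

lemma sobolev_infty_norm_bound:
  fixes f :: "'n::finite cfun"
  assumes f: "f \<in> sobolev_infty_all" and \<alpha>: "mi_order \<alpha> \<le> s"
  shows "cmod (mpartial \<alpha> f x) \<le> sobolev_infty_norm s f"
proof -
  have s: "f \<in> smooth_on UNIV" "f \<in> sobolev_infty s" using f by (auto simp: sobolev_infty_all_def)
  define g where "g = (SOME g. g \<in> L_infty \<and> is_weak_deriv \<alpha> f g)"
  have "\<exists>g. g \<in> L_infty \<and> is_weak_deriv \<alpha> f g" using s(2) \<alpha> by (auto simp: sobolev_infty_def)
  from someI_ex[OF this] have g: "g \<in> L_infty" "is_weak_deriv \<alpha> f g" by (auto simp: g_def)
  have "L_infty_norm g \<le> sobolev_infty_norm s f"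
    unfolding sobolev_infty_norm_def g_def
    by (rule Max_ge[OF finite_imageI[OF finite_mi_order]]) (use \<alpha> in auto)
  then show ?thesis using weak_deriv_bound[OF s(1) g, of x] by linarith
qed

section \<open>Growth of nets\<close>

lemma derivs_bounded_cong:
  assumes "open \<Omega>" "K \<subseteq> \<Omega>" "\<And>x. x \<in> \<Omega> \<Longrightarrow> f x = g x" "derivs_bounded K J B f"
  shows "derivs_bounded K J B g"
proof -
  have "foldr partial is f x = foldr partial is g x" if "x \<in> K" for "is" x
    by (rule foldr_partial_cong[OF assms(1)]) (use assms that in auto)
  then show ?thesis using assms(4) unfolding derivs_bounded_def by metis
qed

lemma derivs_bounded_add:
  assumes "open \<Omega>" "K \<subseteq> \<Omega>" "f \<in> smooth_on \<Omega>" "g \<in> smooth_on \<Omega>" "derivs_bounded K J A f" "derivs_bounded K J B g"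
  shows "derivs_bounded K J (A + B) (\<lambda>x. f x + g x)"
  unfolding derivs_bounded_def
proof (intro allI impI ballI)
  fix "is" :: "'a list" and x assume *: "length is \<le> J" "x \<in> K"
  then have "foldr partial is (\<lambda>x. f x + g x) x = foldr partial is f x + foldr partial is g x"
    using assms(2) by (intro foldr_partial_add[OF assms(3,4,1)]) auto
  then show "cmod (foldr partial is (\<lambda>x. f x + g x) x) \<le> A + B"
    using * assms(5,6) unfolding derivs_bounded_def by (metis add_mono norm_triangle_le)
qed

lemma derivs_bounded_cmult:
  assumes "open \<Omega>" "K \<subseteq> \<Omega>" "f \<in> smooth_on \<Omega>" "derivs_bounded K J B f"
  shows "derivs_bounded K J (cmod c * B) (\<lambda>x. c * f x)"
  unfolding derivs_bounded_def
proof (intro allI impI ballI)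
  fix "is" :: "'a list" and x assume *: "length is \<le> J" "x \<in> K"
  then have "foldr partial is (\<lambda>x. c * f x) x = c * foldr partial is f x"
    using assms(2) by (intro foldr_partial_cmult[OF assms(3,1)]) auto
  then show "cmod (foldr partial is (\<lambda>x. c * f x) x) \<le> cmod c * B"
    using * assms(4) unfolding derivs_bounded_def by (simp add: norm_mult mult_left_mono)
qed

lemma derivs_bounded_foldr_partial:
  assumes "derivs_bounded K (J + length js) B f"
  shows "derivs_bounded K J B (foldr partial js f)"
  unfolding derivs_bounded_def
proof (intro allI impI ballI)
  fix "is" :: "'a list" and x assume *: "length is \<le> J" "x \<in> K"
  then have "cmod (foldr partial (is @ js) f x) \<le> B"
    using assms unfolding derivs_bounded_def by (metis add_le_mono1 length_append)
  then show "cmod (foldr partial is (foldr partial js f) x) \<le> B" by simp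
qed

definition net_growth :: "(real^'n::finite) set \<Rightarrow> nat \<Rightarrow> real \<Rightarrow> 'n cfun net \<Rightarrow> bool" where
  "net_growth K J e u \<longleftrightarrow> (\<exists>C\<ge>0. \<forall>\<^sub>F \<epsilon> in at_right 0. derivs_bounded K J (C * \<epsilon> powr e) (u \<epsilon>))"

abbreviation smooth_net :: "(real^'n::finite) set \<Rightarrow> 'n cfun net \<Rightarrow> bool" where
  "smooth_net \<Omega> u \<equiv> \<forall>\<epsilon>\<in>{0<..1}. u \<epsilon> \<in> smooth_on \<Omega>"

lemma eventually_unit: "\<forall>\<^sub>F \<epsilon> in at_right (0::real). \<epsilon> \<in> {0<..1}"
  by (rule eventually_at_rightI[of 0 1]) auto

lemma net_growthI:
  "C \<ge> 0 \<Longrightarrow> \<forall>\<^sub>F \<epsilon> in at_right 0. derivs_bounded K J (C * \<epsilon> powr e) (u \<epsilon>) \<Longrightarrow> net_growth K J e u"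
  unfolding net_growth_def by blast

lemma net_growthE:
  assumes "net_growth K J e u"
  obtains C where "C \<ge> 0" "\<forall>\<^sub>F \<epsilon> in at_right 0. derivs_bounded K J (C * \<epsilon> powr e) (u \<epsilon>)"
  using assms unfolding net_growth_def by blast

lemma net_growth_empty [simp]: "net_growth {} J e u"
  by (rule net_growthI[of 0]) (simp_all add: derivs_bounded_def)

lemma net_growth_zero: "net_growth K J e (\<lambda>\<epsilon> x. 0)"
  by (rule net_growthI[of 0]) (simp_all add: derivs_bounded_def)

lemma net_growth_mono:
  assumes "net_growth K J e u" "K' \<subseteq> K" "J' \<le> J" "e' \<le> e"
  shows "net_growth K' J' e' u"
proof -
  obtain C where C: "C \<ge> 0" "\<forall>\<^sub>F \<epsilon> in at_right 0. derivs_bounded K J (C * \<epsilon> powr e) (u \<epsilon>)"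
    using net_growthE[OF assms(1)] .
  have "\<forall>\<^sub>F \<epsilon> in at_right 0. derivs_bounded K' J' (C * \<epsilon> powr e') (u \<epsilon>)"
    using C(2) eventually_unit
  proof eventually_elim
    case (elim \<epsilon>)
    have "C * \<epsilon> powr e \<le> C * \<epsilon> powr e'" using elim(2) assms(4) C(1) by (intro mult_left_mono powr_mono') auto
    then show ?case by (rule derivs_bounded_mono[OF elim(1) assms(3) _ assms(2)])
  qed
  then show ?thesis by (rule net_growthI[OF C(1)])
qed

lemma net_growth_cong:
  assumes "open \<Omega>" "K \<subseteq> \<Omega>" "\<forall>\<^sub>F \<epsilon> in at_right 0. \<forall>x\<in>\<Omega>. u \<epsilon> x = v \<epsilon> x" "net_growth K J e u"
  shows "net_growth K J e v"
proof -
  obtain C where C: "C \<ge> 0" "\<forall>\<^sub>F \<epsilon> in at_right 0. derivs_bounded K J (C * \<epsilon> powr e) (u \<epsilon>)"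
    using net_growthE[OF assms(4)] .
  have "\<forall>\<^sub>F \<epsilon> in at_right 0. derivs_bounded K J (C * \<epsilon> powr e) (v \<epsilon>)"
    using C(2) assms(3) by eventually_elim (use assms(1,2) derivs_bounded_cong in blast)
  then show ?thesis by (rule net_growthI[OF C(1)])
qed

lemma net_growth_add:
  assumes \<Omega>: "open \<Omega>" "K \<subseteq> \<Omega>" and s: "smooth_net \<Omega> u" "smooth_net \<Omega> v" and g: "net_growth K J e u" "net_growth K J e v"
  shows "net_growth K J e (\<lambda>\<epsilon> x. u \<epsilon> x + v \<epsilon> x)"
proof -
  obtain C where C: "C \<ge> 0" "\<forall>\<^sub>F \<epsilon> in at_right 0. derivs_bounded K J (C * \<epsilon> powr e) (u \<epsilon>)"
    using net_growthE[OF g(1)] .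
  obtain D where D: "D \<ge> 0" "\<forall>\<^sub>F \<epsilon> in at_right 0. derivs_bounded K J (D * \<epsilon> powr e) (v \<epsilon>)"
    using net_growthE[OF g(2)] .
  have "\<forall>\<^sub>F \<epsilon> in at_right 0. derivs_bounded K J ((C + D) * \<epsilon> powr e) (\<lambda>x. u \<epsilon> x + v \<epsilon> x)"
    using C(2) D(2) eventually_unit
    by eventually_elim (use derivs_bounded_add[OF \<Omega>] s in \<open>simp add: distrib_right\<close>)
  from net_growthI[OF _ this] show ?thesis using C(1) D(1) by simp
qed

lemma net_growth_mult:
  assumes \<Omega>: "open \<Omega>" "K \<subseteq> \<Omega>" and s: "smooth_net \<Omega> u" "smooth_net \<Omega> v" and g: "net_growth K J e u" "net_growth K J e' v"
  shows "net_growth K J (e + e') (\<lambda>\<epsilon> x. u \<epsilon> x * v \<epsilon> x)"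
proof -
  obtain C where C: "C \<ge> 0" "\<forall>\<^sub>F \<epsilon> in at_right 0. derivs_bounded K J (C * \<epsilon> powr e) (u \<epsilon>)"
    using net_growthE[OF g(1)] .
  obtain D where D: "D \<ge> 0" "\<forall>\<^sub>F \<epsilon> in at_right 0. derivs_bounded K J (D * \<epsilon> powr e') (v \<epsilon>)"
    using net_growthE[OF g(2)] .
  have "\<forall>\<^sub>F \<epsilon> in at_right 0. derivs_bounded K J ((2 ^ J * (C * D)) * \<epsilon> powr (e + e')) (\<lambda>x. u \<epsilon> x * v \<epsilon> x)"
    using C(2) D(2) eventually_unit
  proof eventually_elim
    case (elim \<epsilon>)
    have "derivs_bounded K J (2 ^ J * ((C * \<epsilon> powr e) * (D * \<epsilon> powr e'))) (\<lambda>x. u \<epsilon> x * v \<epsilon> x)"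
      by (rule derivs_bounded_mult_on[OF \<Omega> _ _ elim(1,2)]) (use s elim(3) in auto)
    moreover have "2 ^ J * ((C * \<epsilon> powr e) * (D * \<epsilon> powr e')) = (2 ^ J * (C * D)) * \<epsilon> powr (e + e')"
      by (simp add: powr_add)
    ultimately show ?case by simp
  qed
  from net_growthI[OF _ this] show ?thesis using C(1) D(1) by simp
qed

lemma net_growth_cmult:
  assumes \<Omega>: "open \<Omega>" "K \<subseteq> \<Omega>" and s: "smooth_net \<Omega> u" and g: "net_growth K J e u"
  shows "net_growth K J e (\<lambda>\<epsilon> x. c * u \<epsilon> x)"
proof -
  obtain C where C: "C \<ge> 0" "\<forall>\<^sub>F \<epsilon> in at_right 0. derivs_bounded K J (C * \<epsilon> powr e) (u \<epsilon>)"
    using net_growthE[OF g] .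
  have "\<forall>\<^sub>F \<epsilon> in at_right 0. derivs_bounded K J ((cmod c * C) * \<epsilon> powr e) (\<lambda>x. c * u \<epsilon> x)"
    using C(2) eventually_unit
    by eventually_elim (use derivs_bounded_cmult[OF \<Omega>] s in \<open>simp add: mult.assoc\<close>)
  from net_growthI[OF _ this] show ?thesis using C(1) by simp
qed

lemma smooth_net_cmult: "open \<Omega> \<Longrightarrow> smooth_net \<Omega> u \<Longrightarrow> smooth_net \<Omega> (\<lambda>\<epsilon> x. c * u \<epsilon> x)"
  using smooth_on_mult[OF _ smooth_on_const] by blast

lemma net_growth_diff:
  assumes \<Omega>: "open \<Omega>" "K \<subseteq> \<Omega>" and s: "smooth_net \<Omega> u" "smooth_net \<Omega> v" and g: "net_growth K J e u" "net_growth K J e v"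
  shows "net_growth K J e (\<lambda>\<epsilon> x. u \<epsilon> x - v \<epsilon> x)"
  using net_growth_add[OF \<Omega> s(1) smooth_net_cmult[OF \<Omega>(1) s(2), of "-1"] g(1) net_growth_cmult[OF \<Omega> s(2) g(2), of "-1"]]
  by simp

lemma net_growth_sum:
  assumes \<Omega>: "open \<Omega>" "K \<subseteq> \<Omega>" and "finite A" "\<And>a. a \<in> A \<Longrightarrow> smooth_net \<Omega> (u a)" "\<And>a. a \<in> A \<Longrightarrow> net_growth K J e (u a)"
  shows "net_growth K J e (\<lambda>\<epsilon> x. \<Sum>a\<in>A. u a \<epsilon> x)"
  using assms(3-)
proof (induction A rule: finite_induct)
  case empty
  show ?case using net_growth_zero by simp
next
  case (insert a A)
  have "smooth_net \<Omega> (\<lambda>\<epsilon> x. \<Sum>a\<in>A. u a \<epsilon> x)" using insert.prems by (auto intro!: smooth_on_sum \<Omega>)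
  then show ?case using insert net_growth_add[OF \<Omega>, of "u a" "\<lambda>\<epsilon> x. \<Sum>a\<in>A. u a \<epsilon> x"] by simp
qed

lemma net_growth_sum_ex:
  assumes \<Omega>: "open \<Omega>" "K \<subseteq> \<Omega>" and A: "finite A" "\<And>a. a \<in> A \<Longrightarrow> smooth_net \<Omega> (u a)"
    and ex: "\<And>a. a \<in> A \<Longrightarrow> \<exists>e. net_growth K J e (u a)"
  shows "\<exists>e. net_growth K J e (\<lambda>\<epsilon> x. \<Sum>a\<in>A. u a \<epsilon> x)"
proof -
  obtain e where e: "\<And>a. a \<in> A \<Longrightarrow> net_growth K J (e a) (u a)" using ex by metis
  have g: "net_growth K J (- (\<Sum>a\<in>A. \<bar>e a\<bar>)) (u a)" if "a \<in> A" for a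
  proof -
    have "\<bar>e a\<bar> \<le> (\<Sum>a\<in>A. \<bar>e a\<bar>)" using that A(1) by (intro member_le_sum) auto
    then show ?thesis by (intro net_growth_mono[OF e[OF that]]) auto
  qed
  show ?thesis by (rule exI, rule net_growth_sum[OF \<Omega> A(1)]) (fact A(2) g)+
qed

lemma net_growth_mpartial:
  assumes "net_growth K (J + mi_order \<alpha>) e u"
  shows "net_growth K J e (\<lambda>\<epsilon>. mpartial \<alpha> (u \<epsilon>))"
proof -
  obtain "is" where "is": "mpartial \<alpha> = foldr partial is" "length is = mi_order \<alpha>"
    using mpartial_list[of \<alpha>] by metis
  obtain C where C: "C \<ge> 0" "\<forall>\<^sub>F \<epsilon> in at_right 0. derivs_bounded K (J + length is) (C * \<epsilon> powr e) (u \<epsilon>)"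
    using net_growthE[OF assms[folded "is"(2)]] .
  have "\<forall>\<^sub>F \<epsilon> in at_right 0. derivs_bounded K J (C * \<epsilon> powr e) (foldr partial is (u \<epsilon>))"
    using C(2) by eventually_elim (rule derivs_bounded_foldr_partial)
  then show ?thesis unfolding "is" by (rule net_growthI[OF C(1)])
qed

lemma smooth_net_Dpartial: "open \<Omega> \<Longrightarrow> smooth_net \<Omega> u \<Longrightarrow> smooth_net \<Omega> (\<lambda>\<epsilon>. Dpartial \<alpha> (u \<epsilon>))"
  unfolding Dpartial_def using smooth_on_mult[OF _ smooth_on_const smooth_on_mpartial] by blast

lemma net_growth_Dpartial:
  assumes \<Omega>: "open \<Omega>" "K \<subseteq> \<Omega>" "smooth_net \<Omega> u" and g: "net_growth K (J + mi_order \<alpha>) e u"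
  shows "net_growth K J e (\<lambda>\<epsilon>. Dpartial \<alpha> (u \<epsilon>))"
  unfolding Dpartial_def
  by (rule net_growth_cmult[OF \<Omega>(1,2) _ net_growth_mpartial[OF g]]) (use \<Omega>(3) smooth_on_mpartial in blast)

lemma compact_seminorm_upper:
  assumes "f \<in> smooth_on \<Omega>" "compact K" "K \<subseteq> \<Omega>" "x \<in> K"
  shows "cmod (mpartial \<alpha> f x) \<le> compact_seminorm K \<alpha> f"
proof -
  have "continuous_on K (\<lambda>x. cmod (mpartial \<alpha> f x))"
    using smooth_on_continuous[OF smooth_on_mpartial[OF assms(1)], of "[]"] assms(3)
    by (auto intro!: continuous_on_norm intro: continuous_on_subset)
  then have "bdd_above ((\<lambda>x. cmod (mpartial \<alpha> f x)) ` K)"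
    using assms(2) by (intro bounded_imp_bdd_above compact_imp_bounded compact_continuous_image)
  then show ?thesis unfolding compact_seminorm_def using assms(4) by (rule cSUP_upper[rotated])
qed

lemma compact_seminorm_nonneg:
  assumes "f \<in> smooth_on \<Omega>" "compact K" "K \<subseteq> \<Omega>" "K \<noteq> {}"
  shows "0 \<le> compact_seminorm K \<alpha> f"
  using compact_seminorm_upper[OF assms(1-3)] assms(4) by (meson all_not_in_conv norm_ge_zero order_trans)

lemma net_growth_imp_bigo:
  assumes K: "compact K" "K \<subseteq> \<Omega>" "K \<noteq> {}" and u: "smooth_net \<Omega> u" and g: "net_growth K J e u" "mi_order \<alpha> \<le> J"
  shows "(\<lambda>\<epsilon>. compact_seminorm K \<alpha> (u \<epsilon>)) \<in> O[at_right 0](\<lambda>\<epsilon>. \<epsilon> powr e)"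
proof -
  obtain "is" where "is": "mpartial \<alpha> = foldr partial is" "length is = mi_order \<alpha>"
    using mpartial_list[of \<alpha>] by metis
  obtain C where C: "C \<ge> 0" "\<forall>\<^sub>F \<epsilon> in at_right 0. derivs_bounded K J (C * \<epsilon> powr e) (u \<epsilon>)"
    using net_growthE[OF g(1)] .
  have "\<forall>\<^sub>F \<epsilon> in at_right 0. norm (compact_seminorm K \<alpha> (u \<epsilon>)) \<le> C * norm (\<epsilon> powr e)"
    using C(2) eventually_unit
  proof eventually_elim
    case (elim \<epsilon>)
    have "compact_seminorm K \<alpha> (u \<epsilon>) \<le> C * \<epsilon> powr e"
      unfolding compact_seminorm_def "is"(1)
      by (rule cSUP_least[OF K(3)]) (use elim(1) g(2) "is"(2) in \<open>auto simp: derivs_bounded_def\<close>)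
    then show ?case using compact_seminorm_nonneg[OF _ K, of "u \<epsilon>" \<alpha>] u elim(2) by simp
  qed
  then show ?thesis by (rule bigoI)
qed

lemma net_growth_of_bigo:
  fixes u :: "'n::finite cfun net"
  assumes bd: "\<And>\<alpha> \<epsilon> x. mi_order \<alpha> \<le> J \<Longrightarrow> \<epsilon> \<in> {0<..1} \<Longrightarrow> x \<in> K \<Longrightarrow> cmod (mpartial \<alpha> (u \<epsilon>) x) \<le> p \<alpha> (u \<epsilon>)"
    and \<Omega>: "open \<Omega>" "K \<subseteq> \<Omega>" and u: "smooth_net \<Omega> u"
    and O: "\<And>\<alpha>. mi_order \<alpha> \<le> J \<Longrightarrow> (\<lambda>\<epsilon>. p \<alpha> (u \<epsilon>)) \<in> O[at_right 0](\<lambda>\<epsilon>. \<epsilon> powr e)"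
  shows "net_growth K J e u"
proof -
  define A where "A = {\<alpha> :: 'n multiindex. mi_order \<alpha> \<le> J}"
  have A: "finite A" unfolding A_def by (rule finite_mi_order)
  have "\<exists>c>0. \<forall>\<^sub>F \<epsilon> in at_right 0. norm (p \<alpha> (u \<epsilon>)) \<le> c * norm (\<epsilon> powr e)" if "\<alpha> \<in> A" for \<alpha>
    using O[of \<alpha>] that landau_o.bigE unfolding A_def by blast
  then obtain c where c: "\<And>\<alpha>. \<alpha> \<in> A \<Longrightarrow> c \<alpha> > 0 \<and> (\<forall>\<^sub>F \<epsilon> in at_right 0. norm (p \<alpha> (u \<epsilon>)) \<le> c \<alpha> * norm (\<epsilon> powr e))"
    by metis
  have ev: "\<forall>\<^sub>F \<epsilon> in at_right 0. \<forall>\<alpha>\<in>A. norm (p \<alpha> (u \<epsilon>)) \<le> c \<alpha> * norm (\<epsilon> powr e)"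
    using c by (intro eventually_ball_finite A) auto
  have "\<forall>\<^sub>F \<epsilon> in at_right 0. derivs_bounded K J ((\<Sum>\<alpha>\<in>A. \<bar>c \<alpha>\<bar>) * \<epsilon> powr e) (u \<epsilon>)"
    using ev eventually_unit
  proof eventually_elim
    case (elim \<epsilon>)
    show ?case unfolding derivs_bounded_def
    proof (intro allI impI ballI)
      fix "is" :: "'n list" and x assume *: "length is \<le> J" "x \<in> K"
      then have a: "count_list is \<in> A" by (simp add: A_def mi_order_count_list)
      have "cmod (foldr partial is (u \<epsilon>) x) = cmod (mpartial (count_list is) (u \<epsilon>) x)"
        using mpartial_count_list[of "u \<epsilon>" \<Omega> x "is"] u elim(2) \<Omega> * by auto
      also have "\<dots> \<le> p (count_list is) (u \<epsilon>)" using a * elim(2) by (intro bd) (auto simp: A_def)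
      also have "\<dots> \<le> c (count_list is) * \<epsilon> powr e" using elim(1) a by fastforce
      also have "\<dots> \<le> (\<Sum>\<alpha>\<in>A. \<bar>c \<alpha>\<bar>) * \<epsilon> powr e"
        by (intro mult_right_mono order_trans[OF abs_ge_self member_le_sum[of _ A "\<lambda>\<alpha>. \<bar>c \<alpha>\<bar>"]] a A) auto
      finally show "cmod (foldr partial is (u \<epsilon>) x) \<le> (\<Sum>\<alpha>\<in>A. \<bar>c \<alpha>\<bar>) * \<epsilon> powr e" .
    qed
  qed
  then show ?thesis by (rule net_growthI[rotated]) (simp add: sum_nonneg)
qed

lemma powr_bigo_mono:
  assumes "e' \<le> e"
  shows "(\<lambda>\<epsilon>. \<epsilon> powr e) \<in> O[at_right 0](\<lambda>\<epsilon>. \<epsilon> powr (e' :: real))"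
proof (rule bigoI[of _ 1])
  show "\<forall>\<^sub>F \<epsilon> in at_right 0. norm (\<epsilon> powr e) \<le> 1 * norm (\<epsilon> powr e')"
    using eventually_unit by eventually_elim (use assms in \<open>simp add: powr_mono'\<close>)
qed

lemma power_bigo_powr: "(\<lambda>\<epsilon>::real. \<epsilon> ^ q) \<in> O[at_right 0](\<lambda>\<epsilon>. \<epsilon> powr real q)"
    "(\<lambda>\<epsilon>::real. \<epsilon> powr real q) \<in> O[at_right 0](\<lambda>\<epsilon>. \<epsilon> ^ q)"
proof -
  have "\<forall>\<^sub>F \<epsilon> in at_right (0::real). \<epsilon> ^ q = \<epsilon> powr real q"
    using eventually_unit by eventually_elim (simp add: powr_realpow)
  then have "\<forall>\<^sub>F \<epsilon> in at_right (0::real). norm (\<epsilon> ^ q) \<le> 1 * norm (\<epsilon> powr real q)"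
    "\<forall>\<^sub>F \<epsilon> in at_right (0::real). norm (\<epsilon> powr real q) \<le> 1 * norm (\<epsilon> ^ q)"
    by (eventually_elim; simp)+
  then show "(\<lambda>\<epsilon>::real. \<epsilon> ^ q) \<in> O[at_right 0](\<lambda>\<epsilon>. \<epsilon> powr real q)"
    "(\<lambda>\<epsilon>::real. \<epsilon> powr real q) \<in> O[at_right 0](\<lambda>\<epsilon>. \<epsilon> ^ q)" by (blast intro: bigoI)+
qed

lemma power_bigo_powr_ceiling: "(\<lambda>\<epsilon>::real. \<epsilon> ^ nat \<lceil>e\<rceil>) \<in> O[at_right 0](\<lambda>\<epsilon>. \<epsilon> powr e)"
  by (rule landau_o.big.trans[OF power_bigo_powr(1) powr_bigo_mono]) linarith

lemma moderate_finite_bigo: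
  assumes "finite A" "\<And>\<alpha>. \<alpha> \<in> A \<Longrightarrow> \<exists>N::nat. h \<alpha> \<in> O[at_right 0](\<lambda>\<epsilon>. \<epsilon> powr (- real N))"
  shows "\<exists>e::real. \<forall>\<alpha>\<in>A. h \<alpha> \<in> O[at_right 0](\<lambda>\<epsilon>. \<epsilon> powr e)"
proof -
  obtain N :: "_ \<Rightarrow> nat" where N: "\<And>\<alpha>. \<alpha> \<in> A \<Longrightarrow> h \<alpha> \<in> O[at_right 0](\<lambda>\<epsilon>. \<epsilon> powr (- real (N \<alpha>)))"
    using assms(2) by metis
  have "h \<alpha> \<in> O[at_right 0](\<lambda>\<epsilon>. \<epsilon> powr (- real (sum N A)))" if "\<alpha> \<in> A" for \<alpha>
  proof -
    have "N \<alpha> \<le> sum N A" using that assms(1) by (intro member_le_sum) auto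
    then show ?thesis by (intro landau_o.big.trans[OF N[OF that] powr_bigo_mono]) (simp del: of_nat_sum)
  qed
  then show ?thesis by blast
qed

abbreviation moderate_gf :: "(real^'n::finite) set \<Rightarrow> 'n cfun net set" where
  "moderate_gf \<Omega> \<equiv> moderate_nets (smooth_on \<Omega>) (smooth_seminorms \<Omega>)"

lemma moderate_iff:
  fixes u :: "'n::finite cfun net"
  assumes \<Omega>: "open \<Omega>"
  shows "u \<in> moderate_gf \<Omega> \<longleftrightarrow>
    smooth_net \<Omega> u \<and> (\<forall>K J. compact K \<longrightarrow> K \<subseteq> \<Omega> \<longrightarrow> (\<exists>e. net_growth K J e u))" (is "?l \<longleftrightarrow> ?r")
proof
  assume l: ?l
  then have s: "smooth_net \<Omega> u" by (simp add: moderate_nets_def)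
  have "\<exists>e. net_growth K J e u" if K: "compact K" "K \<subseteq> \<Omega>" for K J
  proof (cases "K = {}")
    case False
    have "\<exists>N::nat. (\<lambda>\<epsilon>. compact_seminorm K \<alpha> (u \<epsilon>)) \<in> O[at_right 0](\<lambda>\<epsilon>. \<epsilon> powr (- real N))" for \<alpha>
      using l K False unfolding moderate_nets_def smooth_seminorms_def by blast
    then obtain e where e: "\<forall>\<alpha>\<in>{\<alpha>. mi_order \<alpha> \<le> J}. (\<lambda>\<epsilon>. compact_seminorm K \<alpha> (u \<epsilon>)) \<in> O[at_right 0](\<lambda>\<epsilon>. \<epsilon> powr e)"
      using moderate_finite_bigo[OF finite_mi_order, of J "\<lambda>\<alpha> \<epsilon>. compact_seminorm K \<alpha> (u \<epsilon>)"] by blast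
    have "net_growth K J e u"
      by (rule net_growth_of_bigo[where p = "compact_seminorm K", OF _ \<Omega> K(2) s])
         (use compact_seminorm_upper[OF _ K] s e in auto)
    then show ?thesis ..
  qed simp
  then show ?r using s by blast
next
  assume r: ?r
  have "\<exists>N::nat. (\<lambda>\<epsilon>. compact_seminorm K \<alpha> (u \<epsilon>)) \<in> O[at_right 0](\<lambda>\<epsilon>. \<epsilon> powr (- real N))"
    if K: "compact K" "K \<noteq> {}" "K \<subseteq> \<Omega>" for K \<alpha>
  proof -
    obtain e where "net_growth K (mi_order \<alpha>) e u" using r K by blast
    from net_growth_imp_bigo[OF K(1,3,2) _ this order_refl] r
    have "(\<lambda>\<epsilon>. compact_seminorm K \<alpha> (u \<epsilon>)) \<in> O[at_right 0](\<lambda>\<epsilon>. \<epsilon> powr e)" by blast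
    moreover have "- real (nat \<lceil>- e\<rceil>) \<le> e" by linarith
    ultimately have "(\<lambda>\<epsilon>. compact_seminorm K \<alpha> (u \<epsilon>)) \<in> O[at_right 0](\<lambda>\<epsilon>. \<epsilon> powr (- real (nat \<lceil>- e\<rceil>)))"
      by (rule landau_o.big.trans[OF _ powr_bigo_mono])
    then show ?thesis ..
  qed
  then show ?l using r unfolding moderate_nets_def smooth_seminorms_def by blast
qed

lemma negligible_iff:
  fixes u :: "'n::finite cfun net"
  assumes \<Omega>: "open \<Omega>"
  shows "u \<in> negligible_nets (smooth_on \<Omega>) (smooth_seminorms \<Omega>) \<longleftrightarrow>
    smooth_net \<Omega> u \<and> (\<forall>K J e. compact K \<longrightarrow> K \<subseteq> \<Omega> \<longrightarrow> net_growth K J e u)" (is "?l \<longleftrightarrow> ?r")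
proof
  assume l: ?l
  then have s: "smooth_net \<Omega> u" by (simp add: negligible_nets_def)
  have "net_growth K J e u" if K: "compact K" "K \<subseteq> \<Omega>" for K J e
  proof (cases "K = {}")
    case False
    have "(\<lambda>\<epsilon>. compact_seminorm K \<alpha> (u \<epsilon>)) \<in> O[at_right 0](\<lambda>\<epsilon>. \<epsilon> powr e)" for \<alpha>
    proof -
      have "(\<lambda>\<epsilon>. compact_seminorm K \<alpha> (u \<epsilon>)) \<in> O[at_right 0](\<lambda>\<epsilon>. \<epsilon> ^ nat \<lceil>e\<rceil>)"
        using l K False unfolding negligible_nets_def smooth_seminorms_def by blast
      then show ?thesis by (rule landau_o.big.trans[OF _ power_bigo_powr_ceiling])
    qed
    then show ?thesis
      by (intro net_growth_of_bigo[where p = "compact_seminorm K", OF _ \<Omega> K(2) s])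
         (use compact_seminorm_upper[OF _ K] s in auto)
  qed simp
  then show ?r using s by blast
next
  assume r: ?r
  have "(\<lambda>\<epsilon>. compact_seminorm K \<alpha> (u \<epsilon>)) \<in> O[at_right 0](\<lambda>\<epsilon>. \<epsilon> ^ q)"
    if K: "compact K" "K \<noteq> {}" "K \<subseteq> \<Omega>" for K \<alpha> q
  proof -
    have "net_growth K (mi_order \<alpha>) (real q) u" using r K by blast
    from net_growth_imp_bigo[OF K(1,3,2) _ this order_refl] r
    have "(\<lambda>\<epsilon>. compact_seminorm K \<alpha> (u \<epsilon>)) \<in> O[at_right 0](\<lambda>\<epsilon>. \<epsilon> powr real q)" by blast
    then show ?thesis by (rule landau_o.big.trans[OF _ power_bigo_powr(2)])
  qed
  then show ?l using r unfolding negligible_nets_def smooth_seminorms_def by blast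
qed

lemma gf_rel_iff:
  assumes "open \<Omega>"
  shows "(u, v) \<in> gf_rel \<Omega> \<longleftrightarrow> u \<in> moderate_gf \<Omega> \<and> v \<in> moderate_gf \<Omega> \<and>
    (\<forall>K J e. compact K \<longrightarrow> K \<subseteq> \<Omega> \<longrightarrow> net_growth K J e (\<lambda>\<epsilon> x. u \<epsilon> x - v \<epsilon> x))"
proof -
  have m: "(\<lambda>\<epsilon>. u \<epsilon> - v \<epsilon>) = (\<lambda>\<epsilon> x. u \<epsilon> x - v \<epsilon> x)" by (simp add: fun_eq_iff)
  have "smooth_net \<Omega> (\<lambda>\<epsilon> x. u \<epsilon> x - v \<epsilon> x)" if "u \<in> moderate_gf \<Omega>" "v \<in> moderate_gf \<Omega>"
    using that by (auto simp: moderate_iff[OF assms] intro!: smooth_on_diff assms)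
  then show ?thesis unfolding gf_rel_def colombeau_rel_def by (auto simp: m negligible_iff[OF assms] fun_diff_def)
qed

lemma moderate_smooth: "u \<in> moderate_gf \<Omega> \<Longrightarrow> smooth_net \<Omega> u"
  by (simp add: moderate_nets_def)

lemma gf_rel_refl:
  assumes "open \<Omega>" "u \<in> moderate_gf \<Omega>"
  shows "(u, u) \<in> gf_rel \<Omega>"
  using assms by (simp add: gf_rel_iff net_growth_zero)

lemma gf_rel_sym:
  assumes \<Omega>: "open \<Omega>" and uv: "(u, v) \<in> gf_rel \<Omega>"
  shows "(v, u) \<in> gf_rel \<Omega>"
proof -
  note r = uv[unfolded gf_rel_iff[OF \<Omega>]]
  have "net_growth K J e (\<lambda>\<epsilon> x. v \<epsilon> x - u \<epsilon> x)" if K: "compact K" "K \<subseteq> \<Omega>" for K J e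
  proof -
    have "smooth_net \<Omega> (\<lambda>\<epsilon> x. u \<epsilon> x - v \<epsilon> x)" using r moderate_smooth by (auto intro!: smooth_on_diff \<Omega>)
    from net_growth_cmult[OF \<Omega> K(2) this, of J e "-1"] r K show ?thesis by simp
  qed
  then show ?thesis using r by (simp add: gf_rel_iff[OF \<Omega>])
qed

lemma gf_rel_trans:
  assumes \<Omega>: "open \<Omega>" and uv: "(u, v) \<in> gf_rel \<Omega>" and vw: "(v, w) \<in> gf_rel \<Omega>"
  shows "(u, w) \<in> gf_rel \<Omega>"
proof -
  note r = uv[unfolded gf_rel_iff[OF \<Omega>]] vw[unfolded gf_rel_iff[OF \<Omega>]]
  have "net_growth K J e (\<lambda>\<epsilon> x. u \<epsilon> x - w \<epsilon> x)" if K: "compact K" "K \<subseteq> \<Omega>" for K J e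
  proof -
    have "smooth_net \<Omega> (\<lambda>\<epsilon> x. u \<epsilon> x - v \<epsilon> x)" "smooth_net \<Omega> (\<lambda>\<epsilon> x. v \<epsilon> x - w \<epsilon> x)"
      using r moderate_smooth by (auto intro!: smooth_on_diff \<Omega>)
    from net_growth_add[OF \<Omega> K(2) this, of J e] r K show ?thesis by simp
  qed
  then show ?thesis using r by (simp add: gf_rel_iff[OF \<Omega>])
qed

lemma gf_class:
  assumes \<Omega>: "open \<Omega>" and U: "U \<in> gf \<Omega>"
  shows "\<exists>u. u \<in> U" and "u \<in> U \<Longrightarrow> u \<in> moderate_gf \<Omega>" and "u \<in> U \<Longrightarrow> v \<in> U \<Longrightarrow> (u, v) \<in> gf_rel \<Omega>"
proof -
  obtain w where w: "w \<in> moderate_gf \<Omega>" "U = gf_rel \<Omega> `` {w}"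
    using U unfolding gf_def colombeau_def gf_rel_def by (rule quotientE)
  show "\<exists>u. u \<in> U" using gf_rel_refl[OF \<Omega> w(1)] w(2) by blast
  show "u \<in> moderate_gf \<Omega>" if "u \<in> U" using that unfolding w(2) by (auto simp: gf_rel_iff[OF \<Omega>])
  show "(u, v) \<in> gf_rel \<Omega>" if "u \<in> U" "v \<in> U"
    using that unfolding w(2) by (auto intro: gf_rel_trans[OF \<Omega> gf_rel_sym[OF \<Omega>]])
qed

lemma gf_classI:
  assumes "u \<in> moderate_gf \<Omega>"
  shows "gf_rel \<Omega> `` {u} \<in> gf \<Omega>"
  using assms unfolding gf_def colombeau_def gf_rel_def by (rule quotientI)

lemma union_of_equal_classes:
  assumes \<Omega>: "open \<Omega>" and "v0 \<in> S" "\<And>v. v \<in> S \<Longrightarrow> (v0, v) \<in> gf_rel \<Omega>"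
  shows "(\<Union>v\<in>S. gf_rel \<Omega> `` {v}) = gf_rel \<Omega> `` {v0}"
  using assms gf_rel_trans[OF \<Omega>] by blast

lemma class_eqI:
  assumes \<Omega>: "open \<Omega>" and "(u, v) \<in> gf_rel \<Omega>"
  shows "gf_rel \<Omega> `` {u} = gf_rel \<Omega> `` {v}"
  using gf_rel_trans[OF \<Omega>] gf_rel_sym[OF \<Omega>] assms(2) by blast

lemma restrict_smooth_mult:
  fixes \<phi> :: "'n::finite cfun"
  assumes \<Omega>: "open \<Omega>" and \<phi>: "\<phi> \<in> smooth_on UNIV" and fg: "(f, g) \<in> gf_rel UNIV"
  shows "((\<lambda>\<epsilon> x. \<phi> x * f \<epsilon> x), (\<lambda>\<epsilon> x. \<phi> x * g \<epsilon> x)) \<in> gf_rel \<Omega>"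
proof -
  note r = fg[unfolded gf_rel_iff[OF open_UNIV] moderate_iff[OF open_UNIV]]
  have \<phi>n: "smooth_net UNIV (\<lambda>\<epsilon>. \<phi>)" using \<phi> by blast
  have \<phi>g: "net_growth K J 0 (\<lambda>\<epsilon>. \<phi>)" if K: "compact K" for K J
  proof -
    obtain B where "B \<ge> 0" "derivs_bounded K J B \<phi>" using derivs_bounded_compact[OF \<phi> K subset_UNIV] .
    moreover have "\<forall>\<^sub>F \<epsilon> in at_right 0. derivs_bounded K J (B * \<epsilon> powr 0) \<phi>"
      using eventually_unit by eventually_elim (use calculation in simp)
    ultimately show ?thesis by (intro net_growthI)
  qed
  have m: "(\<lambda>\<epsilon> x. \<phi> x * h \<epsilon> x) \<in> moderate_gf \<Omega>"
    if sh: "smooth_net UNIV h" and gh: "\<forall>K J. compact K \<longrightarrow> K \<subseteq> UNIV \<longrightarrow> (\<exists>e. net_growth K J e h)" for h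
    unfolding moderate_iff[OF \<Omega>]
  proof (intro conjI allI impI)
    show "smooth_net \<Omega> (\<lambda>\<epsilon> x. \<phi> x * h \<epsilon> x)"
      using sh by (auto intro!: smooth_on_subset[OF smooth_on_mult[OF open_UNIV \<phi>]])
    fix K :: "(real^'n) set" and J assume K: "compact K" "K \<subseteq> \<Omega>"
    then obtain e where "net_growth K J e h" using gh by blast
    then show "\<exists>e. net_growth K J e (\<lambda>\<epsilon> x. \<phi> x * h \<epsilon> x)"
      using net_growth_mult[OF open_UNIV subset_UNIV \<phi>n sh \<phi>g[OF K(1)]] by blast
  qed
  have "net_growth K J e (\<lambda>\<epsilon> x. \<phi> x * f \<epsilon> x - \<phi> x * g \<epsilon> x)" if K: "compact K" "K \<subseteq> \<Omega>" for K J e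
  proof -
    have s: "smooth_net UNIV (\<lambda>\<epsilon> x. f \<epsilon> x - g \<epsilon> x)" using r by (auto intro!: smooth_on_diff)
    have "net_growth K J e (\<lambda>\<epsilon> x. f \<epsilon> x - g \<epsilon> x)" using r K by blast
    from net_growth_mult[OF open_UNIV subset_UNIV \<phi>n s \<phi>g[OF K(1)] this]
    show ?thesis by (simp add: right_diff_distrib)
  qed
  then show ?thesis using m r by (simp add: gf_rel_iff[OF \<Omega>])
qed

lemma mult_restrict_class:
  assumes \<Omega>: "open \<Omega>" and \<phi>: "\<phi> \<in> smooth_on UNIV" and F: "F \<in> gf UNIV" "f \<in> F"
  shows "mult_restrict \<Omega> \<phi> F = gf_rel \<Omega> `` {\<lambda>\<epsilon> x. \<phi> x * f \<epsilon> x}"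
proof -
  have "mult_restrict \<Omega> \<phi> F = (\<Union>v\<in>(\<lambda>f \<epsilon> x. \<phi> x * f \<epsilon> x) ` F. gf_rel \<Omega> `` {v})"
    by (simp add: mult_restrict_def)
  also have "\<dots> = gf_rel \<Omega> `` {\<lambda>\<epsilon> x. \<phi> x * f \<epsilon> x}"
    by (rule union_of_equal_classes[OF \<Omega>])
       (use F restrict_smooth_mult[OF \<Omega> \<phi> gf_class(3)[OF open_UNIV F(1,2)]] in auto)
  finally show ?thesis .
qed

lemma sobolev_net_growth:
  assumes u: "\<forall>\<epsilon>\<in>{0<..1}. u \<epsilon> \<in> sobolev_infty_all"
    and O: "(\<lambda>\<epsilon>. sobolev_infty_norm J (u \<epsilon>)) \<in> O[at_right 0](\<lambda>\<epsilon>. \<epsilon> powr e)"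
  shows "net_growth K J e u"
proof (rule net_growth_of_bigo[where p = "\<lambda>\<alpha>. sobolev_infty_norm J", OF _ open_UNIV subset_UNIV _ O])
  show "cmod (mpartial \<alpha> (u \<epsilon>) x) \<le> sobolev_infty_norm J (u \<epsilon>)"
    if "mi_order \<alpha> \<le> J" "\<epsilon> \<in> {0<..1}" for \<alpha> \<epsilon> x
    using u that by (intro sobolev_infty_norm_bound) auto
  show "smooth_net UNIV u" using u by (auto simp: sobolev_infty_all_def)
qed

lemma gf_infty_class:
  assumes c: "c \<in> gf_infty" and C: "C \<in> c"
  shows "smooth_net UNIV C" and "\<exists>e. net_growth K J e C"
    and "C' \<in> c \<Longrightarrow> net_growth K J e (\<lambda>\<epsilon> x. C \<epsilon> x - C' \<epsilon> x)"
proof -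
  obtain w where w: "c = colombeau_rel sobolev_infty_all (range sobolev_infty_norm) `` {w}"
    using c unfolding gf_infty_def colombeau_def by (rule quotientE)
  have mod: "\<forall>\<epsilon>\<in>{0<..1}. A \<epsilon> \<in> sobolev_infty_all" "\<exists>N::nat. (\<lambda>\<epsilon>. sobolev_infty_norm J (A \<epsilon>)) \<in> O[at_right 0](\<lambda>\<epsilon>. \<epsilon> powr (- real N))"
    if "A \<in> moderate_nets sobolev_infty_all (range sobolev_infty_norm)" for A J
    using that unfolding moderate_nets_def by blast+
  have sm: "smooth_net UNIV A" if "A \<in> moderate_nets sobolev_infty_all (range sobolev_infty_norm)" for A
    using mod(1)[OF that] by (auto simp: sobolev_infty_all_def)
  have in_mod: "w \<in> moderate_nets sobolev_infty_all (range sobolev_infty_norm)" "A \<in> moderate_nets sobolev_infty_all (range sobolev_infty_norm)"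
    and neg: "(\<lambda>\<epsilon>. w \<epsilon> - A \<epsilon>) \<in> negligible_nets sobolev_infty_all (range sobolev_infty_norm)"
    if "A \<in> c" for A
    using that unfolding w colombeau_rel_def by auto
  show "smooth_net UNIV C" using sm in_mod C by blast
  show "\<exists>e. net_growth K J e C"
    using sobolev_net_growth[OF mod(1)[OF in_mod(2)[OF C]]] mod(2)[OF in_mod(2)[OF C]] by blast
  have wg: "net_growth K J e (\<lambda>\<epsilon> x. w \<epsilon> x - A \<epsilon> x)" if "A \<in> c" for A K J e
  proof -
    have m: "(\<lambda>\<epsilon>. w \<epsilon> - A \<epsilon>) = (\<lambda>\<epsilon> x. w \<epsilon> x - A \<epsilon> x)" by (simp add: fun_eq_iff)
    have "(\<lambda>\<epsilon>. sobolev_infty_norm J (w \<epsilon> - A \<epsilon>)) \<in> O[at_right 0](\<lambda>\<epsilon>. \<epsilon> ^ nat \<lceil>e\<rceil>)"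
      using neg[OF that] unfolding negligible_nets_def by blast
    then have "(\<lambda>\<epsilon>. sobolev_infty_norm J (w \<epsilon> - A \<epsilon>)) \<in> O[at_right 0](\<lambda>\<epsilon>. \<epsilon> powr e)"
      by (rule landau_o.big.trans[OF _ power_bigo_powr_ceiling])
    then show ?thesis unfolding m[symmetric]
      by (intro sobolev_net_growth) (use neg[OF that] in \<open>auto simp: negligible_nets_def\<close>)
  qed
  show "net_growth K J e (\<lambda>\<epsilon> x. C \<epsilon> x - C' \<epsilon> x)" if "C' \<in> c"
  proof -
    have "smooth_net UNIV (\<lambda>\<epsilon> x. w \<epsilon> x - A \<epsilon> x)" if "A \<in> c" for A
      using sm[OF in_mod(1)[OF that]] sm[OF in_mod(2)[OF that]] by (auto intro!: smooth_on_diff)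
    from net_growth_diff[OF open_UNIV subset_UNIV this[OF \<open>C' \<in> c\<close>] this[OF C] wg[OF \<open>C' \<in> c\<close>] wg[OF C]]
    show ?thesis by simp
  qed
qed

context
  fixes c :: "'n::finite multiindex \<Rightarrow> 'n cfun net set" and m :: nat and \<Omega> :: "(real^'n) set"
  assumes coeffs: "\<And>\<alpha>. mi_order \<alpha> \<le> m \<Longrightarrow> c \<alpha> \<in> gf_infty" and \<Omega>: "open \<Omega>"
begin

lemma coeff_smooth:
  assumes "coeff_representative m c C" "mi_order \<alpha> \<le> m"
  shows "smooth_net \<Omega> (C \<alpha>)"
  using gf_infty_class(1)[OF coeffs[OF assms(2)], of "C \<alpha>"] assms smooth_on_subset[OF _ subset_UNIV]
  unfolding coeff_representative_def by blast

lemma apply_op_rep_smooth: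
  assumes C: "coeff_representative m c C" and u: "smooth_net \<Omega> u"
  shows "smooth_net \<Omega> (apply_op_rep m C u)"
  unfolding apply_op_rep_def
  using coeff_smooth[OF C] smooth_net_Dpartial[OF \<Omega> u]
  by (auto intro!: smooth_on_sum smooth_on_mult \<Omega>)

lemma apply_op_rep_moderate:
  assumes C: "coeff_representative m c C" and u: "u \<in> moderate_gf \<Omega>"
  shows "apply_op_rep m C u \<in> moderate_gf \<Omega>"
  unfolding moderate_iff[OF \<Omega>]
proof (intro conjI allI impI apply_op_rep_smooth[OF C moderate_smooth[OF u]])
  fix K :: "(real^'n) set" and J assume K: "compact K" "K \<subseteq> \<Omega>"
  show "\<exists>e. net_growth K J e (apply_op_rep m C u)"
    unfolding apply_op_rep_def
  proof (rule net_growth_sum_ex[OF \<Omega> K(2) finite_mi_order])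
    fix \<alpha> :: "'n multiindex" assume "\<alpha> \<in> {\<alpha>. mi_order \<alpha> \<le> m}"
    then have \<alpha>: "mi_order \<alpha> \<le> m" by simp
    show "smooth_net \<Omega> (\<lambda>\<epsilon> x. C \<alpha> \<epsilon> x * Dpartial \<alpha> (u \<epsilon>) x)"
      using coeff_smooth[OF C \<alpha>] smooth_net_Dpartial[OF \<Omega> moderate_smooth[OF u], of \<alpha>] by (auto intro!: smooth_on_mult \<Omega>)
    obtain e1 where e1: "net_growth K J e1 (C \<alpha>)"
      using gf_infty_class(2)[OF coeffs[OF \<alpha>]] C \<alpha> unfolding coeff_representative_def by blast
    obtain e2 where e2: "net_growth K (J + mi_order \<alpha>) e2 u" using u K unfolding moderate_iff[OF \<Omega>] by blast
    show "\<exists>e. net_growth K J e (\<lambda>\<epsilon> x. C \<alpha> \<epsilon> x * Dpartial \<alpha> (u \<epsilon>) x)"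
      using net_growth_mult[OF \<Omega> K(2) coeff_smooth[OF C \<alpha>] smooth_net_Dpartial[OF \<Omega> moderate_smooth[OF u]]
          e1 net_growth_Dpartial[OF \<Omega> K(2) moderate_smooth[OF u] e2]] by blast
  qed
qed

lemma apply_op_rep_rel:
  assumes C: "coeff_representative m c C" and C': "coeff_representative m c C'" and uv: "(u, v) \<in> gf_rel \<Omega>"
  shows "(apply_op_rep m C u, apply_op_rep m C' v) \<in> gf_rel \<Omega>"
proof -
  have mu: "u \<in> moderate_gf \<Omega>" and mv: "v \<in> moderate_gf \<Omega>"
    and neg: "\<And>K J e. compact K \<Longrightarrow> K \<subseteq> \<Omega> \<Longrightarrow> net_growth K J e (\<lambda>\<epsilon> x. u \<epsilon> x - v \<epsilon> x)"
    using uv unfolding gf_rel_iff[OF \<Omega>] by auto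
  note su = moderate_smooth[OF mu] and sv = moderate_smooth[OF mv]
  have suv: "smooth_net \<Omega> (\<lambda>\<epsilon> x. u \<epsilon> x - v \<epsilon> x)" using su sv by (auto intro!: smooth_on_diff \<Omega>)
  have "net_growth K J e (\<lambda>\<epsilon> x. apply_op_rep m C u \<epsilon> x - apply_op_rep m C' v \<epsilon> x)" if K: "compact K" "K \<subseteq> \<Omega>" for K J e
  proof -
    define t where "t \<alpha> \<epsilon> x = C \<alpha> \<epsilon> x * Dpartial \<alpha> (\<lambda>x. u \<epsilon> x - v \<epsilon> x) x + (C \<alpha> \<epsilon> x - C' \<alpha> \<epsilon> x) * Dpartial \<alpha> (v \<epsilon>) x" for \<alpha> \<epsilon> x
    have "smooth_net \<Omega> (t \<alpha>) \<and> net_growth K J e (t \<alpha>)" if \<alpha>: "mi_order \<alpha> \<le> m" for \<alpha>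
    proof -
      have sC: "smooth_net \<Omega> (\<lambda>\<epsilon> x. C \<alpha> \<epsilon> x - C' \<alpha> \<epsilon> x)"
        using coeff_smooth[OF C \<alpha>] coeff_smooth[OF C' \<alpha>] by (auto intro!: smooth_on_diff \<Omega>)
      note sm = coeff_smooth[OF C \<alpha>] smooth_net_Dpartial[OF \<Omega> suv, of \<alpha>] sC smooth_net_Dpartial[OF \<Omega> sv, of \<alpha>]
      obtain e1 where e1: "net_growth K J e1 (C \<alpha>)"
        using gf_infty_class(2)[OF coeffs[OF \<alpha>]] C \<alpha> unfolding coeff_representative_def by blast
      obtain e2 where e2: "net_growth K (J + mi_order \<alpha>) e2 v" 
        using mv[unfolded moderate_iff[OF \<Omega>]] K by metis
      have g1: "net_growth K (J + mi_order \<alpha>) (e - e1) (\<lambda>\<epsilon> x. u \<epsilon> x - v \<epsilon> x)" by (rule neg[OF K])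
      have g2: "net_growth K J (e - e2) (\<lambda>\<epsilon> x. C \<alpha> \<epsilon> x - C' \<alpha> \<epsilon> x)"
        using gf_infty_class(3)[OF coeffs[OF \<alpha>]] C C' \<alpha> unfolding coeff_representative_def by blast
      have "net_growth K J (e1 + (e - e1)) (\<lambda>\<epsilon> x. C \<alpha> \<epsilon> x * Dpartial \<alpha> (\<lambda>x. u \<epsilon> x - v \<epsilon> x) x)"
        by (rule net_growth_mult[OF \<Omega> K(2) sm(1,2) e1 net_growth_Dpartial[OF \<Omega> K(2) suv g1]])
      moreover have "net_growth K J ((e - e2) + e2) (\<lambda>\<epsilon> x. (C \<alpha> \<epsilon> x - C' \<alpha> \<epsilon> x) * Dpartial \<alpha> (v \<epsilon>) x)"
        by (rule net_growth_mult[OF \<Omega> K(2) sm(3,4) g2 net_growth_Dpartial[OF \<Omega> K(2) sv e2]])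
      moreover have "smooth_net \<Omega> (\<lambda>\<epsilon> x. C \<alpha> \<epsilon> x * Dpartial \<alpha> (\<lambda>x. u \<epsilon> x - v \<epsilon> x) x)"
        "smooth_net \<Omega> (\<lambda>\<epsilon> x. (C \<alpha> \<epsilon> x - C' \<alpha> \<epsilon> x) * Dpartial \<alpha> (v \<epsilon>) x)"
        using smooth_on_mult[OF \<Omega>] sm by metis+
      moreover from this have "smooth_net \<Omega> (t \<alpha>)" unfolding t_def using smooth_on_add[OF \<Omega>] by metis
      ultimately show ?thesis
        using net_growth_add[OF \<Omega> K(2), of "\<lambda>\<epsilon> x. C \<alpha> \<epsilon> x * Dpartial \<alpha> (\<lambda>x. u \<epsilon> x - v \<epsilon> x) x" "\<lambda>\<epsilon> x. (C \<alpha> \<epsilon> x - C' \<alpha> \<epsilon> x) * Dpartial \<alpha> (v \<epsilon>) x" J e]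
        by (simp add: t_def[abs_def])
    qed
    then have "net_growth K J e (\<lambda>\<epsilon> x. \<Sum>\<alpha> | mi_order \<alpha> \<le> m. t \<alpha> \<epsilon> x)"
      by (intro net_growth_sum[OF \<Omega> K(2) finite_mi_order]) auto
    moreover have "\<forall>\<^sub>F \<epsilon> in at_right 0. \<forall>x\<in>\<Omega>. (\<Sum>\<alpha> | mi_order \<alpha> \<le> m. t \<alpha> \<epsilon> x) = apply_op_rep m C u \<epsilon> x - apply_op_rep m C' v \<epsilon> x"
      using eventually_unit
    proof eventually_elim
      case (elim \<epsilon>)
      have "Dpartial \<alpha> (\<lambda>x. u \<epsilon> x - v \<epsilon> x) x = Dpartial \<alpha> (u \<epsilon>) x - Dpartial \<alpha> (v \<epsilon>) x" if "x \<in> \<Omega>" for \<alpha> x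
        using foldr_partial_diff[of "u \<epsilon>" \<Omega> "v \<epsilon>" x] su sv elim \<Omega> that
        by (simp add: Dpartial_def mpartial_def right_diff_distrib)
      then show ?case
        unfolding t_def apply_op_rep_def sum_subtractf[symmetric]
        by (intro ballI sum.cong refl) (simp add: left_diff_distrib right_diff_distrib)
    qed
    ultimately show ?thesis by (rule net_growth_cong[OF \<Omega> K(2), rotated])
  qed
  then show ?thesis
    using apply_op_rep_moderate[OF C mu] apply_op_rep_moderate[OF C' mv] by (simp add: gf_rel_iff[OF \<Omega>])
qed

lemma apply_op_class:
  assumes C: "coeff_representative m c C" and U: "U \<in> gf \<Omega>" "u \<in> U"
  shows "apply_op m c \<Omega> U = gf_rel \<Omega> `` {apply_op_rep m C u}"
proof -
  have "apply_op m c \<Omega> U = (\<Union>v\<in>{apply_op_rep m C' u' | C' u'. coeff_representative m c C' \<and> u' \<in> U}. gf_rel \<Omega> `` {v})"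
    unfolding apply_op_def by blast
  also have "\<dots> = gf_rel \<Omega> `` {apply_op_rep m C u}"
    by (rule union_of_equal_classes[OF \<Omega>])
       (use C U apply_op_rep_rel[OF C _ gf_class(3)[OF \<Omega> U]] in blast)+
  finally show ?thesis .
qed

end

section \<open>Local solvability\<close>

lemma sol_const_nonneg:
  assumes "M \<ge> 1" "D \<ge> 0"
  shows "sol_const TYPE('n::finite) M s D \<ge> 0"
  unfolding sol_const_def
  using assms japanese_sum_pos[where 'n = 'n] decay_const_nonneg[where 'n = 'n] bump_bound(1)[where 'n = 'n]
  by (intro mult_nonneg_nonneg zero_le_power add_nonneg_nonneg) (auto intro: less_imp_le)

lemma log_deriv_bounded_mono:
  assumes "log_deriv_bounded p R J D" "D \<le> D'" "J' \<le> J"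
  shows "log_deriv_bounded p R J' D'"
  unfolding log_deriv_bounded_def
proof (intro allI impI)
  fix \<xi> x :: "real^'a" and "is" :: "'a list" assume "norm \<xi> \<ge> R" "length is \<le> J'"
  then have "cmod (foldr partial is (\<lambda>y. p y \<xi>) x) \<le> D * cmod (p x \<xi>)"
    using assms(1,3) by (auto simp: log_deriv_bounded_def)
  also have "\<dots> \<le> D' * cmod (p x \<xi>)" using assms(2) by (intro mult_right_mono) auto
  finally show "cmod (foldr partial is (\<lambda>y. p y \<xi>) x) \<le> D' * cmod (p x \<xi>)" .
qed

lemma log_deriv_bounded_of_symbol_deriv:
  fixes p :: "real \<Rightarrow> real^'n::finite \<Rightarrow> real^'n \<Rightarrow> complex"
  assumes s: "\<And>\<epsilon> \<xi>. \<epsilon> \<in> {0<..1} \<Longrightarrow> (\<lambda>y. p \<epsilon> y \<xi>) \<in> smooth_on UNIV"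
    and iii: "\<And>\<beta>. \<exists>d :: real \<Rightarrow> real. d \<in> O[at_right 0](\<lambda>_. 1) \<and>
      (\<forall>x \<xi>. \<forall>\<epsilon>\<in>{0<..1}. norm \<xi> \<ge> R \<longrightarrow>
        cmod (symbol_deriv (\<lambda>_. 0) \<beta> (p \<epsilon>) x \<xi>) \<le> d \<epsilon> * cmod (p \<epsilon> x \<xi>) * bracket \<xi> powr (- real (mi_order (\<lambda>_::'n. 0))))"
  shows "\<epsilon> \<in> {0<..1} \<Longrightarrow> \<exists>D. log_deriv_bounded (p \<epsilon>) R J D"
    and "\<exists>D\<ge>0. \<forall>\<^sub>F \<epsilon> in at_right 0. log_deriv_bounded (p \<epsilon>) R J D"
proof -
  define A where "A = {\<beta> :: 'n multiindex. mi_order \<beta> \<le> J}"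
  have A: "finite A" unfolding A_def by (rule finite_mi_order)
  have "bracket \<xi> \<noteq> 0" for \<xi> :: "real^'n" by (simp add: bracket_def add_nonneg_eq_0_iff)
  then have br: "bracket \<xi> powr (- real (mi_order (\<lambda>_::'n. 0))) = 1" for \<xi> :: "real^'n"
    by (simp add: mi_order_def powr_def)
  obtain d where d: "\<And>\<beta>. d \<beta> \<in> O[at_right 0](\<lambda>_. 1 :: real)"
    "\<And>\<beta> x \<xi> \<epsilon>. \<epsilon> \<in> {0<..1} \<Longrightarrow> norm \<xi> \<ge> R \<Longrightarrow> cmod (mpartial \<beta> (\<lambda>y. p \<epsilon> y \<xi>) x) \<le> d \<beta> \<epsilon> * cmod (p \<epsilon> x \<xi>)"
    using iii unfolding br symbol_deriv_def mpartial_zero mult_1_right by metis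
  have main: "log_deriv_bounded (p \<epsilon>) R J (\<Sum>\<beta>\<in>A. \<bar>c \<beta>\<bar>)"
    if \<epsilon>: "\<epsilon> \<in> {0<..1}" and c: "\<And>\<beta>. \<beta> \<in> A \<Longrightarrow> d \<beta> \<epsilon> \<le> c \<beta>" for \<epsilon> c
    unfolding log_deriv_bounded_def
  proof (intro allI impI)
    fix \<xi> x :: "real^'n" and "is" :: "'n list" assume *: "norm \<xi> \<ge> R" "length is \<le> J"
    then have a: "count_list is \<in> A" by (simp add: A_def mi_order_count_list)
    have "cmod (foldr partial is (\<lambda>y. p \<epsilon> y \<xi>) x) = cmod (mpartial (count_list is) (\<lambda>y. p \<epsilon> y \<xi>) x)"
      by (simp add: mpartial_count_list[OF s[OF \<epsilon>] open_UNIV])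
    also have "\<dots> \<le> d (count_list is) \<epsilon> * cmod (p \<epsilon> x \<xi>)" by (rule d(2)[OF \<epsilon> *(1)])
    also have "\<dots> \<le> (\<Sum>\<beta>\<in>A. \<bar>c \<beta>\<bar>) * cmod (p \<epsilon> x \<xi>)"
    proof (intro mult_right_mono)
      have "\<bar>c (count_list is)\<bar> \<le> (\<Sum>\<beta>\<in>A. \<bar>c \<beta>\<bar>)" using a A by (intro member_le_sum) auto
      then show "d (count_list is) \<epsilon> \<le> (\<Sum>\<beta>\<in>A. \<bar>c \<beta>\<bar>)" using c[OF a] by linarith
    qed simp
    finally show "cmod (foldr partial is (\<lambda>y. p \<epsilon> y \<xi>) x) \<le> (\<Sum>\<beta>\<in>A. \<bar>c \<beta>\<bar>) * cmod (p \<epsilon> x \<xi>)" .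
  qed
  show "\<exists>D. log_deriv_bounded (p \<epsilon>) R J D" if "\<epsilon> \<in> {0<..1}"
    using main[OF that, of "\<lambda>\<beta>. d \<beta> \<epsilon>"] by blast
  have "\<exists>c. \<forall>\<^sub>F \<epsilon> in at_right 0. d \<beta> \<epsilon> \<le> c" for \<beta>
  proof -
    obtain c where "\<forall>\<^sub>F \<epsilon> in at_right 0. norm (d \<beta> \<epsilon>) \<le> c * norm (1 :: real)" using landau_o.bigE[OF d(1)] by blast
    then have "\<forall>\<^sub>F \<epsilon> in at_right 0. d \<beta> \<epsilon> \<le> c" by eventually_elim auto
    then show ?thesis ..
  qed
  then obtain c where c: "\<And>\<beta>. \<forall>\<^sub>F \<epsilon> in at_right 0. d \<beta> \<epsilon> \<le> c \<beta>" by metis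
  have "\<forall>\<^sub>F \<epsilon> in at_right 0. \<forall>\<beta>\<in>A. d \<beta> \<epsilon> \<le> c \<beta>" using c by (intro eventually_ball_finite A) auto
  then have "\<forall>\<^sub>F \<epsilon> in at_right 0. log_deriv_bounded (p \<epsilon>) R J (\<Sum>\<beta>\<in>A. \<bar>c \<beta>\<bar>)"
    using eventually_unit by eventually_elim (use main in blast)
  then show "\<exists>D\<ge>0. \<forall>\<^sub>F \<epsilon> in at_right 0. log_deriv_bounded (p \<epsilon>) R J D"
    by (intro exI[of _ "\<Sum>\<beta>\<in>A. \<bar>c \<beta>\<bar>"]) (simp add: sum_nonneg)
qed

definition solution_net ::
  "(real \<Rightarrow> real^'n::finite \<Rightarrow> real^'n \<Rightarrow> complex) \<Rightarrow> real^'n \<Rightarrow> real \<Rightarrow> real \<Rightarrow> 'n cfun net \<Rightarrow> 'n cfun net" where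
  "solution_net p x0 M \<epsilon>0 f = (\<lambda>\<epsilon>. if \<epsilon> < \<epsilon>0 then wave_series (lattice_freq M) (sol_coeff (p \<epsilon>) x0 M (f \<epsilon>)) else (\<lambda>_. 0))"

locale local_problem_net =
  fixes p :: "real \<Rightarrow> real^'n::finite \<Rightarrow> real^'n \<Rightarrow> complex" and x0 :: "real^'n" and R M D0 \<kappa> a \<epsilon>0 :: real
  assumes \<epsilon>0: "0 < \<epsilon>0" "\<epsilon>0 \<le> 1" and \<kappa>: "\<kappa> > 0"
    and problem: "\<And>\<epsilon>. 0 < \<epsilon> \<Longrightarrow> \<epsilon> < \<epsilon>0 \<Longrightarrow> local_problem (p \<epsilon>) x0 R M D0 (\<kappa> * \<epsilon> powr a)"
    and uniform: "\<And>J. \<exists>D. \<forall>\<^sub>F \<epsilon> in at_right 0. log_deriv_bounded (p \<epsilon>) R J D"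
begin

lemma eventually_small: "\<forall>\<^sub>F \<epsilon> in at_right 0. 0 < \<epsilon> \<and> \<epsilon> < \<epsilon>0"
  by (rule eventually_at_rightI[of 0 \<epsilon>0]) (use \<epsilon>0 in auto)

lemma solution_net_smooth:
  assumes "smooth_net UNIV f"
  shows "smooth_net \<Omega> (solution_net p x0 M \<epsilon>0 f)"
proof
  fix \<epsilon> :: real assume \<epsilon>: "\<epsilon> \<in> {0<..1}"
  show "solution_net p x0 M \<epsilon>0 f \<epsilon> \<in> smooth_on \<Omega>"
  proof (cases "\<epsilon> < \<epsilon>0")
    case True
    then interpret local_problem "p \<epsilon>" x0 R M D0 "\<kappa> * \<epsilon> powr a" using problem \<epsilon> by auto
    show ?thesis using True assms \<epsilon> by (simp add: solution_net_def smooth_on_wave_series sol_coeff_rapid)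
  qed (simp add: solution_net_def)
qed

lemma solution_net_growth:
  assumes f: "smooth_net UNIV f" and g: "net_growth (cball x0 (2 / M)) (2 * Suc J * CARD('n)) e f"
  shows "net_growth K J (e - a) (solution_net p x0 M \<epsilon>0 f)"
proof -
  obtain D1 where "\<forall>\<^sub>F \<epsilon> in at_right 0. log_deriv_bounded (p \<epsilon>) R (2 * Suc J * CARD('n)) D1" using uniform by blast
  moreover define D where "D = max D1 D0"
  ultimately have D: "\<forall>\<^sub>F \<epsilon> in at_right 0. log_deriv_bounded (p \<epsilon>) R (2 * Suc J * CARD('n)) D"
    by (auto elim!: eventually_mono intro: log_deriv_bounded_mono)
  obtain C where C: "C \<ge> 0" "\<forall>\<^sub>F \<epsilon> in at_right 0. derivs_bounded (cball x0 (2 / M)) (2 * Suc J * CARD('n)) (C * \<epsilon> powr e) (f \<epsilon>)"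
    using net_growthE[OF g] .
  interpret P: local_problem "p (\<epsilon>0 / 2)" x0 R M D0 "\<kappa> * (\<epsilon>0 / 2) powr a" using problem[of "\<epsilon>0 / 2"] \<epsilon>0 by simp
  have D_nn: "D \<ge> 0" using P.D0(2) by (simp add: D_def)
  define S where "S = (\<Sum>s\<le>J. sol_const TYPE('n) M s D)"
  have S: "sol_const TYPE('n) M s D \<le> S" if "s \<le> J" for s
    unfolding S_def using that sol_const_nonneg[OF P.M(1) D_nn] by (intro member_le_sum) auto
  have S0: "S \<ge> 0" unfolding S_def by (intro sum_nonneg sol_const_nonneg P.M(1) D_nn)
  show ?thesis
  proof (rule net_growthI[of "S * C / \<kappa>"])
    show "0 \<le> S * C / \<kappa>" using S0 C(1) \<kappa> by simp
    show "\<forall>\<^sub>F \<epsilon> in at_right 0. derivs_bounded K J (S * C / \<kappa> * \<epsilon> powr (e - a)) (solution_net p x0 M \<epsilon>0 f \<epsilon>)"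
      using D C(2) eventually_small
    proof eventually_elim
      case (elim \<epsilon>)
      interpret local_problem "p \<epsilon>" x0 R M D0 "\<kappa> * \<epsilon> powr a" using problem elim(3) by blast
      have fs: "f \<epsilon> \<in> smooth_on UNIV" using f elim(3) \<epsilon>0 by auto
      show ?case unfolding derivs_bounded_def
      proof (intro allI impI ballI)
        fix "is" :: "'n list" and x assume l: "length is \<le> J"
        define \<alpha> where "\<alpha> = count_list is"
        have \<alpha>: "mi_order \<alpha> = length is" by (simp add: \<alpha>_def mi_order_count_list)
        have le: "2 * Suc (mi_order \<alpha>) * CARD('n) \<le> 2 * Suc J * CARD('n)" using l by (simp add: \<alpha>)
        have "cmod (foldr partial is (solution_net p x0 M \<epsilon>0 f \<epsilon>) x) = cmod (mpartial \<alpha> (wave_series (lattice_freq M) (sol_coeff (p \<epsilon>) x0 M (f \<epsilon>))) x)"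
          unfolding \<alpha>_def using mpartial_count_list[OF smooth_on_wave_series[OF sol_coeff_rapid[OF fs], of UNIV] open_UNIV UNIV_I, of "is"] elim(3)
          by (simp add: solution_net_def)
        also have "\<dots> \<le> sol_const TYPE('n) M (mi_order \<alpha>) D * (C * \<epsilon> powr e) / (\<kappa> * \<epsilon> powr a)"
        proof (rule local_solution_bound[OF log_deriv_bounded_mono[OF elim(1) order_refl le] _ fs])
          show "derivs_bounded (ball x0 (2 / M)) (2 * Suc (mi_order \<alpha>) * CARD('n)) (C * \<epsilon> powr e) (f \<epsilon>)"
            by (rule derivs_bounded_mono[OF elim(2) le order_refl]) auto
        qed (use C(1) in \<open>simp_all add: D_def\<close>)
        also have "\<dots> \<le> S * (C * \<epsilon> powr e) / (\<kappa> * \<epsilon> powr a)"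
          using S[of "mi_order \<alpha>"] l C(1) \<kappa> by (intro divide_right_mono mult_right_mono) (auto simp: \<alpha>)
        also have "\<dots> = S * C / \<kappa> * \<epsilon> powr (e - a)" by (simp add: powr_diff)
        finally show "cmod (foldr partial is (solution_net p x0 M \<epsilon>0 f \<epsilon>) x) \<le> S * C / \<kappa> * \<epsilon> powr (e - a)" .
      qed
    qed
  qed
qed

lemma solution_net_moderate:
  assumes f: "f \<in> moderate_gf UNIV" and \<Omega>: "open \<Omega>"
  shows "solution_net p x0 M \<epsilon>0 f \<in> moderate_gf \<Omega>"
  unfolding moderate_iff[OF \<Omega>]
proof (intro conjI allI impI solution_net_smooth moderate_smooth[OF f])
  fix K :: "(real^'n) set" and J
  obtain e where "net_growth (cball x0 (2 / M)) (2 * Suc J * CARD('n)) e f"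
    using f unfolding moderate_iff[OF open_UNIV] by (metis compact_cball subset_UNIV)
  then show "\<exists>e. net_growth K J e (solution_net p x0 M \<epsilon>0 f)"
    using solution_net_growth[OF moderate_smooth[OF f]] by blast
qed

lemma solution_net_solves:
  assumes p: "p = op_symbol m C" and f: "smooth_net UNIV f"
  shows "\<forall>\<^sub>F \<epsilon> in at_right 0. \<forall>x\<in>ball x0 (1 / M). apply_op_rep m C (solution_net p x0 M \<epsilon>0 f) \<epsilon> x = bump ((2 * M) *\<^sub>R (x - x0)) * f \<epsilon> x"
  using eventually_small
proof eventually_elim
  case (elim \<epsilon>)
  interpret local_problem "p \<epsilon>" x0 R M D0 "\<kappa> * \<epsilon> powr a" using problem elim by blast
  have fs: "f \<epsilon> \<in> smooth_on UNIV" using f elim \<epsilon>0 by auto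
  have u: "solution_net p x0 M \<epsilon>0 f \<epsilon> = wave_series (lattice_freq M) (sol_coeff (p \<epsilon>) x0 M (f \<epsilon>))"
    using elim by (simp add: solution_net_def)
  show ?case
    using local_solution[OF fs] apply_op_rep_wave_series[where u = "solution_net p x0 M \<epsilon>0 f" and \<epsilon> = \<epsilon>, OF sol_coeff_rapid[OF fs] u, of m C] by (simp add: p)
qed

end

lemma gf_regular_growth:
  assumes U: "U \<in> gf_regular UNIV" and K: "compact K" "K \<noteq> {}"
  obtains u N where "u \<in> U" "\<And>J. net_growth K J (- real N) u"
proof -
  obtain u where u: "U \<in> gf UNIV" "u \<in> U" "\<And>K. compact K \<Longrightarrow> K \<noteq> {} \<Longrightarrow>
     \<exists>N::nat. \<forall>\<alpha>. (\<lambda>\<epsilon>. compact_seminorm K \<alpha> (u \<epsilon>)) \<in> O[at_right 0](\<lambda>\<epsilon>. \<epsilon> powr (- real N))"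
    using U unfolding gf_regular_def by auto
  then obtain N :: nat where N: "\<And>\<alpha>. (\<lambda>\<epsilon>. compact_seminorm K \<alpha> (u \<epsilon>)) \<in> O[at_right 0](\<lambda>\<epsilon>. \<epsilon> powr (- real N))"
    using K by blast
  have s: "smooth_net UNIV u" using gf_class(2)[OF open_UNIV u(1,2)] by (rule moderate_smooth)
  have "net_growth K J (- real N) u" for J
    by (rule net_growth_of_bigo[where p = "compact_seminorm K", OF _ open_UNIV subset_UNIV s N])
       (use compact_seminorm_upper[OF _ K(1) subset_UNIV] s in auto)
  then show ?thesis using that u(2) by blast
qed

theorem proposition2p9:
  fixes c :: "'n::finite multiindex \<Rightarrow> 'n cfun net set"
    and C :: "'n multiindex \<Rightarrow> 'n cfun net"
    and m :: nat
    and a m' R :: real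
  assumes coeffs: "\<And>\<alpha>. mi_order \<alpha> \<le> m \<Longrightarrow> c \<alpha> \<in> gf_infty"
    and m': "0 \<le> m'" "m' \<le> real m"
    and R: "R > 0"
    and rep: "coeff_representative m c C"
    and i: "\<And>\<alpha> \<beta>. (\<lambda>\<epsilon>. symbol_seminorm m \<alpha> \<beta> (op_symbol m C \<epsilon>)) \<in> O[at_right 0](\<lambda>\<epsilon>. \<epsilon> powr a)"
    and ii: "\<exists>k>0. \<forall>x \<xi>. \<forall>\<epsilon>\<in>{0<..1}. norm \<xi> \<ge> R \<longrightarrow>
               cmod (op_symbol m C \<epsilon> x \<xi>) \<ge> k * \<epsilon> powr a * bracket \<xi> powr m'"
    and iii: "\<And>\<alpha> \<beta>. \<exists>d :: real \<Rightarrow> real. d \<in> O[at_right 0](\<lambda>_. 1) \<and>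
               (\<forall>x \<xi>. \<forall>\<epsilon>\<in>{0<..1}. norm \<xi> \<ge> R \<longrightarrow>
                  cmod (symbol_deriv \<alpha> \<beta> (op_symbol m C \<epsilon>) x \<xi>)
                    \<le> d \<epsilon> * cmod (op_symbol m C \<epsilon> x \<xi>) * bracket \<xi> powr (- real (mi_order \<alpha>)))"
  shows "\<forall>x0. \<exists>\<Omega> \<phi>. open \<Omega> \<and> x0 \<in> \<Omega> \<and>
           \<phi> \<in> test_functions \<Omega> \<and> (\<forall>\<^sub>F x in nhds x0. \<phi> x = 1) \<and>
           (\<forall>f\<in>gf UNIV. \<exists>u\<in>gf \<Omega>. apply_op m c \<Omega> u = mult_restrict \<Omega> \<phi> f) \<and>
           (\<forall>f\<in>gf_regular UNIV. \<exists>u\<in>gf_regular \<Omega>. apply_op m c \<Omega> u = mult_restrict \<Omega> \<phi> f)"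
proof
  fix x0 :: "real^'n"
  define p where "p = op_symbol m C"
  have p_smooth: "(\<lambda>y. p \<epsilon> y \<xi>) \<in> smooth_on UNIV" if "\<epsilon> \<in> {0<..1}" for \<epsilon> \<xi>
    unfolding p_def op_symbol_def
  proof (intro smooth_on_sum smooth_on_mult smooth_on_const open_UNIV)
    fix \<alpha> :: "'n multiindex" assume "\<alpha> \<in> {\<alpha>. mi_order \<alpha> \<le> m}"
    then show "C \<alpha> \<epsilon> \<in> smooth_on UNIV"
      using coeff_smooth[OF coeffs open_UNIV rep, of \<alpha>] that by simp
  qed
  note iii0 = iii[of "\<lambda>_. 0", folded p_def]
  have logd: "\<epsilon> \<in> {0<..1} \<Longrightarrow> \<exists>D. log_deriv_bounded (p \<epsilon>) R J D"
    "\<exists>D\<ge>0. \<forall>\<^sub>F \<epsilon> in at_right 0. log_deriv_bounded (p \<epsilon>) R J D" for J \<epsilon>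
    by (rule log_deriv_bounded_of_symbol_deriv[where p = p and R = R], erule p_smooth, rule iii0, assumption?)+
  obtain k where k: "k > 0" "\<And>x \<xi> \<epsilon>. \<epsilon> \<in> {0<..1} \<Longrightarrow> norm \<xi> \<ge> R \<Longrightarrow>
      cmod (p \<epsilon> x \<xi>) \<ge> k * \<epsilon> powr a * bracket \<xi> powr m'"
    using ii unfolding p_def by blast
  have lower: "cmod (p \<epsilon> x \<xi>) \<ge> k * \<epsilon> powr a" if "\<epsilon> \<in> {0<..1}" "norm \<xi> \<ge> R" for \<epsilon> x \<xi>
  proof -
    have "bracket \<xi> \<ge> 1" by (simp add: bracket_def)
    then have "k * \<epsilon> powr a * 1 \<le> k * \<epsilon> powr a * bracket \<xi> powr m'"
      using k(1) m'(1) by (intro mult_left_mono ge_one_powr_ge_zero) auto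
    then show ?thesis using k(2)[OF that, of x] by simp
  qed
  obtain D0 where D0: "D0 \<ge> 0" "\<forall>\<^sub>F \<epsilon> in at_right 0. log_deriv_bounded (p \<epsilon>) R (2 * CARD('n)) D0"
    using logd(2) by blast
  then obtain b where b: "b > 0" "\<And>\<epsilon>. 0 < \<epsilon> \<Longrightarrow> \<epsilon> < b \<Longrightarrow> log_deriv_bounded (p \<epsilon>) R (2 * CARD('n)) D0"
    unfolding eventually_at_right_field by auto
  define \<epsilon>0 where "\<epsilon>0 = min b 1"
  define M where "M = 1 + 2 * R + 8 * real CARD('n) * D0 + 20 * real CARD('n) * japanese_sum TYPE('n) * decay_const TYPE('n) 1 * D0"
  have nn: "0 \<le> 8 * real CARD('n) * D0" "0 \<le> 20 * real CARD('n) * japanese_sum TYPE('n) * decay_const TYPE('n) 1 * D0"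
    using D0(1) japanese_sum_pos[where 'n = 'n] decay_const_nonneg[where 'n = 'n] by simp_all
  have M: "M \<ge> 1" "M \<ge> 2 * R" "M \<ge> 8 * real CARD('n) * D0"
      "M \<ge> 20 * real CARD('n) * japanese_sum TYPE('n) * decay_const TYPE('n) 1 * D0"
    using nn R unfolding M_def by linarith+
  interpret net: local_problem_net p x0 R M D0 k a \<epsilon>0
  proof (rule local_problem_net.intro)
    show "0 < \<epsilon>0" "\<epsilon>0 \<le> 1" "k > 0" using b k by (simp_all add: \<epsilon>0_def)
    show "\<exists>D. \<forall>\<^sub>F \<epsilon> in at_right 0. log_deriv_bounded (p \<epsilon>) R J D" for J using logd(2) by blast
    show "local_problem (p \<epsilon>) x0 R M D0 (k * \<epsilon> powr a)" if "0 < \<epsilon>" "\<epsilon> < \<epsilon>0" for \<epsilon>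
    proof
      have \<epsilon>: "\<epsilon> \<in> {0<..1}" "\<epsilon> < b" using that by (auto simp: \<epsilon>0_def)
      show "(\<lambda>y. p \<epsilon> y \<xi>) \<in> smooth_on UNIV" for \<xi> by (rule p_smooth[OF \<epsilon>(1)])
      show "log_deriv_bounded (p \<epsilon>) R (2 * CARD('n)) D0" by (rule b(2)[OF that(1) \<epsilon>(2)])
      show "\<exists>D. log_deriv_bounded (p \<epsilon>) R J D" for J by (rule logd(1)[OF \<epsilon>(1)])
      show "k * \<epsilon> powr a > 0" using k(1) that(1) by simp
      show "cmod (p \<epsilon> x0 \<xi>) \<ge> k * \<epsilon> powr a" if "norm \<xi> \<ge> R" for \<xi> by (rule lower[OF \<epsilon>(1) that])
    qed (fact M D0(1))+
  qed
  define \<Omega> where "\<Omega> = ball x0 (1 / M)"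
  define \<phi> where "\<phi> x = bump ((2 * M) *\<^sub>R (x - x0))" for x :: "real^'n"
  have M0: "M > 0" using M(1) by simp
  have \<Omega>: "open \<Omega>" "x0 \<in> \<Omega>" using M0 by (simp_all add: \<Omega>_def)
  have nrm: "norm ((2 * M) *\<^sub>R (x - x0)) = 2 * M * dist x0 x" for x
    using M0 by (simp add: dist_norm norm_minus_commute)
  have \<phi>_smooth: "\<phi> \<in> smooth_on UNIV"
    using smooth_on_affine[OF bump_smooth open_UNIV, of "- ((2 * M) *\<^sub>R x0)" "2 * M"]
    by (simp add: \<phi>_def[abs_def] scaleR_right_diff_distrib)
  have supp: "closure {x. \<phi> x \<noteq> 0} \<subseteq> cball x0 (3 / (4 * M))"
  proof (rule closure_minimal[OF _ closed_cball], rule subsetI, rule ccontr)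
    fix x assume x: "x \<in> {x. \<phi> x \<noteq> 0}" "x \<notin> cball x0 (3 / (4 * M))"
    then have "2 * M * dist x0 x \<ge> 3 / 2" using M0 by (simp add: field_simps)
    then have "\<phi> x = 0" unfolding \<phi>_def by (intro bump_eq_0) (simp only: nrm)
    then show False using x by simp
  qed
  have \<phi>_test: "\<phi> \<in> test_functions \<Omega>"
  proof -
    have "compact (closure {x. \<phi> x \<noteq> 0})"
      using compact_Int_closed[OF compact_cball closed_closure, of x0 "3 / (4 * M)" "{x. \<phi> x \<noteq> 0}"] supp by (simp add: Int_absorb1)
    moreover have "cball x0 (3 / (4 * M)) \<subseteq> \<Omega>"
      unfolding \<Omega>_def using M0 by (auto simp: field_simps)
    ultimately show ?thesis using supp \<phi>_smooth by (auto simp: test_functions_def)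
  qed
  have \<phi>_one: "\<forall>\<^sub>F x in nhds x0. \<phi> x = 1"
    unfolding eventually_nhds
  proof (intro exI conjI ballI)
    show "open (ball x0 (1 / (2 * M)))" "x0 \<in> ball x0 (1 / (2 * M))" using M0 by simp_all
    fix x assume "x \<in> ball x0 (1 / (2 * M))"
    then have "2 * M * dist x0 x \<le> 1" using M0 by (simp add: field_simps)
    then show "\<phi> x = 1" unfolding \<phi>_def by (intro bump_eq_1) (simp only: nrm)
  qed
  have solve: "gf_rel \<Omega> `` {solution_net p x0 M \<epsilon>0 f} \<in> gf \<Omega> \<and>
      apply_op m c \<Omega> (gf_rel \<Omega> `` {solution_net p x0 M \<epsilon>0 f}) = mult_restrict \<Omega> \<phi> F"
    if F: "F \<in> gf UNIV" "f \<in> F" for F f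
  proof -
    have fm: "f \<in> moderate_gf UNIV" by (rule gf_class(2)[OF open_UNIV F])
    note fs = moderate_smooth[OF fm]
    define u where "u = solution_net p x0 M \<epsilon>0 f"
    have u: "u \<in> moderate_gf \<Omega>" unfolding u_def by (rule net.solution_net_moderate[OF fm \<Omega>(1)])
    have uU: "u \<in> gf_rel \<Omega> `` {u}" using gf_rel_refl[OF \<Omega>(1) u] by blast
    have Pu: "apply_op_rep m C u \<in> moderate_gf \<Omega>" by (rule apply_op_rep_moderate[OF coeffs \<Omega>(1) rep u])
    have \<phi>f: "(\<lambda>\<epsilon> x. \<phi> x * f \<epsilon> x) \<in> moderate_gf \<Omega>"
      using restrict_smooth_mult[OF \<Omega>(1) \<phi>_smooth gf_rel_refl[OF open_UNIV fm]] by (simp add: gf_rel_iff[OF \<Omega>(1)])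
    have "net_growth K J e (\<lambda>\<epsilon> x. apply_op_rep m C u \<epsilon> x - \<phi> x * f \<epsilon> x)" if "K \<subseteq> \<Omega>" for K J e
    proof (rule net_growth_cong[OF \<Omega>(1) that _ net_growth_zero])
      show "\<forall>\<^sub>F \<epsilon> in at_right 0. \<forall>x\<in>\<Omega>. 0 = apply_op_rep m C u \<epsilon> x - \<phi> x * f \<epsilon> x"
        using net.solution_net_solves[OF p_def fs]
        by eventually_elim (simp add: u_def \<Omega>_def \<phi>_def)
    qed
    then have "(apply_op_rep m C u, \<lambda>\<epsilon> x. \<phi> x * f \<epsilon> x) \<in> gf_rel \<Omega>"
      using Pu \<phi>f by (simp add: gf_rel_iff[OF \<Omega>(1)])
    then show ?thesis
      using apply_op_class[OF coeffs \<Omega>(1) rep gf_classI[OF u] uU] class_eqI[OF \<Omega>(1)]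
        mult_restrict_class[OF \<Omega>(1) \<phi>_smooth F] gf_classI[OF u] by (simp add: u_def)
  qed
  have "\<exists>u\<in>gf \<Omega>. apply_op m c \<Omega> u = mult_restrict \<Omega> \<phi> F" if "F \<in> gf UNIV" for F
    using gf_class(1)[OF open_UNIV that] solve[OF that] by blast
  moreover have "\<exists>u\<in>gf_regular \<Omega>. apply_op m c \<Omega> u = mult_restrict \<Omega> \<phi> F" if F: "F \<in> gf_regular UNIV" for F
  proof -
    have "cball x0 (2 / M) \<noteq> {}" using M0 by simp
    then obtain f N where f: "f \<in> F" "\<And>J. net_growth (cball x0 (2 / M)) J (- real N) f"
      using gf_regular_growth[OF F compact_cball] by metis
    have F': "F \<in> gf UNIV" using F by (simp add: gf_regular_def)
    define u where "u = solution_net p x0 M \<epsilon>0 f"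
    have fs: "smooth_net UNIV f" by (rule moderate_smooth[OF gf_class(2)[OF open_UNIV F' f(1)]])
    have us: "smooth_net \<Omega> u" unfolding u_def by (rule net.solution_net_smooth[OF fs])
    have g: "net_growth K J (- real N - a) u" for K J
      unfolding u_def by (rule net.solution_net_growth[OF fs f(2)])
    have "(\<lambda>\<epsilon>. compact_seminorm K \<alpha> (u \<epsilon>)) \<in> O[at_right 0](\<lambda>\<epsilon>. \<epsilon> powr (- real (N + nat \<lceil>a\<rceil>)))"
      if K: "compact K" "K \<noteq> {}" "K \<subseteq> \<Omega>" for K \<alpha>
      by (rule landau_o.big.trans[OF net_growth_imp_bigo[OF K(1,3,2) us g order_refl] powr_bigo_mono]) linarith
    moreover have "u \<in> gf_rel \<Omega> `` {u}"
      using gf_rel_refl[OF \<Omega>(1) net.solution_net_moderate[OF gf_class(2)[OF open_UNIV F' f(1)] \<Omega>(1)]] by (simp add: u_def)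
    ultimately have "gf_rel \<Omega> `` {u} \<in> gf_regular \<Omega>"
      using solve[OF F' f(1)] unfolding gf_regular_def u_def[symmetric] by blast
    then show ?thesis using solve[OF F' f(1)] unfolding u_def by blast
  qed
  ultimately show "\<exists>\<Omega> \<phi>. open \<Omega> \<and> x0 \<in> \<Omega> \<and>
           \<phi> \<in> test_functions \<Omega> \<and> (\<forall>\<^sub>F x in nhds x0. \<phi> x = 1) \<and>
           (\<forall>f\<in>gf UNIV. \<exists>u\<in>gf \<Omega>. apply_op m c \<Omega> u = mult_restrict \<Omega> \<phi> f) \<and>
           (\<forall>f\<in>gf_regular UNIV. \<exists>u\<in>gf_regular \<Omega>. apply_op m c \<Omega> u = mult_restrict \<Omega> \<phi> f)"
    using \<Omega> \<phi>_test \<phi>_one by blast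
qed

end
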